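(* Let $\alpha(n) := N(0,2;n) - N(1,2;n)$ for $n \geq 1$, where $N(r,2;n)$ denotes the number of partitions of $n$ whose rank is congruent to $r$ modulo $2$. Let $D_n := -24n+1$, $l(n) := \pi\sqrt{|D_n|}/6$, and \[ q(n) := \frac{\log(|D_n|)}{\left|\log \log(|D_n|) - 1.1714\right|}. \] Then for all integers $n \geq 1$, \[ \alpha(n) = (-1)^{n+1} \frac{\sqrt{6}}{\sqrt{24n-1}} e^{l(n)/2} + E(n), \] where \[ |E(n)| < (4.30 \times 10^{23})\, 2^{q(n)} |D_n|^2 e^{l(n)/3}. \]
   Context: A partition of $n$ is a finite nondecreasing list of positive integers $\lambda = (\lambda_1 \le \lambda_2 \le \dots \le \lambda_k)$ with $\lambda_1 + \cdots + \lambda_k = n$. The rank of $\lambda$ is $\lambda_k - k$ (largest part minus number of parts). For integers $r$ and $t \ge 1$, $N(r,t;n)$ is the number of partitions of $n$ with rank congruent to $r$ modulo $t$. Equivalently, $\alpha(n)$ is the coefficient of $q^n$ in Ramanujan's mock theta function $f(q) = \sum_{m=0}^{\infty} \frac{q^{m^2}}{(1+q)^2(1+q^2)^2\cdots(1+q^m)^2}$. *)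

theory Defs
  imports Complex_Main "HOL-Number_Theory.Cong"
begin

definition partitions :: "nat \<Rightarrow> nat list set" where
  "partitions n = {xs. sorted xs \<and> (\<forall>x\<in>set xs. 0 < x) \<and> sum_list xs = n}"

lemma finite_partitions: "finite (partitions n)"
proof (rule finite_subset)
  have len: "length xs \<le> sum_list xs" if "\<forall>x\<in>set xs. 0 < x" for xs :: "nat list"
    using that by (induction xs) auto
  show "partitions n \<subseteq> {xs. set xs \<subseteq> {..n} \<and> length xs \<le> n}"
    using len by (auto simp: partitions_def intro: member_le_sum_list)
  show "finite {xs. set xs \<subseteq> {..n} \<and> length xs \<le> n}"
    by (rule finite_lists_length_le) simp
qed

text \<open>Parts are listed in nondecreasing order, so the last one is the largest.
  The empty partition (of 0) gets rank 0 by convention.\<close>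
definition rank :: "nat list \<Rightarrow> int" where
  "rank xs = (if xs = [] then 0 else int (last xs) - int (length xs))"

definition N :: "int \<Rightarrow> nat \<Rightarrow> nat \<Rightarrow> nat" where
  "N r t n = card {xs \<in> partitions n. [rank xs = r] (mod int t)}"

definition \<alpha> :: "nat \<Rightarrow> int" where
  "\<alpha> n = int (N 0 2 n) - int (N 1 2 n)"

definition D :: "nat \<Rightarrow> int" where
  "D n = - 24 * int n + 1"

definition l :: "nat \<Rightarrow> real" where
  "l n = pi * sqrt \<bar>D n\<bar> / 6"

definition q :: "nat \<Rightarrow> real" where
  "q n = ln \<bar>D n\<bar> / \<bar>ln (ln \<bar>D n\<bar>) - 1.1714\<bar>"

end

theory Submission
  imports "HOL-Complex_Analysis.Complex_Analysis" "HOL-Real_Asymp.Real_Asymp"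
    "HOL-Probability.Distributions" Defs
begin

text \<open>Summing over the largest part gives the generating function of \<open>(-1)\<^sup>n \<alpha>(n)\<close>. Euler's expansions
  and the Jacobi triple product rewrite it, for \<open>\<bar>x\<bar> < 1\<close>, as \<open>2 \<phi>(x) - \<theta>\<^sub>3(x) \<Prod>(1 + x\<^sup>2\<^sup>k\<^sup>+\<^sup>1)\<close>, where \<open>\<phi>\<close> is
  Ramanujan's other mock theta function of order three. On the circle of radius \<open>e\<^sup>-\<^sup>y\<close> with
  \<open>y = 2\<pi> / (3 \<surd>\<bar>D\<^sub>n\<bar>)\<close> the function \<open>\<phi>\<close> and the part of the theta product away from \<open>x = 1\<close> are small
  enough to contribute only \<open>e\<^bsup>l(n)/3\<^esup>\<close> up to a linear factor. Near \<open>x = 1\<close> the modular inversion of the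
  theta product, obtained for real \<open>x\<close> from a transformation of \<open>\<theta>\<^sub>3\<close> and extended by analytic
  continuation, leaves a single exponential, and the integral of that exponential is elementary:
  up to a small tail it is a constant times \<open>cosh (l(n)/2) / \<surd>\<bar>D\<^sub>n\<bar>\<close>.\<close>

text \<open>The strongest singularity of the generating function f(q) is at q = -1; writing q = -x
  moves it to x = 1 and produces the sign \<open>(-1) ^ (n + 1)\<close>. Let s be the square root of
  |D_n|. On the circle of radius e^(-y) the factor x^(-n) costs about exp(s^2 y / 24), while
  e^(l(n)/3) = exp(pi s / 18) is allowed in total. If everything discarded is of order exp(k pi^2 /
  y), the largest admissible k is 1/54, attained at y = 2 pi / (3 s). At the saddle point y = pi / s
  of the main exponential it would be only 1/72; the circle may leave the saddle because that
  exponential is integrated exactly. The obstacle is phi. Bounding each factor of its denominators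
  separately majorises it by Euler's series for the Weber product, of order exp(pi^2 / (24 y)), as
  large as the main term. Pairing consecutive factors leaves a Rogers-Ramanujan sum in e^(-4y), of
  order exp(pi^2 / (60 y)), which fits under 1/54 with little to spare. That bound depends on |x|
  only, so phi needs no dissection of the circle.\<close>

section \<open>Finite and infinite q-products\<close>

text \<open>In the usual notation this is the q-Pochhammer symbol (-a; p)_n. With the plus sign the
  denominators of the mock theta series and Weber's product appear without signs, while the usual
  (p; p)_n becomes \<open>qpoch (-p) p n\<close>.\<close>

definition qpoch :: "complex \<Rightarrow> complex \<Rightarrow> nat \<Rightarrow> complex" where
  "qpoch a p n = (\<Prod>k<n. 1 + a * p ^ k)"

definition qprod :: "complex \<Rightarrow> complex \<Rightarrow> complex" where
  "qprod a p = (\<Prod>k. 1 + a * p ^ k)"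

lemma qpoch_0 [simp]: "qpoch a p 0 = 1"
  by (simp add: qpoch_def)

lemma qpoch_Suc: "qpoch a p (Suc n) = qpoch a p n * (1 + a * p ^ n)"
  by (simp add: qpoch_def)

lemma qpoch_Suc_left: "qpoch a p (Suc n) = (1 + a) * qpoch (a * p) p n"
  unfolding qpoch_def by (subst prod.lessThan_Suc_shift) (simp add: mult.assoc)

lemma norm_power_less_1: "norm (p::complex) < 1 \<Longrightarrow> norm (p ^ Suc n) < 1"
  by (simp add: norm_power power_less_one_iff del: power_Suc)

lemma one_plus_power_nonzero:
  assumes "norm (a::complex) < 1" "norm p < 1"
  shows "1 + a * p ^ k \<noteq> 0"
proof
  assume "1 + a * p ^ k = 0"
  hence "norm (a * p ^ k) = 1" by (metis add_eq_0_iff norm_minus_cancel norm_one)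
  moreover have "norm (a * p ^ k) \<le> norm a * 1" unfolding norm_mult norm_power
    using assms by (intro mult_left_mono power_le_one) auto
  ultimately show False using assms by simp
qed

lemma qpoch_nonzero:
  assumes "norm a < 1" "norm p < 1"
  shows "qpoch a p n \<noteq> 0"
  using one_plus_power_nonzero[OF assms] by (simp add: qpoch_def)

lemma abs_convergent_qprod:
  assumes "norm (p::complex) < 1"
  shows "abs_convergent_prod (\<lambda>k. 1 + a * p ^ k)"
proof (rule summable_imp_abs_convergent_prod)
  show "summable (\<lambda>k. norm (1 + a * p ^ k - 1))"
    using assms by (simp add: norm_mult norm_power summable_mult summable_geometric)
qed

lemma convergent_qprod:
  "norm (p::complex) < 1 \<Longrightarrow> convergent_prod (\<lambda>k. 1 + a * p ^ k)"
  by (intro abs_convergent_prod_imp_convergent_prod abs_convergent_qprod)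

lemma qpoch_tendsto:
  assumes "norm p < 1"
  shows "(\<lambda>n. qpoch a p n) \<longlonglongrightarrow> qprod a p"
  using convergent_prod_LIMSEQ[OF convergent_qprod[OF assms]]
  unfolding qpoch_def qprod_def by (subst LIMSEQ_lessThan_iff_atMost)

lemma qprod_rec:
  assumes "norm p < 1"
  shows "qprod a p = (1 + a) * qprod (a * p) p"
proof (rule LIMSEQ_unique)
  show "(\<lambda>n. qpoch a p (Suc n)) \<longlonglongrightarrow> qprod a p"
    using qpoch_tendsto[OF assms] by (rule LIMSEQ_Suc)
  show "(\<lambda>n. qpoch a p (Suc n)) \<longlonglongrightarrow> (1 + a) * qprod (a * p) p"
    unfolding qpoch_Suc_left by (intro tendsto_intros qpoch_tendsto assms)
qed

lemma qprod_split:
  assumes "norm p < 1"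
  shows "qprod a p = qpoch a p n * qprod (a * p ^ n) p"
proof (induction n)
  case (Suc n)
  thus ?case using qprod_rec[OF assms, of "a * p ^ n"] by (simp add: qpoch_Suc mult_ac)
qed auto

lemma qprod_nonzero:
  assumes "norm a < 1" "norm p < 1"
  shows "qprod a p \<noteq> 0"
  unfolding qprod_def using one_plus_power_nonzero[OF assms]
  by (intro prodinf_nonzero convergent_qprod assms) auto

lemma Bseq_inverse_qpoch:
  assumes "norm a < 1" "norm p < 1"
  shows "Bseq (\<lambda>n. inverse (qpoch a p n))"
  by (rule convergent_imp_Bseq, rule convergentI, rule tendsto_inverse[OF qpoch_tendsto])
     (use assms qprod_nonzero in auto)

text \<open>The products converge to a nonzero limit, so their inverses stay bounded. The uniform
  constant yields geometric majorants for series that have such products in the denominator.\<close>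

lemma inverse_qpoch_bounded:
  assumes "norm a < 1" "norm p < 1"
  obtains C where "C > 0" "\<And>n. norm (inverse (qpoch a p n)) \<le> C"
  using Bseq_inverse_qpoch[OF assms] unfolding Bseq_def by blast

lemma norm_qpoch_le:
  assumes "norm p < 1"
  shows "norm (qpoch a p n) \<le> exp (norm a / (1 - norm p))"
proof -
  have "norm (qpoch a p n) \<le> (\<Prod>k<n. 1 + norm a * norm p ^ k)"
    unfolding qpoch_def prod_norm [symmetric]
    by (intro prod_mono) (auto simp: norm_mult norm_power intro: norm_triangle_ineq[THEN order_trans])
  also have "\<dots> \<le> exp (\<Sum>k<n. norm a * norm p ^ k)"
    by (intro prod_le_exp_sum) auto
  also have "(\<Sum>k<n. norm a * norm p ^ k) \<le> (\<Sum>k. norm a * norm p ^ k)"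
    using assms by (intro sum_le_suminf summable_mult summable_geometric) auto
  also have "\<dots> = norm a / (1 - norm p)"
    using assms by (simp add: suminf_mult suminf_geometric summable_geometric)
  finally show ?thesis by simp
qed

lemma norm_qprod_le:
  assumes "norm p < 1"
  shows "norm (qprod a p) \<le> exp (norm a / (1 - norm p))"
  by (rule LIMSEQ_le_const2[OF tendsto_norm[OF qpoch_tendsto[OF assms]]])
     (use norm_qpoch_le[OF assms] in auto)

subsection \<open>Euler's expansions\<close>

lemma choose_two_Suc: "Suc k choose 2 = k + (k choose 2)"
  by (simp add: numeral_2_eq_2)

text \<open>The ratio of consecutive terms is \<open>a * p ^ k / (1 - p * p ^ k)\<close>, which
  tends to 0. Hence \<open>a\<close> is unrestricted: the series is entire in \<open>a\<close>,
  unlike the one in \<open>summable_euler2\<close>.\<close>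

lemma summable_euler1:
  assumes "norm p < 1"
  shows "summable (\<lambda>k. norm (p ^ (k choose 2) / qpoch (-p) p k * a ^ k))"
proof (cases "p = 0")
  case True
  have "(k choose 2) \<noteq> 0" if "k \<ge> 2" for k using that by simp
  hence "(\<lambda>k. norm (p ^ (k choose 2) / qpoch (-p) p k * a ^ k)) k = 0" if "k \<ge> 2" for k
    using that True by simp
  thus ?thesis by (intro summable_finite[of "{..<2}"]) (auto simp: not_less)
next
  case False
  let ?f = "\<lambda>k. norm (p ^ (k choose 2) / qpoch (-p) p k * a ^ k)"
  have nz: "1 + - p * p ^ k \<noteq> 0" for k using one_plus_power_nonzero[of "-p" p] assms by simp
  have rec: "?f (Suc k) = norm (a * p ^ k / (1 + - p * p ^ k)) * ?f k" for k
    unfolding choose_two_Suc qpoch_Suc by (simp add: power_add norm_mult norm_divide mult_ac)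
  have "(\<lambda>k. norm (a * p ^ k / (1 + - p * p ^ k))) \<longlonglongrightarrow> norm (a * 0 / (1 + -p * 0))"
    by (intro tendsto_intros LIMSEQ_power_zero assms) auto
  hence "eventually (\<lambda>k. norm (a * p ^ k / (1 + - p * p ^ k)) < 1/2) sequentially"
    by (rule order_tendstoD) auto
  then obtain K where K: "\<And>k. k \<ge> K \<Longrightarrow> norm (a * p ^ k / (1 + - p * p ^ k)) < 1/2"
    unfolding eventually_sequentially by blast
  show ?thesis
  proof (rule summable_ratio_test[of "1/2" K])
    fix n assume n: "n \<ge> K"
    have "?f (Suc n) \<le> 1/2 * ?f n" unfolding rec
      by (intro mult_right_mono less_imp_le[OF K[OF n]]) auto
    thus "norm (?f (Suc n)) \<le> 1/2 * norm (?f n)" by simp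
  qed simp
qed

text \<open>The coefficient recurrence gives the functional equation
  \<open>g a = (1 + a) * g (a * p)\<close>. Iterating it extracts \<open>qpoch a p n\<close> and
  drives the argument to 0, where \<open>g\<close> is continuous with value 1.\<close>

theorem euler_sum1:
  assumes p: "norm p < 1"
  shows "(\<lambda>k. p ^ (k choose 2) / qpoch (-p) p k * a ^ k) sums qprod a p"
proof -
  define c where "c = (\<lambda>k. p ^ (k choose 2) / qpoch (-p) p k)"
  have summ: "summable (\<lambda>k. c k * a ^ k)" for a
    using summable_norm_cancel[OF summable_euler1[OF p]] unfolding c_def .
  define g where "g = (\<lambda>a. \<Sum>k. c k * a ^ k)"
  have g: "(\<lambda>k. c k * a ^ k) sums g a" for a
    unfolding g_def using summ by (rule summable_sums)
  have nz: "1 - p * p ^ k \<noteq> 0" for k using one_plus_power_nonzero[of "-p" p] p by simp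
  have cS: "c (Suc k) = p ^ k * c k + p ^ Suc k * c (Suc k)" for k
  proof -
    have "c (Suc k) = p ^ k * c k / (1 - p * p ^ k)"
      unfolding c_def choose_two_Suc qpoch_Suc by (simp add: power_add)
    thus ?thesis using nz[of k] by (simp add: field_simps)
  qed
  have rec: "g a = (1 + a) * g (a * p)" for a
  proof -
    have "(\<lambda>k. c (Suc k) * (a*p) ^ (Suc k)) sums (g (a * p) - c 0)"
      using g[of "a*p"] by (subst sums_Suc_iff) simp
    hence "(\<lambda>k. c (Suc k) * (a*p) ^ (Suc k) + a * (c k * (a * p) ^ k)) sums (g (a * p) - c 0 + a * g (a*p))"
      by (intro sums_add sums_mult g)
    also have "(\<lambda>k. c (Suc k) * (a*p) ^ (Suc k) + a * (c k * (a * p) ^ k)) = (\<lambda>k. c (Suc k) * a ^ Suc k)"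
      by (rule ext, subst (2) cS) (simp add: algebra_simps power_mult_distrib)
    finally have "(\<lambda>k. c k * a ^ k) sums (g (a * p) - c 0 + a * g (a*p) + c 0)"
      by (subst (asm) sums_Suc_iff) simp
    from sums_unique2[OF g this] show ?thesis by (simp add: algebra_simps)
  qed
  have split: "g a = qpoch a p n * g (a * p ^ n)" for n
  proof (induction n)
    case (Suc n)
    thus ?case using rec[of "a * p ^ n"] by (simp add: qpoch_Suc mult_ac)
  qed simp
  have "(g \<longlongrightarrow> c 0) (at 0)"
    by (rule powser_limit_0[of 1 c g]) (use g in auto)
  moreover have "g 0 = c 0" by (simp add: g_def powser_zero)
  ultimately have "isCont g 0" by (simp add: isCont_def)
  moreover have "(\<lambda>n. a * p ^ n) \<longlonglongrightarrow> 0"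
    using tendsto_mult[OF tendsto_const LIMSEQ_power_zero[OF p]] by simp
  ultimately have "(\<lambda>n. g (a * p ^ n)) \<longlonglongrightarrow> g 0"
    by (rule isCont_tendsto_compose)
  hence "(\<lambda>n. qpoch a p n * g (a * p ^ n)) \<longlonglongrightarrow> qprod a p * g 0"
    by (intro tendsto_mult qpoch_tendsto p)
  hence "g a = qprod a p * g 0"
    by (intro LIMSEQ_unique[OF tendsto_const]) (simp flip: split)
  hence "g a = qprod a p" by (simp add: \<open>g 0 = c 0\<close> c_def numeral_2_eq_2)
  with g[of a] show ?thesis by (simp add: c_def)
qed

lemma summable_euler2:
  assumes "norm p < 1" "norm a < 1"
  shows "summable (\<lambda>k. norm (1 / qpoch (-p) p k * a ^ k))"
proof -
  obtain C where C: "C > 0" "\<And>n. norm (inverse (qpoch (-p) p n)) \<le> C"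
    using inverse_qpoch_bounded[of "-p" p] assms by auto
  show ?thesis
  proof (rule summable_comparison_test')
    show "summable (\<lambda>k. C * norm a ^ k)"
      using assms by (intro summable_mult summable_geometric) auto
    show "norm (norm (1 / qpoch (-p) p k * a ^ k)) \<le> C * norm a ^ k" for k
      using mult_right_mono[OF C(2)[of k], of "norm a ^ k"]
      by (simp add: norm_power norm_divide norm_inverse field_simps)
  qed
qed

text \<open>The same device with \<open>(1 - a) * g a = g (a * p)\<close>. The reciprocal product
  has a pole at \<open>a = 1\<close>, which is the reason for the bound on
  \<open>norm a\<close>.\<close>

theorem euler_sum2:
  assumes p: "norm p < 1" and a: "norm a < 1"
  shows "(\<lambda>k. 1 / qpoch (-p) p k * a ^ k) sums (1 / qprod (-a) p)"
proof -
  define c where "c = (\<lambda>k. 1 / qpoch (-p) p k)"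
  have summ: "summable (\<lambda>k. c k * a ^ k)" if "norm a < 1" for a
    using summable_norm_cancel[OF summable_euler2[OF p that]] unfolding c_def .
  define g where "g = (\<lambda>a. \<Sum>k. c k * a ^ k)"
  have g: "(\<lambda>k. c k * a ^ k) sums g a" if "norm a < 1" for a
    unfolding g_def using summ[OF that] by (rule summable_sums)
  have nz: "1 - p * p ^ k \<noteq> 0" for k using one_plus_power_nonzero[of "-p" p] p by simp
  have cS: "p ^ Suc k * c (Suc k) = c (Suc k) - c k" for k
    unfolding c_def qpoch_Suc using nz[of k] qpoch_nonzero[of "-p" p] p by (simp add: field_simps)
  have ap: "norm (a * p ^ n) < 1" for n
    using mult_left_mono[OF power_le_one[of "norm p" n], of "norm a"] p a
    by (simp add: norm_mult norm_power)
  have rec: "(1 - a) * g a = g (a * p)" if a: "norm a < 1" for a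
  proof -
    have *: "norm (a * p) < 1" using mult_left_mono[of "norm p" 1 "norm a"] p a by (simp add: norm_mult)
    have "(\<lambda>k. c (Suc k) * a ^ (Suc k)) sums (g a - c 0)"
      using g[OF a] by (subst sums_Suc_iff) simp
    hence "(\<lambda>k. c (Suc k) * a ^ (Suc k) - a * (c k * a ^ k)) sums (g a - c 0 - a * g a)"
      by (intro sums_diff sums_mult g a)
    also have "(\<lambda>k. c (Suc k) * a ^ (Suc k) - a * (c k * a ^ k)) = (\<lambda>k. c (Suc k) * (a * p) ^ Suc k)"
    proof
      fix k
      have "c (Suc k) * (a * p) ^ Suc k = (p ^ Suc k * c (Suc k)) * a ^ Suc k"
        by (simp add: power_mult_distrib)
      also have "\<dots> = (c (Suc k) - c k) * a ^ Suc k" by (subst cS) simp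
      finally show "c (Suc k) * a ^ (Suc k) - a * (c k * a ^ k) = c (Suc k) * (a * p) ^ Suc k"
        by (simp add: algebra_simps)
    qed
    finally have "(\<lambda>k. c k * (a*p) ^ k) sums (g a - c 0 - a * g a + c 0)"
      by (subst (asm) sums_Suc_iff) simp
    from sums_unique2[OF g[OF *] this] show ?thesis by (simp add: algebra_simps)
  qed
  have split: "qpoch (-a) p n * g a = g (a * p ^ n)" for n
  proof (induction n)
    case (Suc n)
    have "qpoch (-a) p (Suc n) * g a = (1 - a * p ^ n) * (qpoch (-a) p n * g a)"
      by (simp add: qpoch_Suc)
    also have "\<dots> = g (a * p ^ Suc n)"
      unfolding Suc by (subst rec[OF ap]) (simp add: mult_ac)
    finally show ?case .
  qed simp
  have "(g \<longlongrightarrow> c 0) (at 0)"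
    by (rule powser_limit_0[of 1 c g]) (use g in auto)
  moreover have "g 0 = c 0" by (simp add: g_def powser_zero)
  ultimately have "isCont g 0" by (simp add: isCont_def)
  moreover have "(\<lambda>n. a * p ^ n) \<longlonglongrightarrow> 0"
    using tendsto_mult[OF tendsto_const LIMSEQ_power_zero[OF p]] by simp
  ultimately have "(\<lambda>n. g (a * p ^ n)) \<longlonglongrightarrow> g 0"
    by (rule isCont_tendsto_compose)
  moreover have "(\<lambda>n. qpoch (-a) p n * g a) \<longlonglongrightarrow> qprod (-a) p * g a"
    by (intro tendsto_intros qpoch_tendsto p)
  ultimately have "qprod (-a) p * g a = g 0"
    unfolding split by (rule LIMSEQ_unique[rotated])
  hence "g a = 1 / qprod (-a) p"
    using qprod_nonzero[of "-a" p] a p by (simp add: \<open>g 0 = c 0\<close> c_def field_simps)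
  with g[OF a] show ?thesis by (simp add: c_def)
qed

section \<open>Rearrangement of dominated double series\<close>

lemma summable_on_product_bound:
  fixes f :: "'a \<times> 'b \<Rightarrow> 'c :: banach"
  assumes a: "a summable_on A" and b: "b summable_on B"
    and nonneg: "\<And>x. x \<in> A \<Longrightarrow> (0::real) \<le> a x" "\<And>y. y \<in> B \<Longrightarrow> (0::real) \<le> b y"
    and le: "\<And>x y. x \<in> A \<Longrightarrow> y \<in> B \<Longrightarrow> norm (f (x, y)) \<le> a x * b y"
  shows "f summable_on (A \<times> B)"
proof (rule Infinite_Sum.abs_summable_summable, rule Infinite_Sum.abs_summable_on_comparison_test')
  show "(\<lambda>(x, y). a x * b y) summable_on (A \<times> B)"
  proof (rule summable_on_SigmaI)
    show "((\<lambda>y. case (x, y) of (x, y) \<Rightarrow> a x * b y) has_sum a x * infsum b B) B" if "x \<in> A" for x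
      by simp (intro has_sum_cmult_right has_sum_infsum b)
    show "(\<lambda>x. a x * infsum b B) summable_on A"
      by (intro summable_on_cmult_left a)
  qed (use nonneg in auto)
qed (use le in auto)

lemma summable_on_nat_nonneg:
  fixes f :: "nat \<Rightarrow> real"
  shows "summable f \<Longrightarrow> (\<And>n. 0 \<le> f n) \<Longrightarrow> f summable_on UNIV"
  by (simp add: summable_on_UNIV_nonneg_real_iff)

text \<open>One absolutely summable double series is evaluated by rows, by columns and along
  antidiagonals. The column statement is an implication, so that closed forms of the column sums may
  be supplied afterwards.\<close>

lemma dominated_double_sums:
  fixes f :: "nat \<Rightarrow> nat \<Rightarrow> complex"
  assumes a: "summable a" and b: "summable b"
    and le: "\<And>m k. norm (f m k) \<le> a m * b k"
    and nonneg: "\<And>m. 0 \<le> a m" "\<And>k. 0 \<le> b k"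
    and rows: "\<And>m. f m sums g m"
  obtains S where "g sums S" "\<And>h. (\<And>k. (\<lambda>m. f m k) sums h k) \<Longrightarrow> h sums S"
    "(\<lambda>n. \<Sum>k\<le>n. f (n - k) k) sums S"
proof -
  have summ': "(\<lambda>(m, k). f m k) summable_on (UNIV \<times> UNIV)"
    by (rule summable_on_product_bound[of a _ b])
       (use assms in \<open>auto intro: summable_on_nat_nonneg\<close>)
  define S where "S = infsum (\<lambda>(m, k). f m k) (UNIV \<times> UNIV)"
  have S: "((\<lambda>(m, k). f m k) has_sum S) (UNIV \<times> UNIV)"
    unfolding S_def using summ' by (rule has_sum_infsum)
  have row: "(f m has_sum g m) UNIV" for m
  proof (rule norm_summable_imp_has_sum[OF _ rows])
    show "summable (\<lambda>k. norm (f m k))"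
      by (rule summable_comparison_test'[OF summable_mult[OF b]]) (use le in auto)
  qed
  have 1: "g sums S"
    by (rule has_sum_imp_sums, rule has_sum_SigmaD[OF S]) (use row in auto)
  have 2: "h sums S" if h: "\<And>k. (\<lambda>m. f m k) sums h k" for h
  proof -
    have col: "((\<lambda>m. f m k) has_sum h k) UNIV" for k
    proof (rule norm_summable_imp_has_sum[OF _ h])
      show "summable (\<lambda>m. norm (f m k))"
        by (rule summable_comparison_test'[OF summable_mult2[OF a]]) (use le in auto)
    qed
    have "((\<lambda>(k, m). f m k) has_sum S) (UNIV \<times> UNIV)"
      using S by (subst has_sum_reindex_bij_witness[of _ prod.swap prod.swap]) auto
    thus ?thesis
      by (rule has_sum_imp_sums[OF has_sum_SigmaD]) (use col in auto)
  qed
  have "((\<lambda>(n, k). f (n - k) k) has_sum S) (SIGMA n:UNIV. {..n})"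
    using S by (subst has_sum_reindex_bij_witness[of _ "\<lambda>(m, k). (m + k, k)" "\<lambda>(n, k). (n - k, k)"]) auto
  hence "((\<lambda>n. \<Sum>k\<le>n. f (n - k) k) has_sum S) UNIV"
    by (rule has_sum_SigmaD) (auto intro: has_sum_finite)
  with 1 2 show ?thesis using that has_sum_imp_sums by blast
qed

subsection \<open>The mock theta function of order three\<close>

definition phi3 :: "complex \<Rightarrow> complex" where
  "phi3 x = (\<Sum>n. x ^ (n\<^sup>2) / qpoch (x\<^sup>2) (x\<^sup>2) n)"

text \<open>The terms n >= 1 of Jacobi's theta series. The mock theta identity is proved with this
  one-sided sum; the two-sided series enters only with the triple product.\<close>

definition thetaplus :: "complex \<Rightarrow> complex" where
  "thetaplus x = (\<Sum>n. x ^ ((Suc n)\<^sup>2))"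

lemma summable_power_square:
  assumes "norm (x::complex) < 1"
  shows "summable (\<lambda>n. norm (x ^ (n\<^sup>2)))"
proof (rule summable_comparison_test')
  show "summable (\<lambda>n. norm x ^ n)" using assms by (intro summable_geometric) auto
  show "norm (norm (x ^ (n\<^sup>2))) \<le> norm x ^ n" for n
    using assms by (auto intro!: power_decreasing simp: power2_eq_square norm_power)
qed

lemma thetaplus_sums:
  assumes "norm x < 1"
  shows "(\<lambda>n. x ^ ((Suc n)\<^sup>2)) sums thetaplus x"
proof -
  have "summable (\<lambda>n. x ^ (n\<^sup>2))" using summable_power_square[OF assms] by (rule summable_norm_cancel)
  hence "summable (\<lambda>n. x ^ ((Suc n)\<^sup>2))" by (subst summable_Suc_iff)
  thus ?thesis unfolding thetaplus_def by (rule summable_sums)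
qed

lemma norm_square_less_1: "norm (x::complex) < 1 \<Longrightarrow> norm (x\<^sup>2) < 1"
  by (simp add: norm_power power_less_one_iff)

text \<open>Euler's theorem on partitions into distinct parts and into odd parts, with the distinct
  parts split by parity. It is the product of three elementary splittings of infinite products, from
  which the nonzero factor \<open>qprod (-X) X\<close> is cancelled.\<close>

lemma euler_odd_even:
  assumes x: "norm x < 1"
  shows "qprod x (x\<^sup>2) * qprod (-x) (x\<^sup>2) * qprod (x\<^sup>2) (x\<^sup>2) = 1"
proof -
  define X where "X = x\<^sup>2"
  have X: "norm X < 1" "norm (X\<^sup>2) < 1" unfolding X_def using x norm_square_less_1 by blast+
  have T: "qprod (-X) X \<noteq> 0" using X by (intro qprod_nonzero) auto
  have 1: "qprod X X * qprod (-X) X = qprod (-(X\<^sup>2)) (X\<^sup>2)"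
  proof (rule LIMSEQ_unique)
    show "(\<lambda>n. qpoch X X n * qpoch (-X) X n) \<longlonglongrightarrow> qprod X X * qprod (-X) X"
      by (intro tendsto_intros qpoch_tendsto X)
    have "(\<lambda>n. qpoch X X n * qpoch (-X) X n) = qpoch (-(X\<^sup>2)) (X\<^sup>2)"
      by (rule ext) (auto simp: qpoch_def prod.distrib[symmetric] algebra_simps power_mult_distrib
            power2_eq_square intro!: prod.cong)
    thus "(\<lambda>n. qpoch X X n * qpoch (-X) X n) \<longlonglongrightarrow> qprod (-(X\<^sup>2)) (X\<^sup>2)"
      using qpoch_tendsto[OF X(2)] by simp
  qed
  have 2: "qprod (-X) X = qprod (-X) (X\<^sup>2) * qprod (-(X\<^sup>2)) (X\<^sup>2)"
  proof (rule LIMSEQ_unique)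
    have "strict_mono (\<lambda>n::nat. 2 * n)" by (auto simp: strict_mono_def)
    from LIMSEQ_subseq_LIMSEQ[OF qpoch_tendsto[OF X(1)] this]
    show "(\<lambda>n. qpoch (-X) X (2 * n)) \<longlonglongrightarrow> qprod (-X) X" by (simp add: o_def)
    have "qpoch (-X) X (2 * n) = qpoch (-X) (X\<^sup>2) n * qpoch (-(X\<^sup>2)) (X\<^sup>2) n" for n
      by (induction n) (auto simp: qpoch_Suc power_mult power2_eq_square algebra_simps power_mult_distrib)
    thus "(\<lambda>n. qpoch (-X) X (2 * n)) \<longlonglongrightarrow> qprod (-X) (X\<^sup>2) * qprod (-(X\<^sup>2)) (X\<^sup>2)"
      by simp (intro tendsto_intros qpoch_tendsto X)
  qed
  have 3: "qprod x X * qprod (-x) X = qprod (-X) (X\<^sup>2)"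
  proof (rule LIMSEQ_unique)
    show "(\<lambda>n. qpoch x X n * qpoch (-x) X n) \<longlonglongrightarrow> qprod x X * qprod (-x) X"
      by (intro tendsto_intros qpoch_tendsto X)
    have "(\<lambda>n. qpoch x X n * qpoch (-x) X n) = qpoch (-X) (X\<^sup>2)"
      by (rule ext) (auto simp: qpoch_def prod.distrib[symmetric] algebra_simps power_mult_distrib
            power2_eq_square X_def intro!: prod.cong)
    thus "(\<lambda>n. qpoch x X n * qpoch (-x) X n) \<longlonglongrightarrow> qprod (-X) (X\<^sup>2)"
      using qpoch_tendsto[OF X(2)] by simp
  qed
  have "qprod x X * qprod (-x) X * qprod X X * qprod (-X) X = 1 * qprod (-X) X"
    using 1 2 3 by (simp add: mult.assoc)
  thus ?thesis using T unfolding X_def by simp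
qed

lemma square_power_choose_two: "(x\<^sup>2) ^ (k choose 2) = (x::complex) ^ (k\<^sup>2 - k)"
proof -
  have "2 * (k choose 2) = k\<^sup>2 - k"
    by (simp add: choose_two power2_eq_square algebra_simps)
  thus ?thesis by (metis power_mult)
qed

text \<open>These are the column sums in \<open>even_part_sums\<close>. For \<open>k = 0\<close> the
  series telescopes, since X^(m+1) / (x; X)_(m+1) is x times the difference of consecutive
  reciprocals. Passing from k to k + 1 uses the same splitting x X^m = 1 - (1 - x X^m) and gives
  F_(k+1) = x (1 - X^(k+1)) F_k + (1 - x).\<close>

lemma geometric_over_qpoch_sums:
  assumes x: "norm x < 1"
  defines "X \<equiv> x\<^sup>2"
  shows "(\<lambda>m. (X ^ Suc k) ^ m / qpoch (-x) X m) sums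
           (qpoch (-X) X k * (x ^ Suc k / qprod (-x) X + (1 - x) * (\<Sum>j\<le>k. x ^ (k - j) / qpoch (-X) X j)))"
proof (induction k)
  case 0
  have X: "norm X < 1" unfolding X_def using x norm_square_less_1 by blast
  have nz: "1 - x * X ^ m \<noteq> 0" "qpoch (-x) X m \<noteq> 0" for m
    using one_plus_power_nonzero[of "-x" X] qpoch_nonzero[of "-x" X] x X by auto
  have "(\<lambda>m. x * (1 / qpoch (-x) X (Suc m) - 1 / qpoch (-x) X m)) sums (x * (1 / qprod (-x) X - 1 / qpoch (-x) X 0))"
    by (intro sums_mult telescope_sums tendsto_intros qpoch_tendsto X) (use qprod_nonzero x X in auto)
  also have "(\<lambda>m. x * (1 / qpoch (-x) X (Suc m) - 1 / qpoch (-x) X m)) = (\<lambda>m. X ^ Suc m / qpoch (-x) X (Suc m))"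
  proof
    fix m
    show "x * (1 / qpoch (-x) X (Suc m) - 1 / qpoch (-x) X m) = X ^ Suc m / qpoch (-x) X (Suc m)"
      unfolding qpoch_Suc using nz[of m] by (simp add: field_simps) (simp add: X_def power2_eq_square)
  qed
  finally have "(\<lambda>m. X ^ m / qpoch (-x) X m) sums (x * (1 / qprod (-x) X - 1) + 1)"
    by (subst (asm) sums_Suc_iff) simp
  thus ?case by (simp add: algebra_simps)
next
  case (Suc k)
  have X: "norm X < 1" unfolding X_def using x norm_square_less_1 by blast
  have nz: "1 - x * X ^ m \<noteq> 0" "qpoch (-x) X m \<noteq> 0" for m
    using one_plus_power_nonzero[of "-x" X] qpoch_nonzero[of "-x" X] x X by auto
  have nz2: "1 - X * X ^ m \<noteq> 0" "qpoch (-X) X m \<noteq> 0" for m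
    using one_plus_power_nonzero[of "-X" X] qpoch_nonzero[of "-X" X] x X by auto
  define t where "t = X ^ Suc k"
  define F where "F = qpoch (-X) X k * (x ^ Suc k / qprod (-x) X + (1 - x) * (\<Sum>j\<le>k. x ^ (k - j) / qpoch (-X) X j))"
  have F: "(\<lambda>m. t ^ m / qpoch (-x) X m) sums F" using Suc unfolding t_def F_def .
  have F': "(\<lambda>m. t ^ Suc m / qpoch (-x) X (Suc m)) sums (F - 1)"
    using F by (subst sums_Suc_iff) simp
  have "(\<lambda>m. x * (t ^ Suc m / qpoch (-x) X (Suc m)) - x * t * (t ^ m / qpoch (-x) X m)) sums
          (x * (F - 1) - x * t * F)"
    by (intro sums_diff sums_mult F F')
  also have "(\<lambda>m. x * (t ^ Suc m / qpoch (-x) X (Suc m)) - x * t * (t ^ m / qpoch (-x) X m)) =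
      (\<lambda>m. (t * X) ^ Suc m / qpoch (-x) X (Suc m))"
  proof
    fix m
    show "x * (t ^ Suc m / qpoch (-x) X (Suc m)) - x * t * (t ^ m / qpoch (-x) X m) = (t * X) ^ Suc m / qpoch (-x) X (Suc m)"
      unfolding qpoch_Suc using nz[of m]
      by (simp add: field_simps power_mult_distrib) (simp add: X_def power2_eq_square algebra_simps)
  qed
  finally have "(\<lambda>m. (t * X) ^ m / qpoch (-x) X m) sums (x * (F - 1) - x * t * F + 1)"
    by (subst (asm) sums_Suc_iff) simp
  also have "t * X = X ^ Suc (Suc k)" by (simp add: t_def)
  also have "x * (F - 1) - x * t * F + 1 = x * (1 - t) * F + (1 - x)" by (simp add: algebra_simps)
  also have "\<dots> = qpoch (-X) X (Suc k) * (x ^ Suc (Suc k) / qprod (-x) X + (1 - x) * (\<Sum>j\<le>Suc k. x ^ (Suc k - j) / qpoch (-X) X j))"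
  proof -
    have "(\<Sum>j\<le>Suc k. x ^ (Suc k - j) / qpoch (-X) X j) = x * (\<Sum>j\<le>k. x ^ (k - j) / qpoch (-X) X j) + 1 / qpoch (-X) X (Suc k)"
      by (simp add: sum_distrib_left Suc_diff_le)
    moreover have "qpoch (-X) X (Suc k) = qpoch (-X) X k * (1 - t)" by (simp add: qpoch_Suc t_def)
    moreover have "1 - t \<noteq> 0" using nz2(1)[of k] by (simp add: t_def)
    ultimately show ?thesis unfolding F_def using nz2(2)[of k]
      by (simp add: distrib_left mult_ac)
  qed
  finally show ?case .
qed

text \<open>Replacing the exponent \<open>k * Suc m\<close> by \<open>k\<close> decouples the two
  indices; this is the product majorant required by \<open>dominated_double_sums\<close>.\<close>

lemma qpoch_expansion_bound:
  assumes X: "norm X < 1"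
  shows "norm (y * (X ^ (k choose 2) / qpoch (-X) X k * (X ^ Suc m) ^ k)) \<le>
           norm y * norm (X ^ (k choose 2) / qpoch (-X) X k * X ^ k)"
proof -
  have "norm X ^ (k * Suc m) \<le> norm X ^ k" using X by (intro power_decreasing) auto
  thus ?thesis
    by (simp only: norm_mult norm_power power_mult[symmetric] mult.commute[of "Suc m"])
       (intro mult_left_mono, auto)
qed

text \<open>The reciprocal of (-X; X)_n is (-X^(n+1); X) divided by (-X; X), both infinite.
  Expanding the numerator by \<open>euler_sum1\<close> and summing along antidiagonals works because
  d^2 + (k^2 - k) + 2 (d + 1) k = (d + k)^2 + k. The second form is the one that reappears in
  \<open>even_part_sums\<close>.\<close>

lemma phi3_sums:
  assumes x: "norm x < 1"
  defines "X \<equiv> x\<^sup>2"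
  shows "(\<lambda>n. x ^ (n\<^sup>2) / qpoch X X n) sums phi3 x"
    and "(\<lambda>n. x ^ (n\<^sup>2) * (\<Sum>j\<le>n. x ^ j / qpoch (-X) X j)) sums (qprod X X * phi3 x)"
proof -
  have X: "norm X < 1" unfolding X_def using x norm_square_less_1 by blast
  have nz: "qpoch X X m \<noteq> 0" for m using qpoch_nonzero[of X X] X by auto
  have nz': "qprod X X \<noteq> 0" using qprod_nonzero[of X X] X by auto
  define f where "f = (\<lambda>n k. x ^ (n\<^sup>2) * (X ^ (k choose 2) / qpoch (-X) X k * (X ^ Suc n) ^ k))"
  obtain S where S: "(\<lambda>n. qprod X X * (x ^ (n\<^sup>2) / qpoch X X n)) sums S"
     "(\<lambda>n. \<Sum>k\<le>n. f (n - k) k) sums S"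
  proof (rule dominated_double_sums)
    show "summable (\<lambda>n. norm (x ^ (n\<^sup>2)))" using summable_power_square[OF x] .
    show "summable (\<lambda>k. norm (X ^ (k choose 2) / qpoch (-X) X k * X ^ k))" by (rule summable_euler1[OF X])
    show "norm (f n k) \<le> norm (x ^ n\<^sup>2) * norm (X ^ (k choose 2) / qpoch (-X) X k * X ^ k)" for n k
      unfolding f_def by (rule qpoch_expansion_bound[OF X])
    fix n
    have "f n sums (x ^ (n\<^sup>2) * qprod (X ^ Suc n) X)" unfolding f_def by (intro sums_mult euler_sum1[OF X])
    also have "x ^ (n\<^sup>2) * qprod (X ^ Suc n) X = qprod X X * (x ^ (n\<^sup>2) / qpoch X X n)"
      using qprod_split[OF X, of X n] nz by (simp add: field_simps)
    finally show "f n sums (qprod X X * (x ^ (n\<^sup>2) / qpoch X X n))" .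
  qed auto
  have "(\<lambda>n. inverse (qprod X X) * (qprod X X * (x ^ (n\<^sup>2) / qpoch X X n))) sums (inverse (qprod X X) * S)"
    by (intro sums_mult S)
  hence *: "(\<lambda>n. x ^ (n\<^sup>2) / qpoch X X n) sums (inverse (qprod X X) * S)"
    using nz' by (simp add: mult.assoc[symmetric])
  hence "phi3 x = inverse (qprod X X) * S" by (simp add: phi3_def X_def sums_iff)
  hence "S = qprod X X * phi3 x" using nz' by simp
  moreover show "(\<lambda>n. x ^ (n\<^sup>2) / qpoch X X n) sums phi3 x"
    using * \<open>phi3 x = _\<close> by simp
  moreover have "(\<Sum>k\<le>n. f (n - k) k) = x ^ (n\<^sup>2) * (\<Sum>j\<le>n. x ^ j / qpoch (-X) X j)" for n
    unfolding sum_distrib_left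
  proof (rule sum.cong)
    fix k assume "k \<in> {..n}"
    then obtain d where d: "n = d + k" by (metis atMost_iff le_iff_add add.commute)
    have "f d k = x ^ (d\<^sup>2 + (k\<^sup>2 - k) + 2 * (Suc d * k)) / qpoch (-X) X k"
    proof -
      have "(X ^ Suc d) ^ k = x ^ (2 * (Suc d * k))" by (simp only: X_def power_mult[symmetric] mult.assoc)
      thus ?thesis unfolding f_def unfolding X_def square_power_choose_two by (simp add: power_add)
    qed
    also have "d\<^sup>2 + (k\<^sup>2 - k) + 2 * (Suc d * k) = (d + k)\<^sup>2 + k"
    proof -
      have "k \<le> k\<^sup>2" by (simp add: power2_eq_square)
      hence "d\<^sup>2 + (k\<^sup>2 - k) + 2 * (Suc d * k) = d\<^sup>2 + k\<^sup>2 + 2 * (d * k) + k" by simp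
      also have "\<dots> = (d + k)\<^sup>2 + k" by (simp add: power2_eq_square algebra_simps)
      finally show ?thesis .
    qed
    finally show "f (n - k) k = x ^ n\<^sup>2 * (x ^ k / qpoch (-X) X k)"
      by (simp add: d power_add)
  qed auto
  ultimately show "(\<lambda>n. x ^ (n\<^sup>2) * (\<Sum>j\<le>n. x ^ j / qpoch (-X) X j)) sums (qprod X X * phi3 x)"
    using S(2) by simp
qed

text \<open>The left side collects the even-indexed terms of the series in
  \<open>mock_theta_identity\<close>. Expanding 1 / (-X; X)_m as in \<open>phi3_sums\<close> and
  summing over m first produces the theta series plus a remainder \<open>(1 - x) * V\<close>, and
  \<open>V\<close> is then found from a linear equation.\<close>

lemma even_part_sums:
  assumes x: "norm x < 1"
  defines "X \<equiv> x\<^sup>2"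
  shows "(\<lambda>m. X ^ m / (qpoch (-x) X m * qpoch X X m)) sums (qprod x X * thetaplus x + 2 - phi3 x)"
proof -
  have X: "norm X < 1" unfolding X_def using x norm_square_less_1 by blast
  have nz: "qpoch X X m \<noteq> 0" "qpoch (-x) X m \<noteq> 0" "qpoch (-X) X m \<noteq> 0" "1 - X * X ^ m \<noteq> 0" for m
    using qpoch_nonzero[of X X] qpoch_nonzero[of "-x" X] qpoch_nonzero[of "-X" X]
      one_plus_power_nonzero[of "-X" X] X x by auto
  have nz': "qprod X X \<noteq> 0" "qprod (-x) X \<noteq> 0"
    using qprod_nonzero[of X X] qprod_nonzero[of "-x" X] X x by auto
  have x1: "1 - x \<noteq> 0" using x by auto
  obtain C where C: "C > 0" "\<And>n. norm (inverse (qpoch (-x) X n)) \<le> C"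
    using inverse_qpoch_bounded[of "-x" X] x X by auto
  define f where "f = (\<lambda>m k. X ^ m / qpoch (-x) X m * (X ^ (k choose 2) / qpoch (-X) X k * (X ^ Suc m) ^ k))"
  define e where "e = (\<lambda>k. \<Sum>j\<le>k. x ^ (k - j) / qpoch (-X) X j)"
  define c where "c = (\<lambda>k. \<Sum>j\<le>k. x ^ j / qpoch (-X) X j)"
  define h where "h = (\<lambda>k. x ^ ((Suc k)\<^sup>2) / qprod (-x) X + (1 - x) * (x ^ (k\<^sup>2 + k) * e k))"
  obtain S where S: "(\<lambda>m. qprod X X * (X ^ m / (qpoch (-x) X m * qpoch X X m))) sums S"
     "(\<And>h. (\<And>k. (\<lambda>m. f m k) sums h k) \<Longrightarrow> h sums S)"
  proof (rule dominated_double_sums[of "\<lambda>m. C * norm X ^ m"])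
    show "summable (\<lambda>m. C * norm X ^ m)" using X by (intro summable_mult summable_geometric) auto
    show "summable (\<lambda>k. norm (X ^ (k choose 2) / qpoch (-X) X k * X ^ k))" by (rule summable_euler1[OF X])
    fix m
    show "norm (f m k) \<le> (C * norm X ^ m) * norm (X ^ (k choose 2) / qpoch (-X) X k * X ^ k)" for k
    proof -
      have "norm (f m k) \<le> norm (X ^ m / qpoch (-x) X m) * norm (X ^ (k choose 2) / qpoch (-X) X k * X ^ k)"
        unfolding f_def by (rule qpoch_expansion_bound[OF X])
      also have "norm (X ^ m / qpoch (-x) X m) \<le> C * norm X ^ m"
        using mult_right_mono[OF C(2)[of m], of "norm X ^ m"]
        by (simp add: norm_divide norm_inverse norm_power field_simps)
      finally show ?thesis by (simp add: mult_right_mono)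
    qed
    have "f m sums (X ^ m / qpoch (-x) X m * qprod (X ^ Suc m) X)"
      unfolding f_def by (intro sums_mult euler_sum1[OF X])
    also have "X ^ m / qpoch (-x) X m * qprod (X ^ Suc m) X = qprod X X * (X ^ m / (qpoch (-x) X m * qpoch X X m))"
      using qprod_split[OF X, of X m] nz by (simp add: field_simps)
    finally show "f m sums (qprod X X * (X ^ m / (qpoch (-x) X m * qpoch X X m)))" .
  qed (use C in auto)
  have h: "h sums S"
  proof (rule S(2))
    fix k
    have "(\<lambda>m. X ^ (k choose 2) * X ^ k / qpoch (-X) X k * ((X ^ Suc k) ^ m / qpoch (-x) X m)) sums
       (X ^ (k choose 2) * X ^ k / qpoch (-X) X k * (qpoch (-X) X k * (x ^ Suc k / qprod (-x) X + (1 - x) * e k)))"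
      unfolding e_def X_def by (intro sums_mult geometric_over_qpoch_sums x)
    also have "(\<lambda>m. X ^ (k choose 2) * X ^ k / qpoch (-X) X k * ((X ^ Suc k) ^ m / qpoch (-x) X m)) = (\<lambda>m. f m k)"
    proof
      fix m
      have "(X ^ Suc k) ^ m * X ^ k = X ^ m * (X ^ Suc m) ^ k"
        by (simp add: power_mult[symmetric] power_add[symmetric] algebra_simps)
      show "X ^ (k choose 2) * X ^ k / qpoch (-X) X k * ((X ^ Suc k) ^ m / qpoch (-x) X m) = f m k"
      proof -
        have "X ^ (k choose 2) * X ^ k / qpoch (-X) X k * ((X ^ Suc k) ^ m / qpoch (-x) X m) =
          X ^ (k choose 2) * ((X ^ Suc k) ^ m * X ^ k) / (qpoch (-X) X k * qpoch (-x) X m)"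
          by (simp only: times_divide_times_eq mult_ac)
        also have "\<dots> = f m k"
          unfolding \<open>(X ^ Suc k) ^ m * X ^ k = _\<close> f_def
          by (simp only: times_divide_times_eq times_divide_eq_left times_divide_eq_right mult_ac divide_divide_eq_left)
        finally show ?thesis .
      qed
    qed
    also have "X ^ (k choose 2) * X ^ k / qpoch (-X) X k * (qpoch (-X) X k * (x ^ Suc k / qprod (-x) X + (1 - x) * e k))
       = X ^ (k choose 2) * X ^ k * (x ^ Suc k / qprod (-x) X + (1 - x) * e k)" using nz[of k] by simp
    also have "X ^ (k choose 2) * X ^ k = x ^ (k\<^sup>2 + k)"
    proof -
      have "k \<le> k\<^sup>2" by (simp add: power2_eq_square)
      hence *: "k\<^sup>2 - k + 2 * k = k\<^sup>2 + k" by simp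
      have "X ^ (k choose 2) * X ^ k = x ^ (k\<^sup>2 - k) * x ^ (2 * k)"
        unfolding X_def square_power_choose_two by (simp add: power_mult)
      also have "\<dots> = x ^ (k\<^sup>2 - k + 2 * k)" by (rule power_add[symmetric])
      finally show ?thesis unfolding * .
    qed
    also have "x ^ (k\<^sup>2 + k) * (x ^ Suc k / qprod (-x) X + (1 - x) * e k) = h k"
    proof -
      have "k\<^sup>2 + k + Suc k = (Suc k)\<^sup>2" by (simp add: power2_eq_square)
      hence "x ^ (k\<^sup>2 + k) * x ^ Suc k = x ^ ((Suc k)\<^sup>2)" by (metis power_add)
      thus ?thesis unfolding h_def by (simp only: distrib_left times_divide_eq_right) (simp add: mult_ac)
    qed
    finally show "(\<lambda>m. f m k) sums h k" .
  qed
  define V where "V = (S - thetaplus x / qprod (-x) X) / (1 - x)"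
  have V: "(\<lambda>k. x ^ (k\<^sup>2 + k) * e k) sums V"
  proof -
    have "(\<lambda>k. (h k - x ^ ((Suc k)\<^sup>2) / qprod (-x) X) / (1 - x)) sums V"
      unfolding V_def by (intro sums_divide sums_diff h thetaplus_sums x)
    thus ?thesis unfolding h_def using x1 by simp
  qed
  have e_Suc: "e (Suc k) = x * e k + 1 / qpoch (-X) X (Suc k)" for k
    unfolding e_def by (simp add: sum_distrib_left Suc_diff_le)
  \<comment> \<open>The sum \<open>e\<close> carries the reversed weights of the sum
    \<open>c\<close> that occurs in \<open>phi3_sums\<close>. In the difference the j-th term has
    the factor x^(k+1-j) (1 - X^j); here 1 - X^j cancels the last factor of (X; X)_j, which shifts j
    by one and leaves \<open>e k\<close>.\<close>
  have ec: "e (Suc k) - x ^ Suc k * c (Suc k) = e k" for k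
  proof (induction k)
    case 0
    have T: "qpoch (-X) X (Suc 0) = 1 - x * x" by (simp add: qpoch_Suc X_def power2_eq_square)
    have "1 - x * x \<noteq> 0" using nz(3)[of "Suc 0"] T by simp
    thus ?case unfolding e_def c_def by (simp add: T divide_simps) (simp add: algebra_simps)
  next
    case (Suc k)
    have "e (Suc (Suc k)) - x ^ Suc (Suc k) * c (Suc (Suc k)) =
       x * (e (Suc k) - x ^ Suc k * c (Suc k)) + (1 - x ^ Suc (Suc k) * x ^ Suc (Suc k)) / qpoch (-X) X (Suc (Suc k))"
      unfolding e_Suc[of "Suc k"] by (simp add: c_def algebra_simps diff_divide_distrib)
    also have "x ^ Suc (Suc k) * x ^ Suc (Suc k) = X * X ^ Suc k"
      unfolding X_def by (simp add: power_mult[symmetric] power_add[symmetric] power2_eq_square power_mult_distrib)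
    also have "(1 - X * X ^ Suc k) / qpoch (-X) X (Suc (Suc k)) = 1 / qpoch (-X) X (Suc k)"
      unfolding qpoch_Suc[of _ _ "Suc k"] using nz(4)[of "Suc k"] by (simp del: power_Suc)
    finally show ?case unfolding Suc by (simp only: e_Suc[of k])
  qed
  \<comment> \<open>\<open>euler_sum1\<close> at \<open>a = 1\<close>: the first factor 1 + 1 of the
    product is split off.\<close>
  have Z: "(\<lambda>k. x ^ (k\<^sup>2 - k) / qpoch (-X) X k) sums (2 * qprod X X)"
  proof -
    have "(\<lambda>k. X ^ (k choose 2) / qpoch (-X) X k * 1 ^ k) sums ((1 + 1) * qprod (1 * X) X)"
      using euler_sum1[OF X, of 1] unfolding qprod_rec[OF X, of 1] .
    moreover have "X ^ (k choose 2) = x ^ (k\<^sup>2 - k)" for k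
      unfolding X_def by (rule square_power_choose_two)
    ultimately show ?thesis by (simp del: power_Suc)
  qed
  have U: "(\<lambda>k. x ^ (k\<^sup>2 - k) * e k) sums (x * V + 2 * qprod X X)"
  proof -
    have 1: "x ^ ((Suc k)\<^sup>2 - Suc k) = x ^ (k\<^sup>2 + k)" for k by (simp add: power2_eq_square add.commute)
    have Z': "(\<lambda>k. x ^ ((Suc k)\<^sup>2 - Suc k) / qpoch (-X) X (Suc k)) sums (2 * qprod X X - 1)"
      using Z by (subst sums_Suc_iff) simp
    have "(\<lambda>k. x * (x ^ (k\<^sup>2 + k) * e k) + x ^ ((Suc k)\<^sup>2 - Suc k) / qpoch (-X) X (Suc k)) sums
       (x * V + (2 * qprod X X - 1))" by (intro sums_add sums_mult V Z')
    also have "(\<lambda>k. x * (x ^ (k\<^sup>2 + k) * e k) + x ^ ((Suc k)\<^sup>2 - Suc k) / qpoch (-X) X (Suc k)) =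
       (\<lambda>k. x ^ ((Suc k)\<^sup>2 - Suc k) * e (Suc k))"
      unfolding e_Suc 1 by (simp add: algebra_simps)
    finally have "(\<lambda>k. x ^ (k\<^sup>2 - k) * e k) sums (x * V + (2 * qprod X X - 1) + e 0)"
      by (subst (asm) sums_Suc_iff) simp
    thus ?thesis by (simp add: e_def)
  qed
  \<comment> \<open>By \<open>ec\<close>, x^(k^2 + k) (e_(k+1) - e_k) = x^((k+1)^2) c_(k+1). So the
    series of \<open>phi3_sums\<close> is also the difference of the series \<open>U\<close> and
    \<open>V\<close>; equating its two values determines \<open>(1 - x) * V\<close>.\<close>
  have W: "(\<lambda>k. x ^ (k\<^sup>2) * c k) sums (x * V + 2 * qprod X X - V)"
  proof -
    have U': "(\<lambda>k. x ^ (k\<^sup>2 + k) * e (Suc k)) sums (x * V + 2 * qprod X X - 1)"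
    proof -
      have "(\<lambda>k. x ^ ((Suc k)\<^sup>2 - Suc k) * e (Suc k)) sums (x * V + 2 * qprod X X - 1)"
        using U by (subst sums_Suc_iff) (simp add: e_def)
      moreover have "(Suc k)\<^sup>2 - Suc k = k\<^sup>2 + k" for k by (simp add: power2_eq_square)
      ultimately show ?thesis by (simp only:)
    qed
    have "(\<lambda>k. x ^ (k\<^sup>2 + k) * e (Suc k) - x ^ (k\<^sup>2 + k) * e k) sums (x * V + 2 * qprod X X - 1 - V)"
      by (intro sums_diff U' V)
    also have "(\<lambda>k. x ^ (k\<^sup>2 + k) * e (Suc k) - x ^ (k\<^sup>2 + k) * e k) = (\<lambda>k. x ^ ((Suc k)\<^sup>2) * c (Suc k))"
    proof
      fix k
      have "x ^ (k\<^sup>2 + k) * e (Suc k) - x ^ (k\<^sup>2 + k) * e k = x ^ (k\<^sup>2 + k) * (x ^ Suc k * c (Suc k))"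
        by (subst ec[of k, symmetric]) (simp add: algebra_simps)
      also have "\<dots> = x ^ (k\<^sup>2 + k + Suc k) * c (Suc k)" by (simp add: power_add)
      also have "k\<^sup>2 + k + Suc k = (Suc k)\<^sup>2" by (simp add: power2_eq_square)
      finally show "x ^ (k\<^sup>2 + k) * e (Suc k) - x ^ (k\<^sup>2 + k) * e k = x ^ ((Suc k)\<^sup>2) * c (Suc k)" .
    qed
    finally have "(\<lambda>k. x ^ (k\<^sup>2) * c k) sums (x * V + 2 * qprod X X - 1 - V + c 0)"
      by (subst (asm) sums_Suc_iff) simp
    moreover have "x * V + 2 * qprod X X - 1 - V + c 0 = x * V + 2 * qprod X X - V" by (simp add: c_def)
    ultimately show ?thesis by (simp only:)
  qed
  have "x * V + 2 * qprod X X - V = qprod X X * phi3 x"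
    using sums_unique2[OF W[unfolded c_def X_def] phi3_sums(2)[OF x]] unfolding X_def .
  hence "(1 - x) * V = qprod X X * (2 - phi3 x)" by (simp add: algebra_simps)
  moreover have "(1 - x) * V = S - thetaplus x / qprod (-x) X" using x1 by (simp add: V_def)
  ultimately have "S = thetaplus x / qprod (-x) X + qprod X X * (2 - phi3 x)"
    by (simp add: diff_eq_eq add.commute)
  also have "thetaplus x / qprod (-x) X = thetaplus x * (1 / qprod (-x) X)" by simp
  also have "1 / qprod (-x) X = qprod X X * qprod x X"
    using euler_odd_even[OF x] nz' unfolding X_def[symmetric] by (simp add: field_simps)
  finally have "S = qprod X X * (qprod x X * thetaplus x + 2 - phi3 x)" by (simp add: algebra_simps)
  from S(1)[unfolded this] have "(\<lambda>m. inverse (qprod X X) * (qprod X X * (X ^ m / (qpoch (-x) X m * qpoch X X m)))) sums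
    (inverse (qprod X X) * (qprod X X * (qprod x X * thetaplus x + 2 - phi3 x)))"
    by (rule sums_mult)
  thus ?thesis using nz' by (simp add: mult.assoc[symmetric])
qed

text \<open>Jacobi's theta_3 times Weber's product. With an extra factor x^(-1/24) this is a modular
  object of weight 1/2, which explains the exponentials with 24 in its inversion formula.\<close>

definition theta_weber :: "complex \<Rightarrow> complex" where
  "theta_weber x = (1 + 2 * thetaplus x) * qprod x (x\<^sup>2)"

text \<open>With \<open>alpha_generating_function\<close> this becomes, at q = -x, the classical
  relation that expresses 2 phi(-q) - f(q) as theta_4(q) divided by the product of the 1 + q^r. The
  odd-indexed terms need no separate evaluation: adding each of them to its neighbours doubles the
  even-indexed sum up to a boundary term 1 / \<open>u M\<close>, whose limit is given by
  \<open>euler_odd_even\<close>.\<close>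

theorem mock_theta_identity:
  assumes x: "norm x < 1"
  shows "(\<lambda>n. x ^ n / qpoch (-x) (-x) n) sums (theta_weber x + 2 - 2 * phi3 x)"
proof -
  define X where "X = x\<^sup>2"
  have X: "norm X < 1" unfolding X_def using x norm_square_less_1 by blast
  define L where "L = qprod x X * thetaplus x + 2 - phi3 x"
  have L: "(\<lambda>m. X ^ m / (qpoch (-x) X m * qpoch X X m)) sums L"
    unfolding L_def X_def by (rule even_part_sums[OF x])
  define u where "u = (\<lambda>m. qpoch (-x) X m * qpoch X X m)"
  have even: "qpoch (-x) (-x) (2 * m) = u m" for m
  proof (induction m)
    case (Suc m)
    have "(1 + - x * (- x) ^ (2 * m)) = 1 + - x * X ^ m" by (simp add: X_def power_mult)
    moreover have "(1 + - x * (- x) ^ (Suc (2 * m))) = 1 + X * X ^ m" by (simp add: X_def power_mult power2_eq_square)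
    ultimately show ?case using Suc by (simp add: u_def qpoch_Suc mult_ac del: mult_minus_left mult_minus_right power_Suc)
  qed (simp add: u_def)
  have nz: "u m \<noteq> 0" "1 - x * X ^ m \<noteq> 0" "1 + X * X ^ m \<noteq> 0" for m
    using qpoch_nonzero[of "-x" X] qpoch_nonzero[of X X] one_plus_power_nonzero[of "-x" X]
      one_plus_power_nonzero[of X X] x X unfolding u_def by auto
  have odd: "qpoch (-x) (-x) (Suc (2 * m)) = u m * (1 - x * X ^ m)" for m
    unfolding qpoch_Suc even by (simp add: X_def power_mult)
  obtain C where C: "C > 0" "\<And>n. norm (inverse (qpoch (-x) (-x) n)) \<le> C"
    using inverse_qpoch_bounded[of "-x" "-x"] x by auto
  have "summable (\<lambda>n. x ^ n / qpoch (-x) (-x) n)"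
  proof (rule summable_comparison_test')
    show "summable (\<lambda>n. C * norm x ^ n)" using x by (intro summable_mult summable_geometric) auto
    show "norm (x ^ n / qpoch (-x) (-x) n) \<le> C * norm x ^ n" for n
      using mult_right_mono[OF C(2)[of n], of "norm x ^ n"]
      by (simp add: norm_divide norm_inverse norm_power field_simps)
  qed
  then obtain G where G: "(\<lambda>n. x ^ n / qpoch (-x) (-x) n) sums G" by (auto simp: summable_def)
  have partial: "(\<Sum>n<Suc (2 * M). x ^ n / qpoch (-x) (-x) n) = 2 * (\<Sum>m<Suc M. X ^ m / u m) - 2 + 1 / u M" for M
  proof (induction M)
    case 0 thus ?case by (simp add: u_def)
  next
    case (Suc M)
    have uS: "u (Suc M) = u M * (1 - x * X ^ M) * (1 + X * X ^ M)"
    proof -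
      have "u (Suc M) = qpoch (-x) (-x) (Suc (2 * M)) * (1 + - x * (- x) ^ (Suc (2 * M)))"
        by (simp only: even[symmetric] mult_Suc_right numeral_2_eq_2 add_Suc add_0 qpoch_Suc[of _ _ "Suc _"])
      also have "(1 + - x * (- x) ^ (Suc (2 * M))) = 1 + X * X ^ M" by (simp add: X_def power_mult power2_eq_square)
      finally show ?thesis unfolding odd .
    qed
    have x1: "x ^ Suc (2 * M) = x * X ^ M" and x2: "x ^ Suc (Suc (2 * M)) = X ^ Suc M"
      by (simp_all add: X_def power_mult[symmetric] power2_eq_square power_mult_distrib power_add[symmetric] mult_2)
    have "(\<Sum>n<Suc (2 * Suc M). x ^ n / qpoch (-x) (-x) n) =
        (\<Sum>n<Suc (2 * M). x ^ n / qpoch (-x) (-x) n) + x ^ Suc (2 * M) / qpoch (-x) (-x) (Suc (2*M)) +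
        x ^ Suc (Suc (2 * M)) / qpoch (-x) (-x) (2 * Suc M)" by simp
    also have "\<dots> = 2 * (\<Sum>m<Suc M. X ^ m / u m) - 2 + (1 / u M + x * X ^ M / (u M * (1 - x * X ^ M)) + X ^ Suc M / u (Suc M))"
      unfolding Suc odd even x1 x2 by simp
    also have "1 / u M + x * X ^ M / (u M * (1 - x * X ^ M)) + X ^ Suc M / u (Suc M) =
       2 * (X ^ Suc M / u (Suc M)) + 1 / u (Suc M)"
    proof -
      \<comment> \<open>With s = 1 - y and t = 1 + w one has s t + y t + w = 2 w + 1: the old
        boundary term and the odd term together equal a second copy of the even term plus the new
        boundary term.\<close>
      have *: "1 / a + y / (a * s) + w / (a * s * t) = 2 * (w / (a * s * t)) + 1 / (a * s * t)"
        if "a \<noteq> 0" "s \<noteq> 0" "t \<noteq> 0" "s = 1 - y" "t = 1 + w" for a s t y w :: complex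
      proof -
        have "s * t + y * t + w = 2 * w + 1" unfolding that(4,5) by (simp add: algebra_simps)
        moreover have "1 / a + y / (a * s) + w / (a * s * t) = (s * t + y * t + w) / (a * s * t)"
          using that(1-3) by (simp add: field_simps)
        ultimately show ?thesis by (simp add: add_divide_distrib)
      qed
      show ?thesis unfolding uS by (rule *) (use nz[of M] in auto)
    qed
    finally show ?case by (simp add: algebra_simps)
  qed
  have sub: "strict_mono (\<lambda>M::nat. Suc (2 * M))" by (auto simp: strict_mono_def)
  have 1: "(\<lambda>M. \<Sum>n<Suc (2 * M). x ^ n / qpoch (-x) (-x) n) \<longlonglongrightarrow> G"
    using LIMSEQ_subseq_LIMSEQ[OF G[unfolded sums_def] sub] by (simp add: o_def)
  have u_lim: "(\<lambda>M. 1 / u M) \<longlonglongrightarrow> 1 / (qprod (-x) X * qprod X X)"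
    unfolding u_def by (intro tendsto_intros qpoch_tendsto X) (use qprod_nonzero x X in auto)
  have L': "(\<lambda>m. X ^ m / u m) sums L" using L by (simp add: u_def)
  have 2: "(\<lambda>M. 2 * (\<Sum>m<Suc M. X ^ m / u m) - 2 + 1 / u M) \<longlonglongrightarrow> 2 * L - 2 + 1 / (qprod (-x) X * qprod X X)"
    by (intro tendsto_add tendsto_diff tendsto_mult tendsto_const u_lim LIMSEQ_Suc[OF L'[unfolded sums_def]])
  have "G = 2 * L - 2 + 1 / (qprod (-x) X * qprod X X)"
    using LIMSEQ_unique[OF 1[unfolded partial] 2] .
  also have "1 / (qprod (-x) X * qprod X X) = qprod x X"
    using euler_odd_even[OF x] unfolding X_def[symmetric] by (metis eq_divide_imp mult.assoc mult_zero_right zero_neq_one)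
  also have "2 * L - 2 + qprod x X = theta_weber x + 2 - 2 * phi3 x"
    unfolding L_def theta_weber_def X_def by (simp add: algebra_simps)
  finally show ?thesis using G by simp
qed

subsection \<open>Partitions counted by their largest part\<close>

definition parts_le :: "nat \<Rightarrow> nat \<Rightarrow> nat list set" where
  "parts_le m n = {xs \<in> partitions n. set xs \<subseteq> {..m}}"

text \<open>The weight \<open>w\<close> marks the number of parts: \<open>w = -1\<close> gives its
  parity, as needed for the rank, and \<open>w = 1\<close> gives plain counts for the convergence
  estimate.\<close>

definition wcount :: "complex \<Rightarrow> nat \<Rightarrow> nat \<Rightarrow> complex" where
  "wcount w m n = (\<Sum>xs\<in>parts_le m n. w ^ length xs)"

lemma finite_parts_le: "finite (parts_le m n)"
  unfolding parts_le_def using finite_partitions by simp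

lemma parts_le_0: "parts_le 0 n = (if n = 0 then {[]} else {})"
proof -
  have "xs = [] \<and> n = 0" if "xs \<in> parts_le 0 n" for xs
    using that by (cases xs) (auto simp: parts_le_def partitions_def)
  moreover have "[] \<in> parts_le 0 0" by (simp add: parts_le_def partitions_def)
  ultimately show ?thesis by auto
qed

text \<open>The largest part is the last entry, so removing it leaves an arbitrary partition with
  parts at most \<open>Suc m\<close>. The case distinction guards against truncated subtraction,
  which would otherwise make the remainder 0 for small \<open>n\<close>.\<close>

lemma parts_le_last:
  "{xs \<in> partitions n. xs \<noteq> [] \<and> last xs = Suc m} =
     (if Suc m \<le> n then (\<lambda>ys. ys @ [Suc m]) ` parts_le (Suc m) (n - Suc m) else {})"
  (is "?L = ?R")
proof (intro equalityI subsetI)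
  fix xs assume xs: "xs \<in> ?L"
  then obtain ys where ys: "xs = ys @ [Suc m]" by (metis (mono_tags) append_butlast_last_id mem_Collect_eq)
  have "ys \<in> parts_le (Suc m) (n - Suc m)" "Suc m \<le> n"
    using xs unfolding ys by (auto simp: parts_le_def partitions_def sorted_append)
  thus "xs \<in> ?R" using ys by auto
next
  fix xs assume "xs \<in> ?R"
  thus "xs \<in> ?L" by (auto simp: parts_le_def partitions_def sorted_append split: if_splits)
qed

lemma parts_le_Suc:
  "parts_le (Suc m) n = parts_le m n \<union> {xs \<in> partitions n. xs \<noteq> [] \<and> last xs = Suc m}"
proof (intro equalityI subsetI)
  fix xs assume xs: "xs \<in> parts_le (Suc m) n"
  show "xs \<in> parts_le m n \<union> {xs \<in> partitions n. xs \<noteq> [] \<and> last xs = Suc m}"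
  proof (cases "xs \<noteq> [] \<and> last xs = Suc m")
    case False
    have "x \<le> m" if "x \<in> set xs" for x
    proof -
      have "xs \<noteq> []" using that by auto
      then obtain ys z where ys: "xs = ys @ [z]" by (metis append_butlast_last_id)
      thus ?thesis using False xs that by (auto simp: parts_le_def partitions_def sorted_append le_Suc_eq)
    qed
    thus ?thesis using xs by (auto simp: parts_le_def)
  qed (use xs in \<open>auto simp: parts_le_def\<close>)
next
  fix xs assume "xs \<in> parts_le m n \<union> {xs \<in> partitions n. xs \<noteq> [] \<and> last xs = Suc m}"
  thus "xs \<in> parts_le (Suc m) n"
  proof
    assume "xs \<in> parts_le m n"
    thus ?thesis unfolding parts_le_def by (auto intro: le_SucI)
  next
    assume xs: "xs \<in> {xs \<in> partitions n. xs \<noteq> [] \<and> last xs = Suc m}"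
    then obtain ys where ys: "xs = ys @ [Suc m]" by (metis (mono_tags) append_butlast_last_id mem_Collect_eq)
    show ?thesis using xs unfolding ys by (auto simp: parts_le_def partitions_def sorted_append)
  qed
qed

lemma sum_last_part:
  "(\<Sum>xs\<in>{xs \<in> partitions n. xs \<noteq> [] \<and> last xs = Suc m}. w ^ length xs) =
     (if Suc m \<le> n then w * wcount w (Suc m) (n - Suc m) else 0)"
proof -
  have "inj_on (\<lambda>ys. ys @ [Suc m]) A" for A by (auto simp: inj_on_def)
  hence "(\<Sum>xs\<in>(\<lambda>ys. ys @ [Suc m]) ` A. w ^ length xs) = w * (\<Sum>xs\<in>A. w ^ length xs)" for A
    by (subst sum.reindex) (auto simp: sum_distrib_left)
  thus ?thesis unfolding parts_le_last wcount_def by auto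
qed

lemma wcount_0: "wcount w 0 n = (if n = 0 then 1 else 0)"
  by (simp add: wcount_def parts_le_0)

lemma wcount_Suc:
  "wcount w (Suc m) n = wcount w m n + (if Suc m \<le> n then w * wcount w (Suc m) (n - Suc m) else 0)"
proof -
  have "wcount w (Suc m) n = (\<Sum>xs\<in>parts_le m n. w ^ length xs) +
     (\<Sum>xs\<in>{xs \<in> partitions n. xs \<noteq> [] \<and> last xs = Suc m}. w ^ length xs)"
    unfolding wcount_def parts_le_Suc
  proof (rule sum.union_disjoint)
    show "finite {xs \<in> partitions n. xs \<noteq> [] \<and> last xs = Suc m}" using finite_partitions by simp
    show "parts_le m n \<inter> {xs \<in> partitions n. xs \<noteq> [] \<and> last xs = Suc m} = {}"
      by (force simp: parts_le_def dest: last_in_set)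
  qed (rule finite_parts_le)
  thus ?thesis unfolding sum_last_part by (simp add: wcount_def)
qed

text \<open>Only polynomial growth in \<open>n\<close> for fixed \<open>m\<close> matters: it
  secures convergence of the generating function before \<open>wcount_sums\<close> solves for its
  value.\<close>

lemma norm_wcount_le:
  assumes w: "norm w \<le> 1"
  shows "norm (wcount w m n) \<le> (real n + 1) ^ m"
proof (induction m arbitrary: n)
  case (Suc m)
  note IH = this
  show ?case
  proof (induction n rule: less_induct)
    case (less n)
    show ?case
    proof (cases "Suc m \<le> n")
      case False
      have "norm (wcount w (Suc m) n) \<le> (real n + 1) ^ m" using IH False by (simp add: wcount_Suc)
      also have "\<dots> \<le> (real n + 1) ^ Suc m" by (intro power_increasing) auto
      finally show ?thesis .
    next
      case True
      have "norm (wcount w (Suc m) n) \<le> norm (wcount w m n) + norm (w * wcount w (Suc m) (n - Suc m))"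
        by (subst wcount_Suc) (use True in \<open>simp add: norm_triangle_ineq\<close>)
      also have "norm (w * wcount w (Suc m) (n - Suc m)) \<le> 1 * (real (n - Suc m) + 1) ^ Suc m"
        unfolding norm_mult by (intro mult_mono w less) (use True in auto)
      also have "\<dots> \<le> 1 * (real n * (real n + 1) ^ m)"
        using True by (auto intro!: mult_mono power_mono)
      finally have "norm (wcount w (Suc m) n) \<le> (real n + 1) ^ m + real n * (real n + 1) ^ m"
        using IH[of n] by simp
      thus ?thesis by (simp add: algebra_simps)
    qed
  qed
qed (simp add: wcount_0)

lemma summable_poly_geometric:
  assumes "0 \<le> r" "r < (1::real)"
  shows "summable (\<lambda>n. (real n + 1) ^ m * r ^ n)"
proof (cases "r = 0")
  case True
  thus ?thesis by (intro summable_finite[of "{0}"]) auto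
next
  case False
  hence r: "r > 0" using assms by simp
  have "(\<lambda>n. ((real n + 2) / (real n + 1)) ^ m * r) \<longlonglongrightarrow> 1 ^ m * r"
    by (intro tendsto_intros) real_asymp
  hence "eventually (\<lambda>n. ((real n + 2) / (real n + 1)) ^ m * r < (1 + r) / 2) sequentially"
    by (rule order_tendstoD) (use assms in auto)
  then obtain K where K: "\<And>n. n \<ge> K \<Longrightarrow> ((real n + 2) / (real n + 1)) ^ m * r < (1 + r) / 2"
    unfolding eventually_sequentially by blast
  show ?thesis
  proof (rule summable_ratio_test[of "(1 + r) / 2" K])
    fix n assume n: "n \<ge> K"
    have "(real (Suc n) + 1) ^ m * r ^ Suc n = (((real n + 2) / (real n + 1)) ^ m * r) * ((real n + 1) ^ m * r ^ n)"
      by (simp add: power_divide add.commute)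
    also have "\<dots> \<le> (1 + r) / 2 * ((real n + 1) ^ m * r ^ n)"
      using K[OF n] r by (intro mult_right_mono) auto
    finally show "norm ((real (Suc n) + 1) ^ m * r ^ Suc n) \<le> (1 + r) / 2 * norm ((real n + 1) ^ m * r ^ n)"
      using r by (simp add: abs_mult)
  qed (use assms in auto)
qed

lemma wcount_sums:
  assumes w: "norm w \<le> 1" and u: "norm u < 1"
  shows "(\<lambda>n. wcount w m n * u ^ n) sums (1 / qpoch (-(w * u)) u m)"
proof (induction m)
  case 0
  show ?case using sums_single[of 0 "\<lambda>n. u ^ n"] by (simp add: wcount_0 if_distrib if_distribR cong: if_cong)
next
  case (Suc m)
  have summ: "summable (\<lambda>n. wcount w (Suc m) n * u ^ n)"
  proof (rule summable_comparison_test')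
    show "summable (\<lambda>n. (real n + 1) ^ Suc m * norm u ^ n)"
      by (rule summable_poly_geometric) (use u in auto)
    show "norm (wcount w (Suc m) n * u ^ n) \<le> (real n + 1) ^ Suc m * norm u ^ n" for n
      unfolding norm_mult norm_power by (intro mult_right_mono norm_wcount_le w) auto
  qed
  then obtain S where S: "(\<lambda>n. wcount w (Suc m) n * u ^ n) sums S" by (auto simp: summable_def)
  have "(\<lambda>n. (w * u ^ Suc m) * (wcount w (Suc m) n * u ^ n)) sums (w * u ^ Suc m * S)"
    by (intro sums_mult S)
  also have "(\<lambda>n. (w * u ^ Suc m) * (wcount w (Suc m) n * u ^ n)) =
     (\<lambda>n. (\<lambda>n. (if Suc m \<le> n then w * wcount w (Suc m) (n - Suc m) else 0) * u ^ n) (n + Suc m))"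
    by (rule ext) (simp add: power_add mult_ac)
  finally have "(\<lambda>n. (if Suc m \<le> n then w * wcount w (Suc m) (n - Suc m) else 0) * u ^ n) sums (w * u ^ Suc m * S)"
    by (subst (asm) sums_iff_shift) simp
  from sums_add[OF Suc this] have "(\<lambda>n. wcount w (Suc m) n * u ^ n) sums (1 / qpoch (-(w * u)) u m + w * u ^ Suc m * S)"
    by (subst wcount_Suc) (simp add: algebra_simps)
  from sums_unique2[OF S this] have *: "S * (1 - w * u ^ Suc m) = 1 / qpoch (-(w * u)) u m"
    by (simp add: algebra_simps)
  have wu: "norm (-(w * u)) < 1" using mult_right_mono[OF w, of "norm u"] u by (simp add: norm_mult)
  have "1 + -(w * u) * u ^ m \<noteq> 0" "qpoch (-(w * u)) u m \<noteq> 0"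
    by (rule one_plus_power_nonzero[OF wu u] qpoch_nonzero[OF wu u])+
  hence "S = 1 / qpoch (-(w * u)) u (Suc m)"
    using * by (simp add: qpoch_Suc field_simps)
  thus ?case using S by simp
qed

lemma alpha_eq_sum: "complex_of_int (\<alpha> n) = (\<Sum>xs\<in>partitions n. if even (Defs.rank xs) then 1 else -1)"
proof -
  have "[Defs.rank xs = 0] (mod int 2) \<longleftrightarrow> even (Defs.rank xs)" "[Defs.rank xs = 1] (mod int 2) \<longleftrightarrow> \<not> even (Defs.rank xs)" for xs
    by (simp_all add: cong_iff_dvd_diff)
  hence "\<alpha> n = int (card {xs \<in> partitions n. even (Defs.rank xs)}) - int (card {xs \<in> partitions n. \<not> even (Defs.rank xs)})"
    by (simp add: \<alpha>_def N_def)
  moreover have "(\<Sum>xs\<in>partitions n. if even (Defs.rank xs) then (1::complex) else -1) =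
     of_nat (card {xs \<in> partitions n. even (Defs.rank xs)}) - of_nat (card {xs \<in> partitions n. \<not> even (Defs.rank xs)})"
    by (subst sum.If_cases[OF finite_partitions]) (auto simp: Int_def)
  ultimately show ?thesis by simp
qed

lemma alpha_0: "\<alpha> 0 = 1"
proof -
  have "xs = []" if "xs \<in> partitions 0" for xs
    using that by (cases xs) (auto simp: partitions_def)
  hence "partitions 0 = {[]}" by (auto simp: partitions_def)
  hence "complex_of_int (\<alpha> 0) = 1" unfolding alpha_eq_sum by (simp add: Defs.rank_def)
  thus ?thesis by simp
qed

text \<open>The rank has the parity of the largest part plus the number of parts. Splitting off the
  largest part \<open>m\<close> removes one part from the count, hence the overall minus sign; the
  term \<open>m = 0\<close> vanishes for positive \<open>n\<close>.\<close>

lemma alpha_eq_wcount: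
  assumes n: "n > 0"
  shows "complex_of_int (\<alpha> n) = - (\<Sum>m\<le>n. (-1) ^ m * wcount (-1) m (n - m))"
proof -
  define f where "f = (\<lambda>xs. if even (Defs.rank xs) then (1::complex) else -1)"
  have last_le: "last xs \<in> {1..n}" "xs \<noteq> []" if "xs \<in> partitions n" for xs
  proof -
    show "xs \<noteq> []" using that n by (auto simp: partitions_def)
    hence "last xs \<in> set xs" by simp
    moreover from this have "last xs \<le> sum_list xs" by (rule member_le_sum_list) auto
    ultimately show "last xs \<in> {1..n}" using that by (auto simp: partitions_def Suc_le_eq)
  qed
  have "complex_of_int (\<alpha> n) = (\<Sum>xs\<in>partitions n. f xs)" unfolding alpha_eq_sum f_def ..
  also have "\<dots> = (\<Sum>m\<in>{1..n}. \<Sum>xs\<in>{xs \<in> partitions n. last xs = m}. f xs)"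
    by (rule sum.group[symmetric]) (use finite_partitions last_le in auto)
  also have "\<dots> = (\<Sum>m\<in>{1..n}. - ((-1) ^ m * wcount (-1) m (n - m)))"
  proof (rule sum.cong)
    fix m assume m: "m \<in> {1..n}"
    then obtain k where k: "m = Suc k" by (cases m) auto
    have "(\<Sum>xs\<in>{xs \<in> partitions n. last xs = m}. f xs) =
        (\<Sum>xs\<in>{xs \<in> partitions n. xs \<noteq> [] \<and> last xs = Suc k}. (-1) ^ m * (-1) ^ length xs)"
    proof (rule sum.cong)
      fix xs assume xs: "xs \<in> {xs \<in> partitions n. xs \<noteq> [] \<and> last xs = Suc k}"
      hence "even (Defs.rank xs) \<longleftrightarrow> even (m + length xs)" by (auto simp: Defs.rank_def k)
      thus "f xs = (-1) ^ m * (-1) ^ length xs" by (simp add: f_def power_add[symmetric])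
    qed (use last_le k in auto)
    also have "\<dots> = - ((-1) ^ m * wcount (-1) m (n - m))"
      unfolding sum_distrib_left[symmetric] sum_last_part using m by (simp add: k)
    finally show "(\<Sum>xs\<in>{xs \<in> partitions n. last xs = m}. f xs) = - ((-1) ^ m * wcount (-1) m (n - m))" .
  qed auto
  also have "\<dots> = (\<Sum>m\<le>n. - ((-1) ^ m * wcount (-1) m (n - m)))"
    by (rule sum.mono_neutral_left) (use n in \<open>auto simp: wcount_0 not_le\<close>)
  finally show ?thesis by (simp add: sum_negf)
qed

text \<open>Up to index \<open>K\<close> the partition numbers agree with the counts having parts at
  most \<open>K\<close>, whose generating function is a finite product. These products are bounded
  uniformly in \<open>K\<close>. The result is the majorant, independent of the largest part, for
  summing over all largest parts.\<close>

lemma summable_wcount_1: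
  assumes r: "0 \<le> r" "r < 1"
  shows "summable (\<lambda>n. real (card (partitions n)) * r ^ n)"
proof -
  have p: "wcount 1 m n = of_nat (card (partitions n))" if "n \<le> m" for m n
  proof -
    have "parts_le m n = partitions n"
    proof -
      have "x \<le> m" if xs: "xs \<in> partitions n" and x: "x \<in> set xs" for xs x
      proof -
        have "x \<le> sum_list xs" by (rule member_le_sum_list[OF x]) auto
        thus ?thesis using xs \<open>n \<le> m\<close> by (simp add: partitions_def)
      qed
      thus ?thesis by (auto simp: parts_le_def)
    qed
    thus ?thesis by (simp add: wcount_def)
  qed
  have rc: "norm (complex_of_real r) < 1" using r by simp
  obtain C where C: "C > 0" "\<And>n. norm (inverse (qpoch (- of_real r) (of_real r) n)) \<le> C"
    using inverse_qpoch_bounded[of "-of_real r" "of_real r"] rc by auto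
  show ?thesis
  proof (rule bounded_imp_summable)
    fix K
    define g where "g = (\<lambda>n. Re (wcount 1 K n) * r ^ n)"
    have g0: "g n \<ge> 0" for n using r by (simp add: g_def wcount_def)
    have "(\<lambda>n. wcount 1 K n * of_real r ^ n) sums (1 / qpoch (-(1 * of_real r)) (of_real r) K)"
      by (rule wcount_sums) (use rc in auto)
    hence "(\<lambda>n. Re (wcount 1 K n * of_real r ^ n)) sums Re (1 / qpoch (-(1 * of_real r)) (of_real r) K)"
      by (rule sums_Re)
    hence g: "g sums Re (1 / qpoch (-(1 * of_real r)) (of_real r) K)"
      by (simp add: g_def flip: of_real_power)
    have "(\<Sum>n\<le>K. real (card (partitions n)) * r ^ n) = (\<Sum>n\<le>K. g n)"
      by (rule sum.cong) (auto simp: g_def p)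
    also have "\<dots> \<le> (\<Sum>n. g n)" using g g0 by (intro sum_le_suminf) (auto simp: sums_iff)
    also have "\<dots> \<le> norm (1 / qpoch (-(1 * of_real r)) (of_real r) K)"
      unfolding sums_unique[OF g, symmetric] by (rule complex_Re_le_cmod)
    also have "\<dots> \<le> C" using C(2)[of K] by (simp add: inverse_eq_divide)
    finally show "(\<Sum>n\<le>K. real (card (partitions n)) * r ^ n) \<le> C" .
  qed (use r in auto)
qed

theorem alpha_generating_function:
  assumes x: "norm x < 1"
  shows "(\<lambda>n. of_int (\<alpha> n) * (-x) ^ n) sums (2 * phi3 x - theta_weber x)"
proof -
  define f where "f = (\<lambda>m k. x ^ m * (wcount (-1) m k * (-x) ^ k))"
  obtain S where S: "(\<lambda>m. x ^ m / qpoch (-x) (-x) m) sums S" "(\<lambda>n. \<Sum>k\<le>n. f (n - k) k) sums S"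
  proof (rule dominated_double_sums)
    show "summable (\<lambda>m. norm x ^ m)" using x by (intro summable_geometric) auto
    show "summable (\<lambda>k. real (card (partitions k)) * norm x ^ k)"
      by (rule summable_wcount_1) (use x in auto)
    show "norm (f m k) \<le> norm x ^ m * (real (card (partitions k)) * norm x ^ k)" for m k
    proof -
      have "norm (wcount (-1) m k) \<le> (\<Sum>xs\<in>parts_le m k. 1)"
        unfolding wcount_def by (rule order_trans[OF norm_sum]) (auto simp: norm_power)
      also have "\<dots> \<le> real (card (partitions k))"
        using card_mono[OF finite_partitions, of "parts_le m k" k] by (auto simp: parts_le_def)
      finally show ?thesis unfolding f_def norm_mult norm_power norm_minus_cancel
        by (intro mult_left_mono, rule mult_right_mono) auto
    qed
    show "f m sums (x ^ m / qpoch (-x) (-x) m)" for m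
      using sums_mult[OF wcount_sums[of "-1" "-x" m], of "x ^ m"] x by (simp add: f_def)
  qed auto
  \<comment> \<open>For \<open>n = 0\<close> the diagonal sum is 1, whereas
    \<open>\<alpha> 0 = 1\<close> (the empty partition has rank 0) enters with a minus sign. The
    correction 2 then cancels the constant 2 of \<open>mock_theta_identity\<close>.\<close>
  have diag: "(\<Sum>k\<le>n. f (n - k) k) = (if n = 0 then 2 else 0) - of_int (\<alpha> n) * (-x) ^ n" for n
  proof (cases "n = 0")
    case True thus ?thesis by (simp add: f_def wcount_0 alpha_0)
  next
    case False
    have "(\<Sum>k\<le>n. f (n - k) k) = (\<Sum>m\<le>n. f m (n - m))"
      by (rule sum.reindex_bij_witness[of _ "\<lambda>m. n - m" "\<lambda>m. n - m"]) auto
    also have "\<dots> = (\<Sum>m\<le>n. (-1) ^ m * wcount (-1) m (n - m)) * (-x) ^ n"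
      unfolding sum_distrib_right
    proof (rule sum.cong)
      fix m assume "m \<in> {..n}"
      hence "(-x) ^ n = (-x) ^ m * (-x) ^ (n - m)" by (simp flip: power_add)
      moreover have "(-1) ^ m * (-x) ^ m = x ^ m" by (simp flip: power_mult_distrib)
      ultimately show "f m (n - m) = (-1) ^ m * wcount (-1) m (n - m) * (-x) ^ n"
        unfolding f_def by (simp add: mult_ac)
    qed auto
    also have "\<dots> = - of_int (\<alpha> n) * (-x) ^ n" using alpha_eq_wcount[of n] False by simp
    finally show ?thesis using False by simp
  qed
  have S': "S = theta_weber x + 2 - 2 * phi3 x"
    using sums_unique2[OF S(1) mock_theta_identity[OF x]] .
  have "(\<lambda>n. (if n = 0 then 2 else 0) - (\<Sum>k\<le>n. f (n - k) k)) sums (2 - S)"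
    by (intro sums_diff S(2) sums_single[of 0 "\<lambda>_. 2", simplified])
  thus ?thesis by (simp add: diag S')
qed

subsection \<open>The Jacobi triple product and the Weber product\<close>

lemma has_sum_int:
  fixes a :: "int \<Rightarrow> complex"
  assumes "summable (\<lambda>n. norm (a (int n)))" "(\<lambda>n. a (int n)) sums A"
    and "summable (\<lambda>n. norm (a (- int (Suc n))))" "(\<lambda>n. a (- int (Suc n))) sums B"
  shows "(a has_sum (A + B)) UNIV"
proof -
  have 1: "(a has_sum A) (range int)"
    by (subst has_sum_reindex) (use norm_summable_imp_has_sum[OF assms(1,2)] in \<open>auto simp: o_def\<close>)
  have 2: "(a has_sum B) (range (\<lambda>n. - int (Suc n)))"
    by (subst has_sum_reindex) (use norm_summable_imp_has_sum[OF assms(3,4)] in \<open>auto simp: o_def inj_on_def\<close>)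
  have "range int \<inter> range (\<lambda>n. - int (Suc n)) = {}" by auto
  from has_sum_Un_disjoint[OF 1 2 this] have "(a has_sum (A + B)) (range int \<union> range (\<lambda>n. - int (Suc n)))" .
  moreover have "range int \<union> range (\<lambda>n. - int (Suc n)) = UNIV"
  proof -
    have "z \<in> range int \<union> range (\<lambda>n. - int (Suc n))" for z
      by (cases z rule: int_cases) auto
    thus ?thesis by auto
  qed
  ultimately show ?thesis by simp
qed

lemma abs_summable_int:
  fixes a :: "int \<Rightarrow> complex"
  assumes "summable (\<lambda>n. norm (a (int n)))" "summable (\<lambda>n. norm (a (- int (Suc n))))"
  shows "(\<lambda>n. norm (a n)) summable_on UNIV"
proof -
  \<comment> \<open>The norms are regarded as complex numbers so that \<open>has_sum_int\<close> can
    join the two halves.\<close>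
  have "((\<lambda>n. complex_of_real (norm (a n))) has_sum
     ((\<Sum>n. complex_of_real (norm (a (int n)))) + (\<Sum>n. complex_of_real (norm (a (- int (Suc n))))))) UNIV"
  proof (rule has_sum_int)
    show "(\<lambda>n. complex_of_real (norm (a (int n)))) sums (\<Sum>n. complex_of_real (norm (a (int n))))"
      by (intro summable_sums summable_of_real assms)
    show "(\<lambda>n. complex_of_real (norm (a (- int (Suc n))))) sums (\<Sum>n. complex_of_real (norm (a (- int (Suc n)))))"
      by (intro summable_sums summable_of_real assms)
  qed (use assms in \<open>simp_all only: norm_of_real abs_norm_cancel\<close>)
  hence "(\<lambda>n. complex_of_real (norm (a n))) summable_on UNIV" by (rule has_sum_imp_summable)
  thus ?thesis by (simp add: summable_on_iff_abs_summable_on_complex)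
qed

text \<open>Multiply the theta series by the expansion of the reciprocal of
  \<open>qprod (x / y) X\<close> (this uses |x/y| < 1) and sum over k at fixed shifted index n. The
  inner sum is (x^(2n+2); X), which vanishes for negative n, so a one-sided series remains, and
  \<open>euler_sum1\<close> evaluates it.\<close>

theorem jacobi_triple_product:
  assumes x: "norm x < 1" "x \<noteq> 0" and y: "norm x < norm y"
    and theta: "((\<lambda>n::int. x ^ nat (n\<^sup>2) * y powi n) has_sum \<Theta>) UNIV"
    and theta_abs: "(\<lambda>n::int. norm (x ^ nat (n\<^sup>2) * y powi n)) summable_on UNIV"
  shows "\<Theta> = qprod (-(x\<^sup>2)) (x\<^sup>2) * qprod (x * y) (x\<^sup>2) * qprod (x / y) (x\<^sup>2)"
proof -
  define X where "X = x\<^sup>2"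
  have X: "norm X < 1" unfolding X_def using x norm_square_less_1 by blast
  have y0: "y \<noteq> 0" using y by auto
  have xy: "norm (x / y) < 1" using y y0 by (simp add: norm_divide)
  have nz: "qpoch (-X) X m \<noteq> 0" for m using qpoch_nonzero[of "-X" X] X by auto
  define a where "a = (\<lambda>n::int. x ^ nat (n\<^sup>2) * y powi n)"
  define b where "b = (\<lambda>k. 1 / qpoch (-X) X k * (- (x / y)) ^ k)"
  have b_abs: "summable (\<lambda>k. norm (b k))" unfolding b_def by (rule summable_euler2) (use X xy in auto)
  have b: "(b has_sum (1 / qprod (x / y) X)) UNIV"
  proof (rule norm_summable_imp_has_sum[OF b_abs])
    show "b sums (1 / qprod (x / y) X)"
      unfolding b_def using euler_sum2[OF X, of "- (x / y)"] xy by simp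
  qed
  have summ: "(\<lambda>(n, k). a n * b k) summable_on (UNIV \<times> UNIV)"
    by (rule summable_on_product_bound[of "\<lambda>n. norm (a n)" _ "\<lambda>k. norm (b k)"])
       (use theta_abs b_abs in \<open>auto simp: a_def norm_mult intro: summable_on_nat_nonneg\<close>)
  define S where "S = infsum (\<lambda>(n, k). a n * b k) (UNIV \<times> UNIV)"
  have S: "((\<lambda>(n, k). a n * b k) has_sum S) (UNIV \<times> UNIV)" unfolding S_def using summ by (rule has_sum_infsum)
  have "((\<lambda>n. a n * (1 / qprod (x / y) X)) has_sum S) UNIV"
  proof (rule has_sum_SigmaD[OF S])
    show "((\<lambda>k. case (n, k) of (n, k) \<Rightarrow> a n * b k) has_sum a n * (1 / qprod (x / y) X)) UNIV" for n
      using has_sum_cmult_right[OF b, of "a n"] by simp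
  qed
  moreover have "((\<lambda>n. a n * (1 / qprod (x / y) X)) has_sum (\<Theta> * (1 / qprod (x / y) X))) UNIV"
    using has_sum_cmult_left[OF theta] unfolding a_def .
  ultimately have S1: "S = \<Theta> * (1 / qprod (x / y) X)" by (rule has_sum_unique)
  have S2: "((\<lambda>(n, k). a (n + int k) * b k) has_sum S) (UNIV \<times> UNIV)"
    using S by (subst has_sum_reindex_bij_witness[of _ "\<lambda>(m, k). (m - int k, k)" "\<lambda>(n, k). (n + int k, k)"]) auto
  define g where "g = (\<lambda>n::int. if n \<ge> 0 then qprod (-X) X * (x ^ nat (n\<^sup>2) * y powi n / qpoch (-X) X (nat n)) else 0)"
  have ab: "a (n + int k) * b k = x ^ nat (n\<^sup>2) * y powi n * (X ^ (k choose 2) / qpoch (-X) X k * (- (x powi (2 * n + 2))) ^ k)" for n k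
  proof -
    have "a (n + int k) * b k = y powi (n + int k) / y ^ k * (x ^ nat ((n + int k)\<^sup>2) * x ^ k) * (-1) ^ k / qpoch (-X) X k"
      unfolding a_def b_def by (simp add: power_divide power_minus[of "x / y"] mult_ac)
    also have "y powi (n + int k) / y ^ k = y powi n" using y0 by (simp add: power_int_add)
    also have "x ^ nat ((n + int k)\<^sup>2) * x ^ k = x ^ nat (n\<^sup>2) * (X ^ (k choose 2) * (x powi (2 * n + 2)) ^ k)"
    proof -
      have "k \<le> k\<^sup>2" by (simp add: power2_eq_square)
      hence "int (k\<^sup>2 - k) = int k * int k - int k" by (simp add: of_nat_diff power2_eq_square)
      hence e: "(n + int k)\<^sup>2 + int k = n\<^sup>2 + (int (k\<^sup>2 - k) + (2 * n + 2) * int k)"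
        by (simp add: power2_eq_square algebra_simps)
      have sq: "x ^ nat (m\<^sup>2) = x powi (m\<^sup>2)" for m :: int
        by (simp add: power_int_def)
      have "x ^ nat ((n + int k)\<^sup>2) * x ^ k = x powi ((n + int k)\<^sup>2 + int k)"
        unfolding sq using x by (simp add: power_int_add)
      also have "\<dots> = x powi (n\<^sup>2) * (x powi (int (k\<^sup>2 - k)) * x powi ((2 * n + 2) * int k))"
        unfolding e using x by (simp only: power_int_add disj_not1 simp_thms)
      also have "x powi (int (k\<^sup>2 - k)) = X ^ (k choose 2)"
        unfolding power_int_of_nat X_def square_power_choose_two ..
      also have "x powi ((2 * n + 2) * int k) = (x powi (2 * n + 2)) ^ k" by (simp only: power_int_mult power_int_of_nat)
      finally show ?thesis unfolding sq .
    qed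
    finally show ?thesis by (simp add: power_minus[of "x powi _"])
  qed
  have row: "((\<lambda>k. a (n + int k) * b k) has_sum g n) UNIV" for n
  proof -
    have "(\<lambda>k. X ^ (k choose 2) / qpoch (-X) X k * (- (x powi (2 * n + 2))) ^ k) sums qprod (- (x powi (2 * n + 2))) X"
      by (rule euler_sum1[OF X])
    hence "((\<lambda>k. X ^ (k choose 2) / qpoch (-X) X k * (- (x powi (2 * n + 2))) ^ k) has_sum qprod (- (x powi (2 * n + 2))) X) UNIV"
      by (rule norm_summable_imp_has_sum[OF summable_euler1[OF X]])
    hence "((\<lambda>k. a (n + int k) * b k) has_sum (x ^ nat (n\<^sup>2) * y powi n * qprod (- (x powi (2 * n + 2))) X)) UNIV"
      unfolding ab by (rule has_sum_cmult_right)
    also have "x ^ nat (n\<^sup>2) * y powi n * qprod (- (x powi (2 * n + 2))) X = g n"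
    proof (cases "n \<ge> 0")
      case True
      then obtain m where m: "n = int m" by (metis nonneg_int_cases)
      have "x powi (2 * n + 2) = x powi (int (2 * Suc m))" by (simp add: m add.commute)
      also have "\<dots> = X * X ^ m" unfolding power_int_of_nat X_def by (simp only: power_mult power_Suc)
      finally have "x powi (2 * n + 2) = X * X ^ m" .
      moreover have "qprod (-X) X = qpoch (-X) X m * qprod (- (X * X ^ m)) X"
        using qprod_split[OF X, of "-X" m] by simp
      ultimately show ?thesis using nz[of m] by (simp add: g_def m)
    next
      case False
      define m where "m = nat (- n - 1)"
      have m: "n = - int (Suc m)" using False by (simp add: m_def)
      have "2 * n + 2 = - int (2 * m)" by (simp add: m)
      hence "x powi (2 * n + 2) = inverse (X ^ m)"
        by (simp only: power_int_minus power_int_of_nat X_def power_mult)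
      \<comment> \<open>For negative n the exponent 2 n + 2 equals -2 m, so the factor with index m
        is 1 - 1 = 0.\<close>
      hence "1 + - (x powi (2 * n + 2)) * X ^ m = 0" using x by (simp add: X_def)
      moreover have "qprod (- (x powi (2 * n + 2))) X = qpoch (- (x powi (2 * n + 2))) X (Suc m) * qprod (- (x powi (2 * n + 2)) * X ^ Suc m) X"
        by (rule qprod_split[OF X])
      ultimately have "qprod (- (x powi (2 * n + 2))) X = 0" by (simp add: qpoch_Suc)
      thus ?thesis using False by (simp add: g_def)
    qed
    finally show ?thesis .
  qed
  have "(g has_sum S) UNIV"
    by (rule has_sum_SigmaD[OF S2]) (use row in auto)
  moreover have "(g has_sum S) UNIV \<longleftrightarrow> (g has_sum S) (range int)"
    by (rule has_sum_cong_neutral) (auto simp: g_def image_iff elim: nonneg_int_cases)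
  ultimately have "(g has_sum S) (range int)" by simp
  hence "((\<lambda>n. g (int n)) has_sum S) UNIV"
    by (subst (asm) has_sum_reindex) (auto simp: o_def)
  hence g1: "(\<lambda>n. g (int n)) sums S" by (rule has_sum_imp_sums)
  have "(\<lambda>n. qprod (-X) X * (X ^ (n choose 2) / qpoch (-X) X n * (x * y) ^ n)) sums (qprod (-X) X * qprod (x * y) X)"
    by (intro sums_mult euler_sum1 X)
  also have "(\<lambda>n. qprod (-X) X * (X ^ (n choose 2) / qpoch (-X) X n * (x * y) ^ n)) = (\<lambda>n. g (int n))"
  proof
    fix n :: nat
    have "n \<le> n\<^sup>2" by (simp add: power2_eq_square)
    hence "x ^ (n\<^sup>2) = x ^ (n\<^sup>2 - n) * x ^ n" by (simp flip: power_add)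
    also have "x ^ (n\<^sup>2 - n) = X ^ (n choose 2)" unfolding X_def square_power_choose_two ..
    finally have "x ^ (n\<^sup>2) = X ^ (n choose 2) * x ^ n" .
    moreover have "nat ((int n)\<^sup>2) = n\<^sup>2" by (simp add: nat_power_eq)
    ultimately show "qprod (-X) X * (X ^ (n choose 2) / qpoch (-X) X n * (x * y) ^ n) = g (int n)"
      by (simp add: g_def power_mult_distrib mult_ac)
  qed
  finally have "S = qprod (-X) X * qprod (x * y) X" using g1 sums_unique2 by blast
  moreover have "qprod (x / y) X \<noteq> 0" by (rule qprod_nonzero) (use xy X in auto)
  ultimately show ?thesis using S1 unfolding X_def[symmetric] by (simp add: field_simps)
qed


section \<open>Theta functions and the sixth power of Weber's product\<close>

definition theta3 :: "complex \<Rightarrow> complex" where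
  "theta3 x = 1 + 2 * thetaplus x"

lemma theta3_product:
  assumes x: "norm x < 1" "x \<noteq> 0"
  shows "theta3 x = qprod (-(x\<^sup>2)) (x\<^sup>2) * (qprod x (x\<^sup>2))\<^sup>2"
proof -
  define a where "a = (\<lambda>n::int. x ^ nat (n\<^sup>2) * 1 powi n)"
  have a1: "a (int n) = x ^ (n\<^sup>2)" for n by (simp add: a_def nat_power_eq)
  have "nat ((- int (Suc n))\<^sup>2) = (Suc n)\<^sup>2" for n
    by (simp only: power2_minus) (simp only: nat_power_eq of_nat_0_le_iff nat_int)
  hence a2: "a (- int (Suc n)) = x ^ ((Suc n)\<^sup>2)" for n by (simp add: a_def)
  have summ: "summable (\<lambda>n. norm (x ^ ((Suc n)\<^sup>2)))"
    using summable_power_square[OF x(1)] by (subst summable_Suc_iff)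
  have "(\<lambda>n. x ^ (n\<^sup>2)) sums (thetaplus x + x ^ (0\<^sup>2))"
    using thetaplus_sums[OF x(1)] by (subst (asm) sums_Suc_iff) simp
  hence "(a has_sum (thetaplus x + x ^ (0\<^sup>2) + thetaplus x)) UNIV"
    by (intro has_sum_int) (use summ summable_power_square[OF x(1)] thetaplus_sums[OF x(1)] in \<open>simp_all only: a1 a2\<close>)
  hence sum: "(a has_sum theta3 x) UNIV" by (simp add: theta3_def algebra_simps)
  have abs: "(\<lambda>n. norm (a n)) summable_on UNIV"
    by (rule abs_summable_int) (use summ summable_power_square[OF x(1)] in \<open>simp_all only: a1 a2\<close>)
  have "theta3 x = qprod (-(x\<^sup>2)) (x\<^sup>2) * qprod (x * 1) (x\<^sup>2) * qprod (x / 1) (x\<^sup>2)"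
    by (rule jacobi_triple_product) (use x sum abs in \<open>auto simp: a_def\<close>)
  thus ?thesis by (simp add: power2_eq_square)
qed

text \<open>The triple product at \<open>y = 1 / x\<close>. The exponents n^2 - n are invariant
  under n -> 1 - n, so the two-sided sum is twice the one-sided one, matching the leading factor 1 +
  1 of \<open>qprod 1 (x\<^sup>2)\<close>. Up to a factor 2 x^(1/4) this is theta_2.\<close>

lemma oblong_sums:
  assumes x: "norm x < 1" "x \<noteq> 0"
  shows "(\<lambda>n. x ^ (n\<^sup>2 + n)) sums (qprod (-(x\<^sup>2)) (x\<^sup>2) * (qprod (x\<^sup>2) (x\<^sup>2))\<^sup>2)"
proof -
  define a where "a = (\<lambda>n::int. x ^ nat (n\<^sup>2) * (1 / x) powi n)"
  have summ0: "summable (\<lambda>n. norm (x ^ (n\<^sup>2 + n)))"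
  proof (rule summable_comparison_test')
    show "summable (\<lambda>n. norm x ^ n)" using x by (intro summable_geometric) auto
    show "norm (norm (x ^ (n\<^sup>2 + n))) \<le> norm x ^ n" for n
      using x by (auto simp: norm_power intro!: power_decreasing)
  qed
  then obtain R where R: "(\<lambda>n. x ^ (n\<^sup>2 + n)) sums R" by (metis summable_norm_cancel summable_def)
  have R2: "(\<lambda>n. x ^ ((Suc n)\<^sup>2 + Suc n)) sums (R - 1)"
    using R by (subst sums_Suc_iff[of "\<lambda>n. x ^ (n\<^sup>2 + n)"]) simp
  have summ2: "summable (\<lambda>n. norm (x ^ ((Suc n)\<^sup>2 + Suc n)))"
    using summ0 by (subst summable_Suc_iff[of "\<lambda>n. norm (x ^ (n\<^sup>2 + n))"])
  have e: "(Suc n)\<^sup>2 - Suc n = n\<^sup>2 + n" for n by (simp add: power2_eq_square)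
  have R1: "(\<lambda>n. x ^ (n\<^sup>2 - n)) sums (R + 1)"
    using R unfolding e[symmetric] by (subst (asm) sums_Suc_iff[of "\<lambda>n. x ^ (n\<^sup>2 - n)"]) simp
  have summ1: "summable (\<lambda>n. norm (x ^ (n\<^sup>2 - n)))"
    using summ0 unfolding e[symmetric] by (subst (asm) summable_Suc_iff[of "\<lambda>n. norm (x ^ (n\<^sup>2 - n))"])
  have a1: "a (int n) = x ^ (n\<^sup>2 - n)" for n
  proof -
    have "n \<le> n\<^sup>2" by (simp add: power2_eq_square)
    hence "x ^ (n\<^sup>2) = x ^ (n\<^sup>2 - n) * x ^ n" by (simp flip: power_add)
    moreover have "nat ((int n)\<^sup>2) = n\<^sup>2" by (simp add: nat_power_eq)
    ultimately show ?thesis using x by (simp add: a_def power_divide)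
  qed
  have a2: "a (- int (Suc n)) = x ^ ((Suc n)\<^sup>2 + Suc n)" for n
  proof -
    have "nat ((- int (Suc n))\<^sup>2) = (Suc n)\<^sup>2"
      by (simp only: power2_minus) (simp only: nat_power_eq of_nat_0_le_iff nat_int)
    moreover have "(1 / x) powi (- int (Suc n)) = x ^ Suc n"
      by (simp only: power_int_minus power_int_of_nat power_one_over inverse_inverse_eq inverse_eq_divide div_by_1 divide_divide_eq_right mult_1)
    ultimately show ?thesis unfolding a_def by (simp only: power_add)
  qed
  have "(a has_sum (R + 1 + (R - 1))) UNIV"
    by (intro has_sum_int) (use summ1 summ2 R1 R2 in \<open>simp_all only: a1 a2\<close>)
  hence sum: "(a has_sum (2 * R)) UNIV" by (simp add: algebra_simps)
  have abs: "(\<lambda>n. norm (a n)) summable_on UNIV"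
    by (rule abs_summable_int) (use summ1 summ2 in \<open>simp_all only: a1 a2\<close>)
  have "norm x < norm (1 / x)"
    using x mult_strict_mono[of "norm x" 1 "norm x" 1] by (simp add: norm_divide field_simps)
  hence "2 * R = qprod (-(x\<^sup>2)) (x\<^sup>2) * qprod (x * (1 / x)) (x\<^sup>2) * qprod (x / (1 / x)) (x\<^sup>2)"
    by (intro jacobi_triple_product) (use x sum abs in \<open>auto simp: a_def\<close>)
  also have "x * (1 / x) = 1" using x by simp
  also have "x / (1 / x) = x\<^sup>2" by (simp add: power2_eq_square)
  also have "qprod 1 (x\<^sup>2) = 2 * qprod (x\<^sup>2) (x\<^sup>2)"
    using qprod_rec[OF norm_square_less_1[OF x(1)], of 1] by simp
  finally have "R = qprod (-(x\<^sup>2)) (x\<^sup>2) * (qprod (x\<^sup>2) (x\<^sup>2))\<^sup>2" by (simp add: power2_eq_square)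
  thus ?thesis using R by simp
qed

lemma sums_if_complex:
  fixes f g :: "nat \<Rightarrow> complex"
  assumes "g sums x" "f sums y"
  shows "(\<lambda>n. if even n then f (n div 2) else g ((n - 1) div 2)) sums (x + y)"
  using sums_if[of "\<lambda>n. Re (g n)" "Re x" "\<lambda>n. Re (f n)" "Re y"]
    sums_if[of "\<lambda>n. Im (g n)" "Im x" "\<lambda>n. Im (f n)" "Im y"] assms
  by (simp add: sums_complex_iff if_distrib)

lemma thetaplus_split:
  assumes x: "norm x < 1" and R: "(\<lambda>n. (x ^ 4) ^ (n\<^sup>2 + n)) sums R"
  shows "thetaplus x = thetaplus (x ^ 4) + x * R"
proof -
  have x4: "norm (x ^ 4) < 1" using norm_power_less_1[OF x, of 3] by simp
  \<comment> \<open>The index \<open>n\<close> stands for the square of \<open>Suc n\<close>, so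
    even indices belong to odd squares 4 (k^2 + k) + 1 and odd indices to even squares 4 (k +
    1)^2.\<close>
  have "(\<lambda>n. if even n then x * (x ^ 4) ^ ((n div 2)\<^sup>2 + n div 2) else (x ^ 4) ^ ((Suc ((n - 1) div 2))\<^sup>2)) sums
     (thetaplus (x ^ 4) + x * R)"
    using sums_if_complex[OF thetaplus_sums[OF x4] sums_mult[OF R, of x]] by simp
  also have "(\<lambda>n. if even n then x * (x ^ 4) ^ ((n div 2)\<^sup>2 + n div 2) else (x ^ 4) ^ ((Suc ((n - 1) div 2))\<^sup>2)) = (\<lambda>n. x ^ ((Suc n)\<^sup>2))"
  proof
    fix n
    show "(if even n then x * (x ^ 4) ^ ((n div 2)\<^sup>2 + n div 2) else (x ^ 4) ^ ((Suc ((n - 1) div 2))\<^sup>2)) = x ^ ((Suc n)\<^sup>2)"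
    proof (cases "even n")
      case True
      then obtain k where k: "n = 2 * k" by (elim evenE)
      have "(Suc n)\<^sup>2 = Suc (4 * (k\<^sup>2 + k))" by (simp add: k power2_eq_square algebra_simps)
      hence "x ^ ((Suc n)\<^sup>2) = x * (x ^ 4) ^ (k\<^sup>2 + k)" by (simp only: power_Suc power_mult)
      thus ?thesis using k by simp
    next
      case False
      then obtain k where k: "n = 2 * k + 1" by (elim oddE)
      have "(Suc n)\<^sup>2 = 4 * (Suc k)\<^sup>2" by (simp add: k power2_eq_square algebra_simps)
      thus ?thesis using k by (simp add: power_mult)
    qed
  qed
  finally show ?thesis using thetaplus_sums[OF x] by (rule sums_unique2[symmetric])
qed

text \<open>With \<open>\<theta>\<^sub>2(x) = \<theta>\<^sub>3(x\<^sup>1\<^sup>/\<^sup>4) - \<theta>\<^sub>3(x)\<close> and \<open>\<theta>\<^sub>4(x) = 2 \<theta>\<^sub>3(x\<^sup>4) - \<theta>\<^sub>3(x)\<close> this expresses the sixth power of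
  Weber's product through \<open>\<theta>\<^sub>3\<close> alone.\<close>
lemma weber_sixth_power:
  assumes w: "norm w < 1" "w \<noteq> 0"
  defines "x \<equiv> w ^ 4"
  shows "(qprod x (x\<^sup>2)) ^ 6 * ((theta3 w - theta3 x) * (2 * theta3 (x ^ 4) - theta3 x)) = 2 * w * (theta3 x)\<^sup>2"
proof -
  have x: "norm x < 1" "x \<noteq> 0" and mx: "norm (-x) < 1" "-x \<noteq> 0"
    using norm_power_less_1[OF w(1), of 3] w unfolding x_def by auto
  have x4: "norm (x ^ 4) < 1" "x ^ 4 \<noteq> 0" using norm_power_less_1[OF x(1), of 3] x by auto
  define T P A M where "T = qprod (-(x\<^sup>2)) (x\<^sup>2)" and "P = qprod x (x\<^sup>2)"
    and "A = qprod (-x) (x\<^sup>2)" and "M = qprod (x\<^sup>2) (x\<^sup>2)"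
  have 1: "P * A * M = 1" unfolding P_def A_def M_def by (rule euler_odd_even[OF x(1)])
  have 2: "theta3 x = T * P\<^sup>2" unfolding T_def P_def by (rule theta3_product[OF x])
  have 3: "theta3 (-x) = T * A\<^sup>2" using theta3_product[OF mx] by (simp add: T_def A_def)
  have 4: "theta3 w - theta3 x = 2 * w * (T * M\<^sup>2)"
    using thetaplus_split[OF w(1), folded x_def, OF oblong_sums[OF x]] unfolding T_def M_def theta3_def by simp
  define R where "R = qprod (-((x ^ 4)\<^sup>2)) ((x ^ 4)\<^sup>2) * (qprod ((x ^ 4)\<^sup>2) ((x ^ 4)\<^sup>2))\<^sup>2"
  have "thetaplus x = thetaplus (x ^ 4) + x * R"
    unfolding R_def by (rule thetaplus_split[OF x(1) oblong_sums[OF x4]])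
  moreover have "thetaplus (-x) = thetaplus (x ^ 4) + (-x) * R"
    using thetaplus_split[OF mx(1)] oblong_sums[OF x4] by (simp add: R_def)
  ultimately have 5: "2 * theta3 (x ^ 4) - theta3 x = T * A\<^sup>2"
    unfolding 3[symmetric] theta3_def by simp
  \<comment> \<open>The combination is chosen so that the three products occur with equal exponents
    and disappear through \<open>P * A * M = 1\<close>.\<close>
  have "P ^ 6 * (2 * w * (T * M\<^sup>2) * (T * A\<^sup>2)) = 2 * w * (T * P\<^sup>2)\<^sup>2 * (P * A * M)\<^sup>2"
    by (simp add: power_mult_distrib power2_eq_square numeral_eq_Suc mult_ac)
  thus ?thesis unfolding 4 5 unfolding 1 2 P_def[symmetric] by simp
qed

subsection \<open>Transformation of theta functions\<close>

lemma jordan_sine: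
  fixes t :: real
  assumes "0 \<le> t" "t \<le> pi / 2"
  shows "2 * t / pi \<le> sin t"
proof -
  have "convex_on {0..pi/2} (\<lambda>x. - sin x)"
  proof (rule f''_ge0_imp_convex)
    show "((\<lambda>x. - sin x) has_real_derivative - cos x) (at x)" for x :: real
      by (auto intro!: derivative_eq_intros)
    show "((\<lambda>x. - cos x) has_real_derivative sin x) (at x)" for x :: real
      by (auto intro!: derivative_eq_intros)
    show "0 \<le> sin x" if "x \<in> {0..pi/2}" for x using that by (auto intro!: sin_ge_zero)
  qed auto
  from convex_onD[OF this, of "2 * t / pi" 0 "pi / 2"] show ?thesis
    using assms by (simp add: field_simps)
qed

text \<open>Jordan's inequality is applied to the half angle in cos u = 1 - 2 sin^2(u/2). This
  supplies the Gaussian majorant for the cosine powers in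
  \<open>theta_transformation_real\<close>.\<close>

lemma cos_le_exp_neg_square:
  fixes u :: real
  assumes "\<bar>u\<bar> \<le> pi / 2"
  shows "cos u \<le> exp (- 2 * u\<^sup>2 / pi\<^sup>2)"
proof -
  have "2 * (\<bar>u\<bar> / 2) / pi \<le> sin (\<bar>u\<bar> / 2)" by (rule jordan_sine) (use assms in auto)
  hence "(2 * (\<bar>u\<bar> / 2) / pi)\<^sup>2 \<le> (sin (\<bar>u\<bar> / 2))\<^sup>2" by (intro power_mono) auto
  hence "u\<^sup>2 / pi\<^sup>2 \<le> (sin (\<bar>u\<bar> / 2))\<^sup>2" by (simp add: power_divide)
  moreover have "cos \<bar>u\<bar> = 1 - 2 * (sin (\<bar>u\<bar> / 2))\<^sup>2" using cos_double_sin[of "\<bar>u\<bar> / 2"] by simp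
  ultimately have "cos u \<le> 1 + (- 2 * u\<^sup>2 / pi\<^sup>2)" by simp
  also have "\<dots> \<le> exp (- 2 * u\<^sup>2 / pi\<^sup>2)" by (rule exp_ge_add_one_self)
  finally show ?thesis .
qed

text \<open>Polya's device: filtering the binomial expansion of \<open>(2 cos \<theta>)\<^sup>2\<^sup>M\<close> by roots of unity gives a
  finite form of the theta transformation.\<close>
lemma sum_cos_power:
  assumes L: "L > 0"
  shows "(\<Sum>r<L. (2 * cos (pi * real r / real L)) ^ (2 * M)) =
     real L * (\<Sum>j | j \<le> 2 * M \<and> int L dvd int j - int M. real ((2 * M) choose j))"
proof -
  define z where "z = (\<lambda>j. cis (2 * pi * real_of_int (int j - int M) / real L))"
  have expand: "complex_of_real ((2 * cos (pi * real r / real L)) ^ (2 * M)) =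
      (\<Sum>j\<le>2 * M. of_nat ((2 * M) choose j) * z j ^ r)" for r
  proof -
    define \<theta> where "\<theta> = pi * real r / real L"
    have "complex_of_real (2 * cos \<theta>) = cis \<theta> + cis (-\<theta>)" by (simp add: complex_eq_iff)
    hence "complex_of_real ((2 * cos \<theta>) ^ (2 * M)) = (cis \<theta> + cis (-\<theta>)) ^ (2 * M)"
      by (simp only: of_real_power)
    also have "\<dots> = (\<Sum>j\<le>2 * M. of_nat ((2 * M) choose j) * cis \<theta> ^ j * cis (-\<theta>) ^ (2 * M - j))"
      by (rule binomial_ring)
    also have "\<dots> = (\<Sum>j\<le>2 * M. of_nat ((2 * M) choose j) * z j ^ r)"
    proof (rule sum.cong)
      fix j assume j: "j \<in> {..2 * M}"
      have "cis \<theta> ^ j * cis (-\<theta>) ^ (2 * M - j) = cis (real j * \<theta> + real (2 * M - j) * (-\<theta>))"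
        by (simp only: Complex.DeMoivre cis_mult)
      also have "real j * \<theta> + real (2 * M - j) * (-\<theta>) = real r * (2 * pi * real_of_int (int j - int M) / real L)"
        using j by (simp add: \<theta>_def of_nat_diff diff_divide_distrib add_divide_distrib algebra_simps)
      also have "cis \<dots> = z j ^ r" by (simp only: z_def Complex.DeMoivre)
      finally show "of_nat ((2 * M) choose j) * cis \<theta> ^ j * cis (-\<theta>) ^ (2 * M - j) = of_nat ((2 * M) choose j) * z j ^ r"
        by (simp only: mult.assoc)
    qed auto
    finally show ?thesis unfolding \<theta>_def .
  qed
  have filter: "(\<Sum>r<L. z j ^ r) = (if int L dvd int j - int M then of_nat L else 0)" for j
  proof (cases "int L dvd int j - int M")
    case True
    then obtain k where k: "int j - int M = int L * k" by (elim dvdE)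
    have "2 * pi * real_of_int (int j - int M) / real L = 2 * pi * real_of_int k" unfolding k using L by simp
    hence "z j = 1" unfolding z_def by (simp only: cis_multiple_2pi Ints_of_int)
    thus ?thesis using True by simp
  next
    case False
    have "z j \<noteq> 1"
    proof
      assume "z j = 1"
      hence "cos (2 * pi * real_of_int (int j - int M) / real L) = 1" by (simp add: z_def complex_eq_iff)
      then obtain k :: int where "2 * pi * real_of_int (int j - int M) / real L = of_int k * 2 * pi"
        by (subst (asm) cos_one_2pi_int) blast
      hence "2 * pi * (real_of_int (int j - int M) / real L) = 2 * pi * of_int k" by (simp only: times_divide_eq_right mult_ac)
      hence "real_of_int (int j - int M) / real L = of_int k" by (simp only: mult_cancel_left) simp
      hence "real_of_int (int j - int M) = real_of_int (int L * k)" using L by (simp add: divide_eq_eq mult.commute)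
      hence "int j - int M = int L * k" by (simp only: of_int_eq_iff)
      thus False using False by simp
    qed
    moreover have "z j ^ L = 1"
    proof -
      have "z j ^ L = cis (2 * pi * real_of_int (int j - int M))" unfolding z_def Complex.DeMoivre using L by simp
      thus ?thesis using cis_multiple_2pi[of "real_of_int (int j - int M)"] by simp
    qed
    ultimately show ?thesis using False by (simp add: geometric_sum)
  qed
  have "complex_of_real (\<Sum>r<L. (2 * cos (pi * real r / real L)) ^ (2 * M)) =
      (\<Sum>r<L. \<Sum>j\<le>2 * M. of_nat ((2 * M) choose j) * z j ^ r)"
    unfolding of_real_sum expand ..
  also have "\<dots> = (\<Sum>j\<le>2 * M. of_nat ((2 * M) choose j) * (\<Sum>r<L. z j ^ r))"
    by (subst sum.swap) (simp add: sum_distrib_left)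
  also have "\<dots> = (\<Sum>j\<le>2 * M. if int L dvd int j - int M then of_nat L * of_nat ((2 * M) choose j) else 0)"
    by (rule sum.cong) (auto simp: filter)
  also have "\<dots> = (\<Sum>j | j \<le> 2 * M \<and> int L dvd int j - int M. of_nat L * of_nat ((2 * M) choose j))"
    by (subst sum.inter_filter[symmetric]) auto
  also have "\<dots> = complex_of_real (real L * (\<Sum>j | j \<le> 2 * M \<and> int L dvd int j - int M. real ((2 * M) choose j)))"
    by (simp add: sum_distrib_left)
  finally show ?thesis by (simp only: of_real_eq_iff)
qed

text \<open>Since \<open>L\<close> is odd, r -> L - r pairs all indices except r = 0, and even
  powers do not see the sign of the cosine. On the right the surviving indices are M plus or minus
  multiples of \<open>L\<close>, paired by the symmetry of the binomial coefficients.\<close>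

lemma polya_finite:
  fixes l L M :: nat
  assumes L: "L = 2 * l + 1"
  shows "1 + 2 * (\<Sum>r<l. cos (pi * real (Suc r) / real L) ^ (2 * M)) =
     real L * real ((2 * M) choose M) / 4 ^ M * (1 + 2 * (\<Sum>k<M. real ((2 * M) choose (M + Suc k * L)) / real ((2 * M) choose M)))"
proof -
  define c where "c = (\<lambda>r. cos (pi * real r / real L) ^ (2 * M))"
  have c_sym: "c (L - r) = c r" if "r \<le> L" for r
  proof -
    have "pi * real (L - r) / real L = pi - pi * real r / real L"
      using that L by (simp add: of_nat_diff field_simps)
    thus ?thesis by (simp add: c_def power_mult)
  qed
  have "(\<Sum>r<L. c r) = c 0 + (\<Sum>r<l. c (Suc r)) + (\<Sum>r<l. c (Suc (l + r)))"
  proof -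
    have "(\<Sum>r<L. c r) = c 0 + (\<Sum>r<l + l. c (Suc r))"
      by (simp only: L mult_2 Suc_eq_plus1[symmetric] sum.lessThan_Suc_shift)
    also have "(\<Sum>r<l + l. c (Suc r)) = (\<Sum>r<l. c (Suc r)) + (\<Sum>r<l. c (Suc (l + r)))"
    proof -
      have "(\<Sum>r<l + m. f r) = (\<Sum>r<l. f r) + (\<Sum>r<m. f (l + r))" for f :: "nat \<Rightarrow> real" and m
        by (induction m) auto
      thus ?thesis .
    qed
    finally show ?thesis by simp
  qed
  also have "(\<Sum>r<l. c (Suc (l + r))) = (\<Sum>r<l. c (Suc r))"
  proof (rule sum.reindex_bij_witness[of _ "\<lambda>r. l - Suc r" "\<lambda>r. l - Suc r"])
    fix r assume r: "r \<in> {..<l}"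
    have "L - Suc (l - Suc r) = Suc (l + r)" using r L by simp
    thus "c (Suc (l - Suc r)) = c (Suc (l + r))" using c_sym[of "Suc (l - Suc r)"] L by simp
  qed auto
  finally have "(\<Sum>r<L. c r) = 1 + 2 * (\<Sum>r<l. c (Suc r))" by (simp add: c_def)
  moreover have "(\<Sum>r<L. (2 * cos (pi * real r / real L)) ^ (2 * M)) = 4 ^ M * (\<Sum>r<L. c r)"
    by (simp add: c_def power_mult_distrib sum_distrib_left power_mult)
  moreover have "(\<Sum>j | j \<le> 2 * M \<and> int L dvd int j - int M. real ((2 * M) choose j)) =
      real ((2 * M) choose M) + 2 * (\<Sum>k<M. real ((2 * M) choose (M + Suc k * L)))"
  proof -
    define K where "K = {k. k < M \<and> Suc k * L \<le> M}"
    have finK: "finite K" by (simp add: K_def)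
    have "{j. j \<le> 2 * M \<and> int L dvd int j - int M} = insert M ((\<lambda>k. M + Suc k * L) ` K \<union> (\<lambda>k. M - Suc k * L) ` K)"
    proof (intro equalityI subsetI)
      fix j assume j: "j \<in> {j. j \<le> 2 * M \<and> int L dvd int j - int M}"
      consider "j = M" | "j > M" | "j < M" by linarith
      thus "j \<in> insert M ((\<lambda>k. M + Suc k * L) ` K \<union> (\<lambda>k. M - Suc k * L) ` K)"
      proof cases
        case 2
        hence "int L dvd int (j - M)" using j by (simp add: of_nat_diff)
        hence "L dvd j - M" by (simp only: int_dvd_int_iff)
        then obtain k' where k': "j - M = L * k'" by (elim dvdE)
        then obtain k where k: "k' = Suc k" using 2 by (cases k') auto
        have "k \<in> K"
        proof -
          have "j - M \<le> M" using j by auto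
          hence "Suc k * L \<le> M" by (simp only: k' k mult.commute)
          moreover have "Suc k * 1 \<le> Suc k * L" using L by (intro mult_le_mono) auto
          ultimately show ?thesis by (simp add: K_def)
        qed
        moreover have "j = M + Suc k * L" using k' k 2 by (simp add: mult.commute)
        ultimately show ?thesis by blast
      next
        case 3
        hence "int (M - j) = - (int j - int M)" by (simp add: of_nat_diff)
        hence "int L dvd int (M - j)" using j by (metis (mono_tags, lifting) dvd_minus_iff mem_Collect_eq)
        hence "L dvd M - j" by (simp only: int_dvd_int_iff)
        then obtain k' where k': "M - j = L * k'" by (elim dvdE)
        then obtain k where k: "k' = Suc k" using 3 by (cases k') auto
        have "k \<in> K"
        proof -
          have "Suc k * L \<le> M" using k' k 3 by (simp add: mult.commute)
          moreover have "Suc k * 1 \<le> Suc k * L" using L by (intro mult_le_mono) auto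
          ultimately show ?thesis by (simp add: K_def)
        qed
        moreover have "j = M - Suc k * L" using k' k 3 by (simp add: mult.commute)
        ultimately show ?thesis by blast
      qed auto
    next
      fix j assume "j \<in> insert M ((\<lambda>k. M + Suc k * L) ` K \<union> (\<lambda>k. M - Suc k * L) ` K)"
      then consider "j = M" | k where "k \<in> K" "j = M + Suc k * L" | k where "k \<in> K" "j = M - Suc k * L" by blast
      thus "j \<in> {j. j \<le> 2 * M \<and> int L dvd int j - int M}"
      proof cases
        case 2
        have "int j - int M = int L * int (Suc k)" by (simp add: 2 algebra_simps)
        thus ?thesis using 2 by (auto simp: K_def)
      next
        case 3
        have "Suc k * L \<le> M" using 3 by (simp add: K_def)
        hence "int j = int M - int (Suc k * L)" by (simp only: 3 of_nat_diff)
        hence "int j - int M = int L * (- int (Suc k))" by (simp add: algebra_simps)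
        thus ?thesis using 3 by (auto simp: K_def)
      qed auto
    qed
    moreover have "inj_on (\<lambda>k. M + Suc k * L) K"
    proof (rule inj_onI)
      fix i k assume "M + Suc i * L = M + Suc k * L"
      hence "Suc i * L = Suc k * L" by (simp only: add_left_cancel)
      thus "i = k" using L by (simp only: mult_cancel2) simp
    qed
    moreover have "inj_on (\<lambda>k. M - Suc k * L) K"
    proof (rule inj_onI)
      fix i k assume "i \<in> K" "k \<in> K" "M - Suc i * L = M - Suc k * L"
      hence "Suc i * L = Suc k * L" by (metis (mono_tags, lifting) K_def diff_diff_cancel mem_Collect_eq)
      thus "i = k" using L by (simp only: mult_cancel2) simp
    qed
    moreover have "(\<lambda>k. M + Suc k * L) ` K \<inter> (\<lambda>k. M - Suc k * L) ` K = {}" using L by auto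
    moreover have "M \<notin> (\<lambda>k. M + Suc k * L) ` K \<union> (\<lambda>k. M - Suc k * L) ` K"
      using L by (auto simp: K_def)
    ultimately have "(\<Sum>j | j \<le> 2 * M \<and> int L dvd int j - int M. real ((2 * M) choose j)) =
       real ((2 * M) choose M) + ((\<Sum>k\<in>K. real ((2 * M) choose (M + Suc k * L))) + (\<Sum>k\<in>K. real ((2 * M) choose (M - Suc k * L))))"
      using finK by (simp add: sum.union_disjoint sum.reindex)
    also have "(\<Sum>k\<in>K. real ((2 * M) choose (M - Suc k * L))) = (\<Sum>k\<in>K. real ((2 * M) choose (M + Suc k * L)))"
    proof (rule sum.cong)
      fix k assume "k \<in> K"
      hence k: "Suc k * L \<le> M" by (simp add: K_def)
      hence "2 * M - (M - Suc k * L) = M + Suc k * L" by linarith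
      thus "real ((2 * M) choose (M - Suc k * L)) = real ((2 * M) choose (M + Suc k * L))"
        using binomial_symmetric[of "M - Suc k * L" "2 * M"] k by simp
    qed auto
    \<comment> \<open>The range may be enlarged to all k < M, because binomial coefficients beyond
      the row are 0.\<close>
    also have "(\<Sum>k\<in>K. real ((2 * M) choose (M + Suc k * L))) = (\<Sum>k<M. real ((2 * M) choose (M + Suc k * L)))"
      by (rule sum.mono_neutral_left) (auto simp: K_def intro!: binomial_eq_0)
    finally show ?thesis by simp
  qed
  ultimately have "4 ^ M * (1 + 2 * (\<Sum>r<l. c (Suc r))) = real L * (real ((2 * M) choose M) + 2 * (\<Sum>k<M. real ((2 * M) choose (M + Suc k * L))))"
    using sum_cos_power[of L M] L by simp
  hence "1 + 2 * (\<Sum>r<l. c (Suc r)) = real L / 4 ^ M * (real ((2 * M) choose M) + 2 * (\<Sum>k<M. real ((2 * M) choose (M + Suc k * L))))"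
    by (simp add: field_simps)
  also have "real ((2 * M) choose M) + 2 * (\<Sum>k<M. real ((2 * M) choose (M + Suc k * L))) =
      real ((2 * M) choose M) * (1 + 2 * (\<Sum>k<M. real ((2 * M) choose (M + Suc k * L)) / real ((2 * M) choose M)))"
  proof -
    have "real ((2 * M) choose M) \<noteq> 0" by simp
    thus ?thesis by (simp add: distrib_left sum_divide_distrib[symmetric])
  qed
  finally show ?thesis by (simp add: c_def mult.assoc)
qed

lemma tendsto_suminf_dominated:
  fixes a :: "nat \<Rightarrow> nat \<Rightarrow> real"
  assumes "\<And>k. (\<lambda>l. a k l) \<longlonglongrightarrow> b k" "\<And>k l. norm (a k l) \<le> M k" "summable M"
  shows "(\<lambda>l. \<Sum>k. a k l) \<longlonglongrightarrow> (\<Sum>k. b k)"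
proof -
  have "eventually (\<lambda>(k, l). norm (a k l) \<le> M k) (at_top \<times>\<^sub>F sequentially)"
    using assms(2) by (intro always_eventually) auto
  from tannerys_theorem[OF assms(1) this assms(3)] show ?thesis by simp
qed

text \<open>Wallis' partial products are exactly the reciprocals of these expressions.\<close>

lemma central_binomial_limit:
  "(\<lambda>n. (real ((2 * n) choose n) / 4 ^ n)\<^sup>2 * (2 * real n + 1)) \<longlonglongrightarrow> 2 / pi"
proof -
  have step: "real ((2 * Suc n) choose Suc n) * (real n + 1) = real ((2 * n) choose n) * (4 * real n + 2)" for n
  proof -
    have "((2 * Suc n) choose Suc n) * (Suc n * Suc n) = (2 * n choose n) * ((4 * n + 2) * Suc n)"
    proof -
      have 1: "fact n * fact n * (2 * n choose n) = (fact (2 * n) :: nat)"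
        using binomial_fact_lemma[of n "2 * n"] by simp
      have 2: "fact (Suc n) * fact (Suc n) * (2 * Suc n choose Suc n) = (fact (2 * Suc n) :: nat)"
        using binomial_fact_lemma[of "Suc n" "2 * Suc n"] by simp
      have "(fact n * fact n) * (((2 * Suc n) choose Suc n) * (Suc n * Suc n)) = fact (2 * Suc n)"
        unfolding 2[symmetric] by (simp only: fact_Suc of_nat_id mult_ac)
      also have "\<dots> = (2 * n + 2) * ((2 * n + 1) * fact (2 * n))" by simp
      also have "\<dots> = (fact n * fact n) * ((2 * n choose n) * ((4 * n + 2) * Suc n))"
        unfolding 1[symmetric] by (simp add: algebra_simps)
      finally show ?thesis by simp
    qed
    hence "((2 * Suc n) choose Suc n) * Suc n * Suc n = (2 * n choose n) * (4 * n + 2) * Suc n"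
      by (simp only: mult.assoc)
    hence "((2 * Suc n) choose Suc n) * Suc n = (2 * n choose n) * (4 * n + 2)" by (simp only: mult_cancel2) simp
    hence "real (((2 * Suc n) choose Suc n) * Suc n) = real ((2 * n choose n) * (4 * n + 2))" by (simp only:)
    thus ?thesis by (simp add: algebra_simps)
  qed
  have "(\<Prod>k=1..n. (4 * real k ^ 2) / (4 * real k ^ 2 - 1)) = 1 / ((real ((2 * n) choose n) / 4 ^ n)\<^sup>2 * (2 * real n + 1))" for n
  proof (induction n)
    case (Suc n)
    define c where "c = real ((2 * n) choose n) / 4 ^ n"
    have c: "c \<noteq> 0" by (simp add: c_def)
    have cS: "real ((2 * Suc n) choose Suc n) / 4 ^ Suc n = c * (2 * real n + 1) / (2 * (real n + 1))"
    proof -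
      have gen: "b1 / (4 * p) = b0 / p * (2 * m + 1) / (2 * (m + 1))"
        if "b1 * (m + 1) = b0 * (4 * m + 2)" "m \<ge> 0" "p > 0" for b1 b0 m p :: real
      proof -
        have "b1 = b0 * (4 * m + 2) / (m + 1)" using that by (simp add: field_simps)
        moreover have "b0 * (4 * m + 2) / (m + 1) / (4 * p) = b0 / p * (2 * m + 1) / (2 * (m + 1))"
          using that by (simp add: divide_simps) (simp add: algebra_simps)
        ultimately show ?thesis by simp
      qed
      show ?thesis unfolding c_def power_Suc by (rule gen[OF step]) auto
    qed
    have "(\<Prod>k=1..Suc n. (4 * real k ^ 2) / (4 * real k ^ 2 - 1)) =
        1 / (c\<^sup>2 * (2 * real n + 1)) * ((4 * real (Suc n) ^ 2) / (4 * real (Suc n) ^ 2 - 1))"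
      using Suc by (simp add: c_def)
    also have "4 * real (Suc n) ^ 2 - 1 = (2 * real n + 1) * (2 * real n + 3)" by (simp add: power2_eq_square algebra_simps)
    also have "1 / (c\<^sup>2 * (2 * real n + 1)) * ((4 * real (Suc n) ^ 2) / ((2 * real n + 1) * (2 * real n + 3))) =
       1 / ((c * (2 * real n + 1) / (2 * (real n + 1)))\<^sup>2 * (2 * real (Suc n) + 1))"
      using c by (simp add: power2_eq_square field_simps)
    finally show ?case unfolding cS .
  qed simp
  hence "(\<lambda>n. 1 / ((real ((2 * n) choose n) / 4 ^ n)\<^sup>2 * (2 * real n + 1))) \<longlonglongrightarrow> pi / 2"
    using wallis by simp
  from tendsto_inverse[OF this] show ?thesis by (simp add: inverse_eq_divide)
qed

lemma binomial_ratio: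
  assumes "j \<le> M"
  shows "real ((2 * M) choose (M + j)) / real ((2 * M) choose M) = (\<Prod>i<j. (real M - real i) / (real M + real i + 1))"
  using assms
proof (induction j)
  case (Suc j)
  have "((2 * M) choose (M + Suc j)) * (M + j + 1) = ((2 * M) choose (M + j)) * (M - j)"
  proof -
    have "Suc (M + j) * ((2 * M) choose Suc (M + j)) = (2 * M - (M + j)) * ((2 * M) choose (M + j))"
      by (simp only: binomial_absorption binomial_absorb_comp)
    moreover have "2 * M - (M + j) = M - j" by simp
    ultimately show ?thesis by (simp add: mult.commute)
  qed
  hence "real (((2 * M) choose (M + Suc j)) * (M + j + 1)) = real (((2 * M) choose (M + j)) * (M - j))" by (simp only:)
  hence "real ((2 * M) choose (M + Suc j)) = real ((2 * M) choose (M + j)) * ((real M - real j) / (real M + real j + 1))"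
    using Suc.prems by (simp add: of_nat_diff field_simps)
  thus ?case using Suc by (simp add: field_simps)
qed simp

lemma sum_odd_real: "(\<Sum>i<j. 2 * real i + 1) = (real j)\<^sup>2"
  by (induction j) (auto simp: power2_eq_square algebra_simps)

text \<open>Each factor of \<open>binomial_ratio\<close> is 1 - (2i+1)/(M+i+1). Using the largest
  denominator M + j and the sum j^2 of the first odd numbers gives a Gaussian;
  \<open>binomial_ratio_ge\<close> treats the reciprocal factors with the smallest denominator M -
  j. Both exponents have the same limit when j is of order sqrt M.\<close>

lemma binomial_ratio_le:
  assumes "j \<le> M" "j > 0"
  shows "real ((2 * M) choose (M + j)) / real ((2 * M) choose M) \<le> exp (- ((real j)\<^sup>2 / (real M + real j)))"
proof -
  have "(\<Prod>i<j. (real M - real i) / (real M + real i + 1)) \<le> (\<Prod>i<j. exp (- ((2 * real i + 1) / (real M + real j))))"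
  proof (rule prod_mono, safe)
    fix i assume i: "i < j"
    show "0 \<le> (real M - real i) / (real M + real i + 1)" using i assms by simp
    have "(real M - real i) / (real M + real i + 1) = 1 + - ((2 * real i + 1) / (real M + real i + 1))"
      by (simp add: field_simps)
    also have "\<dots> \<le> exp (- ((2 * real i + 1) / (real M + real i + 1)))" by (rule exp_ge_add_one_self)
    also have "\<dots> \<le> exp (- ((2 * real i + 1) / (real M + real j)))"
      using i by (auto intro!: divide_left_mono mult_pos_pos)
    finally show "(real M - real i) / (real M + real i + 1) \<le> exp (- ((2 * real i + 1) / (real M + real j)))" .
  qed
  also have "\<dots> = exp (- ((real j)\<^sup>2 / (real M + real j)))"
    by (simp add: exp_sum[symmetric] sum_negf sum_divide_distrib[symmetric] sum_odd_real)
  finally show ?thesis using binomial_ratio[OF assms(1)] by simp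
qed

lemma binomial_ratio_ge:
  assumes "j < M"
  shows "exp (- ((real j)\<^sup>2 / (real M - real j))) \<le> real ((2 * M) choose (M + j)) / real ((2 * M) choose M)"
proof -
  have "(\<Prod>i<j. exp (- ((2 * real i + 1) / (real M - real j)))) \<le> (\<Prod>i<j. (real M - real i) / (real M + real i + 1))"
  proof (rule prod_mono, safe)
    fix i assume i: "i < j"
    have "(real M + real i + 1) / (real M - real i) = 1 + (2 * real i + 1) / (real M - real i)"
      using i assms by (simp add: field_simps)
    also have "\<dots> \<le> exp ((2 * real i + 1) / (real M - real i))" by (rule exp_ge_add_one_self)
    also have "\<dots> \<le> exp ((2 * real i + 1) / (real M - real j))"
      using i assms by (auto intro!: divide_left_mono mult_pos_pos)
    finally have "(real M + real i + 1) / (real M - real i) \<le> exp ((2 * real i + 1) / (real M - real j))" .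
    thus "exp (- ((2 * real i + 1) / (real M - real j))) \<le> (real M - real i) / (real M + real i + 1)"
      using i assms by (simp add: exp_minus field_simps)
  qed auto
  moreover have "(\<Prod>i<j. exp (- ((2 * real i + 1) / (real M - real j)))) = exp (- ((real j)\<^sup>2 / (real M - real j)))"
    by (simp add: exp_sum[symmetric] sum_negf sum_divide_distrib[symmetric] sum_odd_real)
  ultimately show ?thesis using binomial_ratio[of j M] assms by simp
qed

text \<open>Take \<open>polya_finite\<close> with L = 2 l + 1 and M about t L^2, and let l grow. The
  cosine powers tend to the Gaussians on the left, the binomial ratios at multiples of L to those on
  the right, and the central binomial coefficient to the square root factor. Tannery's theorem
  justifies the termwise limits.\<close>

theorem theta_transformation_real:
  fixes t :: real
  assumes t: "t > 0"
  shows "1 + 2 * (\<Sum>n. exp (- pi\<^sup>2 * t * (real (Suc n))\<^sup>2)) = 1 / sqrt (pi * t) * (1 + 2 * (\<Sum>n. exp (- (real (Suc n))\<^sup>2 / t)))"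
proof -
  define L where "L = (\<lambda>l::nat. 2 * l + 1)"
  define M where "M = (\<lambda>l. nat \<lceil>t * (real (L l))\<^sup>2\<rceil>)"
  have L1: "real (L l) \<ge> 1" for l by (simp add: L_def)
  have M1: "t * (real (L l))\<^sup>2 \<le> real (M l)" for l unfolding M_def by linarith
  have M2: "real (M l) \<le> t * (real (L l))\<^sup>2 + 1" for l
  proof -
    have "t * (real (L l))\<^sup>2 \<ge> 0" using t by simp
    thus ?thesis unfolding M_def by linarith
  qed
  have M3: "real (M l) \<le> (t + 1) * (real (L l))\<^sup>2" for l
    using M2[of l] power_mono[OF L1[of l], of 2] by (simp add: algebra_simps)
  have Linf: "filterlim (\<lambda>l. real (L l)) at_top sequentially" unfolding L_def by real_asymp
  have Mlim: "(\<lambda>l. real (M l) / (real (L l))\<^sup>2) \<longlonglongrightarrow> t"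
  proof (rule tendsto_sandwich)
    show "\<forall>\<^sub>F l in sequentially. t \<le> real (M l) / (real (L l))\<^sup>2"
      using M1 L1 by (intro always_eventually allI) (simp add: L_def field_simps)
    show "\<forall>\<^sub>F l in sequentially. real (M l) / (real (L l))\<^sup>2 \<le> t + 1 / (real (L l))\<^sup>2"
    proof (intro always_eventually allI)
      fix l
      have "real (M l) / (real (L l))\<^sup>2 \<le> (t * (real (L l))\<^sup>2 + 1) / (real (L l))\<^sup>2"
        by (intro divide_right_mono M2) auto
      also have "\<dots> = t + 1 / (real (L l))\<^sup>2" by (simp add: L_def field_simps)
      finally show "real (M l) / (real (L l))\<^sup>2 \<le> t + 1 / (real (L l))\<^sup>2" .
    qed
    show "(\<lambda>l. t + 1 / (real (L l))\<^sup>2) \<longlonglongrightarrow> t" unfolding L_def by real_asymp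
  qed auto
  define a where "a = (\<lambda>r l. if r < l then cos (pi * real (Suc r) / real (L l)) ^ (2 * M l) else 0)"
  have lim1: "(\<lambda>l. \<Sum>r. a r l) \<longlonglongrightarrow> (\<Sum>r. exp (- pi\<^sup>2 * t * (real (Suc r))\<^sup>2))"
  proof -
    have "(\<lambda>l. a r l) \<longlonglongrightarrow> exp (- pi\<^sup>2 * t * (real (Suc r))\<^sup>2)" for r
    proof (rule Lim_transform_eventually)
      define s where "s = real (Suc r)"
      have s: "s > 0" by (simp add: s_def)
      have "(\<lambda>l. (2 * real l + 1)\<^sup>2 * ln (cos (pi * s / (2 * real l + 1)))) \<longlonglongrightarrow> - (pi * (pi * (s * s)) / 2)"
        using s by real_asymp
      hence "(\<lambda>l. exp (2 * (real (M l) / (real (L l))\<^sup>2) * ((real (L l))\<^sup>2 * ln (cos (pi * s / real (L l)))))) \<longlonglongrightarrow> exp (2 * t * (- (pi\<^sup>2 * s\<^sup>2) / 2))"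
        by (intro tendsto_intros Mlim) (simp add: L_def add.commute power2_eq_square mult_ac)
      thus "(\<lambda>l. exp (2 * (real (M l) / (real (L l))\<^sup>2) * ((real (L l))\<^sup>2 * ln (cos (pi * s / real (L l)))))) \<longlonglongrightarrow> exp (- pi\<^sup>2 * t * (real (Suc r))\<^sup>2)"
        by (simp add: s_def mult_ac)
      show "\<forall>\<^sub>F l in sequentially. exp (2 * (real (M l) / (real (L l))\<^sup>2) * ((real (L l))\<^sup>2 * ln (cos (pi * s / real (L l))))) = a r l"
        using eventually_gt_at_top[of r]
      proof eventually_elim
        case (elim l)
        \<comment> \<open>Once \<open>l\<close> exceeds \<open>r\<close>, the angle is below pi/2,
          so the cosine is positive and equals the exponential of its logarithm.\<close>
        have "2 * s < real (L l)" using elim by (simp add: s_def L_def)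
        hence "pi * s / real (L l) < pi / 2" using L1[of l] by (simp add: field_simps)
        moreover have "pi * s / real (L l) \<ge> 0" using s by simp
        ultimately have c: "cos (pi * s / real (L l)) > 0" by (intro cos_gt_zero_pi) (auto intro: less_le_trans[of _ 0])
        have "2 * (real (M l) / (real (L l))\<^sup>2) * ((real (L l))\<^sup>2 * ln (cos (pi * s / real (L l)))) = real (2 * M l) * ln (cos (pi * s / real (L l)))"
          using L1[of l] by simp
        also have "exp \<dots> = cos (pi * s / real (L l)) ^ (2 * M l)"
          using c by (simp only: exp_of_nat_mult exp_ln)
        finally show ?case using elim by (simp add: a_def s_def)
      qed
    qed
    moreover have "norm (a r l) \<le> exp (- 2 * t) ^ r" for r l
    proof (cases "r < l")
      case True
      define u where "u = pi * real (Suc r) / real (L l)"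
      have "2 * real (Suc r) \<le> real (L l)" using True by (simp add: L_def)
      hence "pi * (2 * real (Suc r)) \<le> pi * real (L l)" by (intro mult_left_mono) auto
      hence u: "\<bar>u\<bar> \<le> pi / 2" using L1[of l] by (simp add: u_def abs_mult field_simps)
      have c0: "cos u \<ge> 0" using u by (intro cos_ge_zero) auto
      have "cos u ^ (2 * M l) \<le> exp (- 2 * u\<^sup>2 / pi\<^sup>2) ^ (2 * M l)"
        by (intro power_mono cos_le_exp_neg_square u c0)
      also have "\<dots> = exp (- (4 * real (M l) * (real (Suc r))\<^sup>2 / (real (L l))\<^sup>2))"
        by (simp add: u_def power_divide power_mult_distrib flip: exp_of_nat_mult)
      also have "\<dots> \<le> exp (- (2 * t * real r))"
      proof -
        have "2 * t * real r \<le> 4 * t * (real (Suc r))\<^sup>2"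
          using t by (intro mult_mono) (auto simp: power2_eq_square algebra_simps)
        also have "4 * t * (real (Suc r))\<^sup>2 = 4 * (t * (real (L l))\<^sup>2) * (real (Suc r))\<^sup>2 / (real (L l))\<^sup>2"
          using L1[of l] by simp
        also have "\<dots> \<le> 4 * real (M l) * (real (Suc r))\<^sup>2 / (real (L l))\<^sup>2"
          by (intro divide_right_mono mult_right_mono mult_left_mono M1) auto
        finally show ?thesis by simp
      qed
      also have "\<dots> = exp (- 2 * t) ^ r" by (simp add: mult_ac flip: exp_of_nat_mult)
      finally show ?thesis using True c0 by (simp add: a_def u_def)
    qed (simp add: a_def)
    moreover have "summable (\<lambda>r. exp (- 2 * t) ^ r)" using t by (intro summable_geometric) auto
    ultimately show ?thesis
      by (rule tendsto_suminf_dominated)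
  qed
  define h where "h = (\<lambda>k l. real ((2 * M l) choose (M l + Suc k * L l)) / real ((2 * M l) choose (M l)))"
  have lim2: "(\<lambda>l. \<Sum>k. h k l) \<longlonglongrightarrow> (\<Sum>k. exp (- (real (Suc k))\<^sup>2 / t))"
  proof -
    have lim: "(\<lambda>l. h k l) \<longlonglongrightarrow> exp (- (real (Suc k))\<^sup>2 / t)" for k
    proof (rule tendsto_sandwich)
      define s where "s = real (Suc k)"
      have Sinf: "(\<lambda>l. s / real (L l)) \<longlonglongrightarrow> 0" unfolding L_def by real_asymp
      have "(\<lambda>l. exp (- (s\<^sup>2 / (real (M l) / (real (L l))\<^sup>2 - s / real (L l))))) \<longlonglongrightarrow> exp (- (s\<^sup>2 / (t - 0)))"
        by (intro tendsto_intros Mlim Sinf) (use t in auto)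
      thus "(\<lambda>l. exp (- (s\<^sup>2 / (real (M l) / (real (L l))\<^sup>2 - s / real (L l))))) \<longlonglongrightarrow> exp (- (real (Suc k))\<^sup>2 / t)"
        by (simp add: s_def)
      have "(\<lambda>l. exp (- (s\<^sup>2 / (real (M l) / (real (L l))\<^sup>2 + s / real (L l))))) \<longlonglongrightarrow> exp (- (s\<^sup>2 / (t + 0)))"
        by (intro tendsto_intros Mlim Sinf) (use t in auto)
      thus "(\<lambda>l. exp (- (s\<^sup>2 / (real (M l) / (real (L l))\<^sup>2 + s / real (L l))))) \<longlonglongrightarrow> exp (- (real (Suc k))\<^sup>2 / t)"
        by (simp add: s_def)
      have ev: "\<forall>\<^sub>F l in sequentially. Suc k * L l < M l"
      proof -
        have "\<forall>\<^sub>F l in sequentially. s / t < real (L l)"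
          using Linf by (simp add: filterlim_at_top_dense)
        thus ?thesis
        proof eventually_elim
          case (elim l)
          have "s * real (L l) < t * real (L l) * real (L l)"
            using elim t L1[of l] by (intro mult_strict_right_mono) (auto simp: field_simps)
          also have "\<dots> \<le> real (M l)" using M1[of l] by (simp add: power2_eq_square mult_ac)
          finally have "real (Suc k * L l) < real (M l)" by (simp add: s_def algebra_simps)
          thus ?case by (simp only: of_nat_less_iff)
        qed
      qed
      \<comment> \<open>One identity serves both sides of the sandwich, with
        \<open>\<sigma> = 1\<close> for the upper and \<open>\<sigma> = -1\<close> for the lower
        bound.\<close>
      have e: "(real (Suc k * L l))\<^sup>2 / (real (M l) + \<sigma> * real (Suc k * L l)) = s\<^sup>2 / (real (M l) / (real (L l))\<^sup>2 + \<sigma> * (s / real (L l)))" for \<sigma> l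
      proof -
        have "real (M l) / (real (L l))\<^sup>2 + \<sigma> * (s / real (L l)) = (real (M l) + \<sigma> * (s * real (L l))) / (real (L l))\<^sup>2"
          using L1[of l] by (simp add: power2_eq_square field_simps)
        thus ?thesis unfolding of_nat_mult s_def[symmetric] by (simp add: power_mult_distrib)
      qed
      show "\<forall>\<^sub>F l in sequentially. h k l \<le> exp (- (s\<^sup>2 / (real (M l) / (real (L l))\<^sup>2 + s / real (L l))))"
        using ev
      proof eventually_elim
        case (elim l)
        show ?case using binomial_ratio_le[of "Suc k * L l" "M l"] e[of l 1] elim
          unfolding h_def by (simp add: L_def)
      qed
      show "\<forall>\<^sub>F l in sequentially. exp (- (s\<^sup>2 / (real (M l) / (real (L l))\<^sup>2 - s / real (L l)))) \<le> h k l"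
        using ev
      proof eventually_elim
        case (elim l)
        have "(real (Suc k * L l))\<^sup>2 / (real (M l) - real (Suc k * L l)) = s\<^sup>2 / (real (M l) / (real (L l))\<^sup>2 - s / real (L l))"
          using e[of l "-1"] by (simp only: mult_minus1 diff_conv_add_uminus)
        with binomial_ratio_ge[OF elim] show ?case unfolding h_def by (simp only:)
      qed
    qed
    \<comment> \<open>The majorant must not depend on \<open>l\<close>: nonzero terms have (k+1) L
      <= M, so the denominator is at most 2 M, and M <= (t + 1) L^2 removes the remaining
      dependence.\<close>
    have bound: "norm (h k l) \<le> exp (- 1 / (2 * (t + 1))) ^ k" for k l
    proof (cases "Suc k * L l \<le> M l")
      case False
      hence "h k l = 0" by (simp add: h_def binomial_eq_0 del: mult_Suc)
      thus ?thesis by simp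
    next
      case True
      have pos: "real (M l) > 0" using True L1[of l] by (cases "M l") (auto simp: L_def)
      have "h k l \<le> exp (- ((real (Suc k * L l))\<^sup>2 / (real (M l) + real (Suc k * L l))))"
        unfolding h_def using L1[of l] by (intro binomial_ratio_le True) (simp add: L_def)
      also have "\<dots> \<le> exp (- (real k / (2 * (t + 1))))"
      proof -
        have "real k / (2 * (t + 1)) \<le> (real (Suc k))\<^sup>2 / (2 * (t + 1))"
          using t by (intro divide_right_mono) (auto simp: power2_eq_square algebra_simps)
        also have "\<dots> = (real (Suc k * L l))\<^sup>2 / (2 * ((t + 1) * (real (L l))\<^sup>2))"
        proof -
          have *: "a / (2 * b) = (a * c) / (2 * (b * c))" if "c \<noteq> 0" for a b c :: real using that by simp
          show ?thesis unfolding of_nat_mult power_mult_distrib by (rule *) (use L1[of l] in simp)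
        qed
        also have "\<dots> \<le> (real (Suc k * L l))\<^sup>2 / (2 * real (M l))"
          using M3[of l] pos t L1[of l] by (intro divide_left_mono mult_left_mono mult_pos_pos) auto
        also have "\<dots> \<le> (real (Suc k * L l))\<^sup>2 / (real (M l) + real (Suc k * L l))"
        proof (intro divide_left_mono mult_pos_pos)
          have "real (Suc k * L l) \<le> real (M l)" using True by (simp only: of_nat_le_iff)
          thus "real (M l) + real (Suc k * L l) \<le> 2 * real (M l)" by simp
        qed (use pos in \<open>auto intro: add_pos_nonneg\<close>)
        finally show ?thesis by simp
      qed
      also have "\<dots> = exp (- 1 / (2 * (t + 1))) ^ k" by (simp flip: exp_of_nat_mult)
      finally show ?thesis by (simp add: h_def)
    qed
    have "summable (\<lambda>k. exp (- 1 / (2 * (t + 1))) ^ k)" using t by (intro summable_geometric) auto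
    with lim bound show ?thesis by (rule tendsto_suminf_dominated)
  qed
  have lim3: "(\<lambda>l. real (L l) * real ((2 * M l) choose (M l)) / 4 ^ M l) \<longlonglongrightarrow> 1 / sqrt (pi * t)"
  proof -
    have "filterlim (\<lambda>l. t * (real (L l))\<^sup>2) at_top sequentially" unfolding L_def using t by real_asymp
    hence "filterlim (\<lambda>l. real (M l)) at_top sequentially"
      by (rule filterlim_at_top_mono) (use M1 in auto)
    hence "\<forall>\<^sub>F l in sequentially. real Z \<le> real (M l)" for Z unfolding filterlim_at_top by blast
    hence Minf: "filterlim M at_top sequentially" by (simp add: filterlim_at_top)
    define c where "c = (\<lambda>n. real ((2 * n) choose n) / 4 ^ n)"
    have "(\<lambda>l. (c (M l))\<^sup>2 * (2 * real (M l) + 1)) \<longlonglongrightarrow> 2 / pi"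
      unfolding c_def by (rule filterlim_compose[OF central_binomial_limit Minf])
    moreover have "(\<lambda>l. 2 * (real (M l) / (real (L l))\<^sup>2) + 1 / (real (L l))\<^sup>2) \<longlonglongrightarrow> 2 * t + 0"
      by (intro tendsto_intros Mlim) (unfold L_def, real_asymp)
    ultimately have "(\<lambda>l. sqrt (((c (M l))\<^sup>2 * (2 * real (M l) + 1)) / (2 * (real (M l) / (real (L l))\<^sup>2) + 1 / (real (L l))\<^sup>2))) \<longlonglongrightarrow> sqrt ((2 / pi) / (2 * t + 0))"
      using t by (intro tendsto_real_sqrt tendsto_divide) auto
    \<comment> \<open>The factor 2 M + 1 cancels, so Wallis' limit 2/pi divided by 2 t is the limit
      of (L c)^2.\<close>
    moreover have "sqrt (((c (M l))\<^sup>2 * (2 * real (M l) + 1)) / (2 * (real (M l) / (real (L l))\<^sup>2) + 1 / (real (L l))\<^sup>2)) = real (L l) * c (M l)" for l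
    proof -
      have "2 * (real (M l) / (real (L l))\<^sup>2) + 1 / (real (L l))\<^sup>2 = (2 * real (M l) + 1) / (real (L l))\<^sup>2"
        by (simp add: add_divide_distrib)
      hence "((c (M l))\<^sup>2 * (2 * real (M l) + 1)) / (2 * (real (M l) / (real (L l))\<^sup>2) + 1 / (real (L l))\<^sup>2) = (real (L l) * c (M l))\<^sup>2"
        by (simp add: power_mult_distrib add_nonneg_eq_0_iff)
      thus ?thesis by (simp add: c_def)
    qed
    ultimately show ?thesis using t by (simp add: c_def real_sqrt_divide)
  qed
  have fin1: "(\<Sum>r. a r l) = (\<Sum>r<l. cos (pi * real (Suc r) / real (L l)) ^ (2 * M l))" for l
    by (subst suminf_finite[of "{..<l}"]) (auto simp: a_def)
  have fin2: "(\<Sum>k. h k l) = (\<Sum>k<M l. h k l)" for l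
  proof (rule suminf_finite)
    fix k assume "k \<notin> {..<M l}"
    hence "M l < Suc k * 1" by simp
    also have "Suc k * 1 \<le> Suc k * L l" by (intro mult_le_mono) (auto simp: L_def)
    finally show "h k l = 0" by (simp add: h_def binomial_eq_0 del: mult_Suc)
  qed auto
  have eq: "1 + 2 * (\<Sum>r. a r l) = real (L l) * real ((2 * M l) choose (M l)) / 4 ^ M l * (1 + 2 * (\<Sum>k. h k l))" for l
    unfolding fin1 fin2 unfolding h_def by (rule polya_finite) (simp add: L_def)
  show ?thesis
  proof (rule LIMSEQ_unique)
    show "(\<lambda>l. 1 + 2 * (\<Sum>r. a r l)) \<longlonglongrightarrow> 1 + 2 * (\<Sum>n. exp (- pi\<^sup>2 * t * (real (Suc n))\<^sup>2))"
      by (intro tendsto_intros lim1)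
    show "(\<lambda>l. 1 + 2 * (\<Sum>r. a r l)) \<longlonglongrightarrow> 1 / sqrt (pi * t) * (1 + 2 * (\<Sum>n. exp (- (real (Suc n))\<^sup>2 / t)))"
      unfolding eq by (intro tendsto_intros lim2 lim3)
  qed
qed

section \<open>Inversion of the theta and Weber products on the real axis\<close>

definition theta_exp :: "real \<Rightarrow> real" where
  "theta_exp s = 1 + 2 * (\<Sum>n. exp (- s * (real (Suc n))\<^sup>2))"

lemma theta_exp_inversion:
  assumes s: "s > 0"
  shows "theta_exp s = sqrt (pi / s) * theta_exp (pi\<^sup>2 / s)"
proof -
  have "pi\<^sup>2 * (s / pi\<^sup>2) = s" "1 / (s / pi\<^sup>2) = pi\<^sup>2 / s" by simp_all
  moreover have "pi * (s / pi\<^sup>2) = s / pi" by (simp add: power2_eq_square)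
  ultimately have "theta_exp s = 1 / sqrt (s / pi) * theta_exp (pi\<^sup>2 / s)"
    using theta_transformation_real[of "s / pi\<^sup>2"] s unfolding theta_exp_def by (simp add: mult.commute)
  also have "1 / sqrt (s / pi) = sqrt (pi / s)" using s by (simp add: real_sqrt_divide)
  finally show ?thesis .
qed

lemma theta3_exp:
  assumes s: "s > 0"
  shows "theta3 (of_real (exp (- s))) = of_real (theta_exp s)" and "theta_exp s \<ge> 1"
proof -
  have "norm (complex_of_real (exp (- s))) < 1" using s by simp
  note sums = thetaplus_sums[OF this]
  have e: "of_real (exp (- s)) ^ ((Suc n)\<^sup>2) = complex_of_real (exp (- s * (real (Suc n))\<^sup>2))" for n
  proof -
    have "exp (- s) ^ ((Suc n)\<^sup>2) = exp (real ((Suc n)\<^sup>2) * (- s))" by (rule exp_of_nat_mult[symmetric])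
    also have "\<dots> = exp (- s * (real (Suc n))\<^sup>2)" by (simp add: mult.commute)
    finally show ?thesis by (simp only: of_real_power[symmetric])
  qed
  have S: "(\<lambda>n. complex_of_real (exp (- s * (real (Suc n))\<^sup>2))) sums thetaplus (of_real (exp (- s)))"
    using sums unfolding e .
  from sums_Re[OF S] have R: "(\<lambda>n. exp (- s * (real (Suc n))\<^sup>2)) sums Re (thetaplus (of_real (exp (- s))))"
    by simp
  hence "(\<lambda>n. complex_of_real (exp (- s * (real (Suc n))\<^sup>2))) sums complex_of_real (\<Sum>n. exp (- s * (real (Suc n))\<^sup>2))"
    by (intro sums_of_real) (simp add: sums_iff)
  from sums_unique2[OF S this] show "theta3 (of_real (exp (- s))) = of_real (theta_exp s)"
    unfolding theta3_def theta_exp_def by simp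
  have "0 \<le> (\<Sum>n. exp (- s * (real (Suc n))\<^sup>2))" using R by (intro suminf_nonneg) (auto simp: sums_iff)
  thus "theta_exp s \<ge> 1" unfolding theta_exp_def by simp
qed

lemma qprod_of_real:
  assumes a: "0 \<le> a" and p: "0 \<le> p" "p < 1"
  obtains P where "qprod (of_real a) (of_real p) = of_real P" "P \<ge> 1"
proof -
  define f where "f = (\<lambda>n. \<Prod>k<n. 1 + a * p ^ k)"
  have f: "qpoch (of_real a) (of_real p) n = of_real (f n)" for n by (simp add: qpoch_def f_def)
  have f1: "f n \<ge> 1" for n unfolding f_def using a p by (intro prod_ge_1) auto
  have lim: "(\<lambda>n. complex_of_real (f n)) \<longlonglongrightarrow> qprod (of_real a) (of_real p)"
    using qpoch_tendsto[of "of_real p" "of_real a"] p unfolding f by simp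
  have "(\<lambda>n. Im (complex_of_real (f n))) \<longlonglongrightarrow> Im (qprod (of_real a) (of_real p))" using lim by (rule tendsto_Im)
  hence "Im (qprod (of_real a) (of_real p)) = 0" by (simp add: LIMSEQ_const_iff)
  moreover have "1 \<le> Re (qprod (of_real a) (of_real p))"
    using tendsto_Re[OF lim] by (rule LIMSEQ_le_const) (use f1 in auto)
  ultimately show ?thesis by (intro that[of "Re (qprod (of_real a) (of_real p))"]) (auto simp: complex_eq_iff)
qed

text \<open>In \<open>weber_sixth_power\<close> theta_3 occurs only at the parameters s/4, s and 4
  s. Under s -> pi^2/s the outer two are exchanged, so the two factors \<open>A\<close> and
  \<open>B\<close> swap roles and the identities for \<open>s\<close> and \<open>s'\<close> differ
  only by an exponential. The sixth root is unambiguous because the products are real and at least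
  1, which is why real parameters are treated before complex ones.\<close>

lemma weber_inversion_real:
  assumes s: "s > 0"
  shows "qprod (of_real (exp (- s))) ((of_real (exp (- s)))\<^sup>2) =
     of_real (exp ((pi\<^sup>2 / s - s) / 24)) * qprod (of_real (exp (- (pi\<^sup>2 / s)))) ((of_real (exp (- (pi\<^sup>2 / s))))\<^sup>2)"
proof -
  have ex: "\<exists>P. qprod (of_real (exp (- s))) ((of_real (exp (- s)))\<^sup>2) = of_real P \<and> P \<ge> 1" if "s > 0" for s
  proof -
    have "(exp (- s))\<^sup>2 < 1" using that by (simp add: power_less_one_iff)
    then obtain P where "qprod (of_real (exp (- s))) (of_real ((exp (- s))\<^sup>2)) = of_real P" "P \<ge> 1"
      using qprod_of_real[of "exp (- s)" "(exp (- s))\<^sup>2"] by auto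
    thus ?thesis by (intro exI[of _ P]) simp
  qed
  have weber: "P ^ 6 * ((theta_exp (s / 4) - theta_exp s) * (2 * theta_exp (4 * s) - theta_exp s)) = 2 * exp (- (s / 4)) * (theta_exp s)\<^sup>2"
    if s: "s > 0" and P: "qprod (of_real (exp (- s))) ((of_real (exp (- s)))\<^sup>2) = of_real P" for s P
  proof -
    have w: "complex_of_real (exp (- (s / 4))) ^ 4 = of_real (exp (- s))"
      by (simp flip: of_real_power exp_of_nat_mult)
    have x: "complex_of_real (exp (- s)) ^ 4 = of_real (exp (- (4 * s)))"
      by (simp flip: of_real_power exp_of_nat_mult)
    have "norm (complex_of_real (exp (- (s / 4)))) < 1" "complex_of_real (exp (- (s / 4))) \<noteq> 0" using s by auto
    from weber_sixth_power[OF this] have "complex_of_real (P ^ 6 * ((theta_exp (s / 4) - theta_exp s) * (2 * theta_exp (4 * s) - theta_exp s))) = of_real (2 * exp (- (s / 4)) * (theta_exp s)\<^sup>2)"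
      unfolding w x P using theta3_exp(1)[of "s / 4"] theta3_exp(1)[of s] theta3_exp(1)[of "4 * s"] s by simp
    thus ?thesis by (simp only: of_real_eq_iff)
  qed
  define s' where "s' = pi\<^sup>2 / s"
  have s': "s' > 0" using s by (simp add: s'_def)
  obtain P where P: "qprod (of_real (exp (- s))) ((of_real (exp (- s)))\<^sup>2) = of_real P" "P \<ge> 1" using ex[OF s] by blast
  obtain P' where P': "qprod (of_real (exp (- s'))) ((of_real (exp (- s')))\<^sup>2) = of_real P'" "P' \<ge> 1" using ex[OF s'] by blast
  define r where "r = sqrt (pi / s)"
  have r: "r > 0" using s by (simp add: r_def)
  have 1: "theta_exp s = r * theta_exp s'" using theta_exp_inversion[OF s] by (simp add: r_def s'_def)
  have 2: "theta_exp (s / 4) = 2 * r * theta_exp (4 * s')"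
    using theta_exp_inversion[of "s / 4"] s by (simp add: r_def s'_def real_sqrt_mult real_sqrt_divide mult.commute)
  have 3: "2 * theta_exp (4 * s) = r * theta_exp (s' / 4)"
    using theta_exp_inversion[of "4 * s"] s by (simp add: r_def s'_def real_sqrt_mult real_sqrt_divide mult.commute)
  define A B where "A = theta_exp (s' / 4) - theta_exp s'" and "B = 2 * theta_exp (4 * s') - theta_exp s'"
  have W': "P' ^ 6 * (A * B) = 2 * exp (- (s' / 4)) * (theta_exp s')\<^sup>2" unfolding A_def B_def by (rule weber[OF s' P'(1)])
  have T: "theta_exp s' \<noteq> 0" using theta3_exp(2)[OF s'] by auto
  \<comment> \<open>The right-hand side of \<open>W'\<close> is nonzero, so the common factor
    \<open>A * B\<close> may be cancelled.\<close>
  have AB: "A * B \<noteq> 0" using W' T by auto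
  have "P ^ 6 * ((r * B) * (r * A)) = 2 * exp (- (s / 4)) * (r * theta_exp s')\<^sup>2"
    using weber[OF s P(1)] unfolding 1 2 3 A_def B_def by (simp add: algebra_simps)
  hence "r\<^sup>2 * (P ^ 6 * (A * B)) = r\<^sup>2 * (2 * exp (- (s / 4)) * (theta_exp s')\<^sup>2)"
    by (simp add: power2_eq_square mult_ac)
  hence "P ^ 6 * (A * B) = 2 * exp (- (s / 4)) * (theta_exp s')\<^sup>2" using r by simp
  also have "2 * exp (- (s / 4)) * (theta_exp s')\<^sup>2 = exp (s' / 4 - s / 4) * (2 * exp (- (s' / 4)) * (theta_exp s')\<^sup>2)"
  proof -
    have "exp (- (s / 4)) = exp (s' / 4 - s / 4) * exp (- (s' / 4))" by (simp add: exp_add[symmetric])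
    thus ?thesis by (simp only: mult_ac)
  qed
  also have "\<dots> = (exp (s' / 4 - s / 4) * P' ^ 6) * (A * B)" unfolding W'[symmetric] by simp
  finally have "P ^ 6 = exp (s' / 4 - s / 4) * P' ^ 6" using AB by simp
  \<comment> \<open>The denominator 24 is the 4 from the fourth root \<open>w\<close> in
    \<open>weber_sixth_power\<close> times the degree 6 of the root.\<close>
  also have "exp (s' / 4 - s / 4) = exp ((s' - s) / 24) ^ 6" by (simp flip: exp_of_nat_mult)
  finally have "P ^ 6 = (exp ((s' - s) / 24) * P') ^ 6" by (simp add: power_mult_distrib)
  hence "P = exp ((s' - s) / 24) * P'"
    using P(2) P'(2) by (subst (asm) power_eq_iff_eq_base) auto
  thus ?thesis using P(1) P'(1) unfolding s'_def by simp
qed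

lemma theta_weber_inversion_real:
  assumes s: "s > 0"
  shows "theta_weber (of_real (exp (- s))) =
    of_real (exp (- s / 24) * sqrt (pi / s) * exp (pi\<^sup>2 / (24 * s))) * theta_weber (of_real (exp (- (pi\<^sup>2 / s))))"
proof -
  have s': "pi\<^sup>2 / s > 0" using s by simp
  have e: "exp ((pi\<^sup>2 / s - s) / 24) = exp (- s / 24) * exp (pi\<^sup>2 / (24 * s))"
    using s by (simp add: exp_add[symmetric] field_simps)
  have "theta3 (of_real (exp (- s))) = of_real (sqrt (pi / s)) * theta3 (of_real (exp (- (pi\<^sup>2 / s))))"
    using theta3_exp(1)[OF s] theta3_exp(1)[OF s'] theta_exp_inversion[OF s] by simp
  thus ?thesis unfolding theta_weber_def theta3_def[symmetric] weber_inversion_real[OF s] e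
    by (simp only: of_real_mult mult_ac)
qed

section \<open>Holomorphy and analytic continuation\<close>

lemma norm_compact_less:
  assumes "norm (z::complex) < 1"
  obtains d \<rho> where "d > 0" "cball z d \<subseteq> ball 0 1" "\<rho> \<ge> 0" "\<rho> < 1" "\<And>x. x \<in> cball z d \<Longrightarrow> norm x \<le> \<rho>"
proof -
  define d where "d = (1 - norm z) / 2"
  have le: "norm x \<le> norm z + d" if "x \<in> cball z d" for x
    using that norm_triangle_ineq2[of x z] by (simp add: dist_norm norm_minus_commute)
  moreover have "norm z + d < 1" using assms by (simp add: d_def field_simps)
  moreover have "d > 0" using assms by (simp add: d_def)
  ultimately show ?thesis by (intro that[of d "norm z + d"]) (auto simp: add_nonneg_pos less_imp_le dest!: le)
qed

lemma holomorphic_thetaplus: "thetaplus holomorphic_on ball 0 1"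
proof (rule holomorphic_uniform_sequence[of _ "\<lambda>n x. \<Sum>k<n. x ^ ((Suc k)\<^sup>2)"])
  fix z :: complex assume "z \<in> ball 0 1"
  hence z: "norm z < 1" by simp
  obtain d \<rho> where d: "d > 0" "cball z d \<subseteq> ball 0 1" "\<rho> \<ge> 0" "\<rho> < 1" "\<And>x. x \<in> cball z d \<Longrightarrow> norm x \<le> \<rho>"
    using norm_compact_less[OF z] by blast
  have "uniform_limit (cball z d) (\<lambda>n x. \<Sum>k<n. x ^ ((Suc k)\<^sup>2)) (\<lambda>x. \<Sum>k. x ^ ((Suc k)\<^sup>2)) sequentially"
  proof (rule Weierstrass_m_test)
    show "summable (\<lambda>k. \<rho> ^ k)" using d by (intro summable_geometric) auto
    fix k x assume x: "x \<in> cball z d"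
    have "norm (x ^ ((Suc k)\<^sup>2)) \<le> \<rho> ^ ((Suc k)\<^sup>2)" unfolding norm_power by (intro power_mono d x) auto
    also have "\<dots> \<le> \<rho> ^ k" using d by (intro power_decreasing) (auto simp: power2_eq_square)
    finally show "norm (x ^ ((Suc k)\<^sup>2)) \<le> \<rho> ^ k" .
  qed
  thus "\<exists>d>0. cball z d \<subseteq> ball 0 1 \<and> uniform_limit (cball z d) (\<lambda>n x. \<Sum>k<n. x ^ ((Suc k)\<^sup>2)) thetaplus sequentially"
    using d unfolding thetaplus_def by blast
qed (auto intro!: holomorphic_intros)

lemma holomorphic_weber: "(\<lambda>x. qprod x (x\<^sup>2)) holomorphic_on ball 0 1"
proof (rule holomorphic_uniform_sequence[of _ "\<lambda>n x. \<Prod>k<n. 1 + x * (x\<^sup>2) ^ k"])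
  fix z :: complex assume "z \<in> ball 0 1"
  hence z: "norm z < 1" by simp
  obtain d \<rho> where d: "d > 0" "cball z d \<subseteq> ball 0 1" "\<rho> \<ge> 0" "\<rho> < 1" "\<And>x. x \<in> cball z d \<Longrightarrow> norm x \<le> \<rho>"
    using norm_compact_less[OF z] by blast
  have "uniformly_convergent_on (cball z d) (\<lambda>n x. \<Prod>k<n. 1 + x * (x\<^sup>2) ^ k)"
  proof (rule uniformly_convergent_on_prod)
    show "uniformly_convergent_on (cball z d) (\<lambda>N x. \<Sum>k<N. norm (x * (x\<^sup>2) ^ k))"
    proof (rule Weierstrass_m_test')
      show "summable (\<lambda>k. \<rho> ^ k)" using d by (intro summable_geometric) auto
      fix k x assume x: "x \<in> cball z d"
      have "norm (x * (x\<^sup>2) ^ k) = norm x ^ (Suc (2 * k))" by (simp add: norm_mult norm_power power_mult)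
      also have "\<dots> \<le> \<rho> ^ Suc (2 * k)" by (intro power_mono d x) auto
      also have "\<dots> \<le> \<rho> ^ k" using d by (intro power_decreasing) auto
      finally show "norm (norm (x * (x\<^sup>2) ^ k)) \<le> \<rho> ^ k" by simp
    qed
  qed (auto intro!: continuous_intros)
  hence lim: "uniform_limit (cball z d) (\<lambda>n x. \<Prod>k<n. 1 + x * (x\<^sup>2) ^ k) (\<lambda>x. lim (\<lambda>n. \<Prod>k<n. 1 + x * (x\<^sup>2) ^ k)) sequentially"
    by (simp add: uniformly_convergent_uniform_limit_iff)
  have "lim (\<lambda>n. \<Prod>k<n. 1 + x * (x\<^sup>2) ^ k) = qprod x (x\<^sup>2)" if "x \<in> cball z d" for x
  proof (rule limI)
    have "norm x < 1" using that d by auto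
    thus "(\<lambda>n. \<Prod>k<n. 1 + x * (x\<^sup>2) ^ k) \<longlonglongrightarrow> qprod x (x\<^sup>2)"
      using qpoch_tendsto[OF norm_square_less_1, of x x] unfolding qpoch_def by simp
  qed
  hence "uniform_limit (cball z d) (\<lambda>n x. \<Prod>k<n. 1 + x * (x\<^sup>2) ^ k) (\<lambda>x. qprod x (x\<^sup>2)) sequentially"
    using lim by (subst (asm) uniform_limit_cong'[OF refl]) auto
  thus "\<exists>d>0. cball z d \<subseteq> ball 0 1 \<and> uniform_limit (cball z d) (\<lambda>n x. \<Prod>k<n. 1 + x * (x\<^sup>2) ^ k) (\<lambda>x. qprod x (x\<^sup>2)) sequentially"
    using d by blast
qed (auto intro!: holomorphic_intros)

lemma holomorphic_theta_weber: "theta_weber holomorphic_on ball 0 1"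
  unfolding theta_weber_def[abs_def]
  by (intro holomorphic_intros holomorphic_thetaplus holomorphic_weber)

text \<open>The right half-plane avoids the branch cut of \<open>csqrt\<close> and is mapped into
  itself by z -> pi^2/z. Both sides are therefore holomorphic there, and they agree on the positive
  reals, which accumulate at 1.\<close>

theorem theta_weber_inversion:
  assumes z: "Re z > 0"
  shows "theta_weber (exp (- z)) =
    exp (- z / 24) * (of_real (sqrt pi) / csqrt z) * exp (of_real (pi\<^sup>2) / (24 * z)) * theta_weber (exp (- (of_real (pi\<^sup>2) / z)))"
proof -
  define S where "S = {z::complex. Re z > 0}"
  have nonpos: "z \<notin> \<real>\<^sub>\<le>\<^sub>0" "z \<noteq> 0" if "z \<in> S" for z using that by (auto simp: S_def complex_nonpos_Reals_iff)
  define f where "f = (\<lambda>z::complex. theta_weber (exp (- z)) -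
     exp (- z / 24) * (of_real (sqrt pi) / csqrt z) * exp (of_real (pi\<^sup>2) / (24 * z)) * theta_weber (exp (- (of_real (pi\<^sup>2) / z))))"
  have hol_comp: "(\<lambda>z. theta_weber (g z)) holomorphic_on S" if "g holomorphic_on S" "g ` S \<subseteq> ball 0 1" for g :: "complex \<Rightarrow> complex"
    using holomorphic_on_compose_gen[OF that(1) holomorphic_theta_weber that(2)] by (simp add: o_def)
  have Re_inv: "Re (of_real (pi\<^sup>2) / z) > 0" if "z \<in> S" for z
  proof -
    have "Re (of_real (pi\<^sup>2) / z) = pi\<^sup>2 * Re z / (norm z)\<^sup>2" by (simp add: Re_divide cmod_power2)
    thus ?thesis using that nonpos(2)[OF that] by (simp add: S_def)
  qed
  have "f z = 0"
  proof (rule analytic_continuation[of f S "of_real ` {0<..}" 1])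
    show "f holomorphic_on S" unfolding f_def
      by (intro holomorphic_intros hol_comp) (use nonpos Re_inv in \<open>auto simp: S_def\<close>)
    show "open S" unfolding S_def by (rule open_halfspace_Re_gt)
    show "connected S" unfolding S_def by (intro convex_connected convex_halfspace_Re_gt)
    show "1 islimpt complex_of_real ` {0<..}"
      unfolding islimpt_approachable
    proof safe
      fix e :: real assume e: "e > 0"
      show "\<exists>x'\<in>complex_of_real ` {0<..}. x' \<noteq> 1 \<and> dist x' 1 < e"
      proof (rule bexI[of _ "of_real (1 + e / 2)"])
        have "dist (complex_of_real (1 + e / 2)) 1 = e / 2"
          using e by (simp add: dist_norm)
        thus "complex_of_real (1 + e / 2) \<noteq> 1 \<and> dist (complex_of_real (1 + e / 2)) 1 < e" using e by auto
        show "complex_of_real (1 + e / 2) \<in> complex_of_real ` {0<..}" using e by (intro imageI) auto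
      qed
    qed
    fix w assume "w \<in> complex_of_real ` {0<..}"
    then obtain s where s: "w = of_real s" "s > 0" by auto
    have "csqrt (of_real s) = of_real (sqrt s)" using s by (simp add: csqrt_of_real_nonneg)
    thus "f w = 0"
      using theta_weber_inversion_real[OF s(2)] s(2)
      by (simp add: f_def s(1) real_sqrt_divide flip: exp_of_real)
  qed (use z in \<open>auto simp: S_def\<close>)
  thus ?thesis by (simp add: f_def)
qed

text \<open>The lower bound has to give pi^2/54 > 0.18262, for the comparison at the end of
  \<open>rogers_ramanujan_sum_le\<close>.\<close>

lemma pi_sq_bounds: "9.869 < pi\<^sup>2" "pi\<^sup>2 < 9.87"
proof -
  have "3.1415 \<le> pi" "pi \<le> 3.1416" using pi_approx by simp_all
  hence "3.1415\<^sup>2 \<le> pi\<^sup>2" "pi\<^sup>2 \<le> 3.1416\<^sup>2" by (intro power_mono; simp)+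
  thus "9.869 < pi\<^sup>2" "pi\<^sup>2 < 9.87" by (simp_all add: power2_eq_square)
qed

subsection \<open>The Weber product away from the positive real axis\<close>

text \<open>The first-order term is the signed real part rather than the norm. Summed over a whole
  product, it preserves the cancellation that makes the product small away from x = 1.\<close>

lemma norm_one_plus_le: "norm (1 + w :: complex) \<le> exp (Re w + (norm w)\<^sup>2 / 2)"
proof -
  have "(norm (1 + w))\<^sup>2 = 1 + (2 * Re w + (norm w)\<^sup>2)"
    unfolding cmod_power2 by (simp add: power2_eq_square algebra_simps)
  also have "\<dots> \<le> exp (2 * Re w + (norm w)\<^sup>2)" by (rule exp_ge_add_one_self)
  also have "\<dots> = (exp (Re w + (norm w)\<^sup>2 / 2))\<^sup>2" by (simp add: power2_eq_square flip: exp_add)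
  finally show ?thesis by (rule power2_le_imp_le) simp
qed

text \<open>The first-order terms sum to Re (x / (1 - x^2)), which is small off the real axis; the
  second-order terms depend on |x| only and contribute about 1 / (8 y).\<close>

lemma norm_weber_le:
  assumes x: "norm x < 1"
  shows "norm (qprod x (x\<^sup>2)) \<le> exp (Re (x / (1 - x\<^sup>2)) + (norm x)\<^sup>2 / (1 - (norm x) ^ 4) / 2)"
proof -
  define w where "w = (\<lambda>k. x * (x\<^sup>2) ^ k)"
  have X: "norm (x\<^sup>2) < 1" using norm_square_less_1[OF x] .
  have "norm ((x\<^sup>2)\<^sup>2) < 1" using norm_square_less_1[OF X] .
  hence R4: "(norm x) ^ 4 < 1" by (simp add: norm_power flip: power_mult)
  have "w sums (x * (1 / (1 - x\<^sup>2)))" unfolding w_def by (intro sums_mult geometric_sums X)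
  hence "(\<lambda>k. Re (w k)) sums Re (x / (1 - x\<^sup>2))" using sums_Re by fastforce
  moreover have "(\<lambda>k. (norm (w k))\<^sup>2 / 2) sums ((norm x)\<^sup>2 * (1 / (1 - (norm x) ^ 4)) / 2)"
  proof -
    have "(\<lambda>k. (norm (w k))\<^sup>2 / 2) = (\<lambda>k. (norm x)\<^sup>2 * ((norm x) ^ 4) ^ k / 2)"
      by (rule ext) (simp add: w_def norm_mult norm_power power_mult_distrib mult.commute flip: power_mult)
    thus ?thesis using R4 by (simp only:) (intro sums_divide sums_mult geometric_sums, simp)
  qed
  ultimately have S: "(\<lambda>k. Re (w k) + (norm (w k))\<^sup>2 / 2) sums (Re (x / (1 - x\<^sup>2)) + (norm x)\<^sup>2 / (1 - (norm x) ^ 4) / 2)"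
    using sums_add by fastforce
  show ?thesis
  proof (rule LIMSEQ_le)
    show "(\<lambda>n. norm (qpoch x (x\<^sup>2) n)) \<longlonglongrightarrow> norm (qprod x (x\<^sup>2))"
      by (intro tendsto_norm qpoch_tendsto X)
    show "(\<lambda>n. exp (\<Sum>k<n. Re (w k) + (norm (w k))\<^sup>2 / 2)) \<longlonglongrightarrow> exp (Re (x / (1 - x\<^sup>2)) + (norm x)\<^sup>2 / (1 - (norm x) ^ 4) / 2)"
      using S unfolding sums_def by (rule tendsto_exp)
    have "norm (qpoch x (x\<^sup>2) n) \<le> exp (\<Sum>k<n. Re (w k) + (norm (w k))\<^sup>2 / 2)" for n
    proof -
      have "qpoch x (x\<^sup>2) n = (\<Prod>k<n. 1 + w k)" by (simp add: qpoch_def w_def)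
      thus ?thesis by (simp only: exp_sum[OF finite_lessThan] prod_norm[symmetric])
         (intro prod_mono conjI norm_one_plus_le norm_ge_zero)
    qed
    thus "\<exists>N. \<forall>n\<ge>N. norm (qpoch x (x\<^sup>2) n) \<le> exp (\<Sum>k<n. Re (w k) + (norm (w k))\<^sup>2 / 2)" by blast
  qed
qed

lemma norm_thetaplus_le:
  assumes x: "norm x < 1"
  shows "norm (thetaplus x) \<le> norm x / (1 - norm x)"
proof -
  have g: "(\<lambda>n. norm x * norm x ^ n) sums (norm x * (1 / (1 - norm x)))"
    using x by (intro sums_mult geometric_sums) auto
  have le: "norm (x ^ ((Suc n)\<^sup>2)) \<le> norm x * norm x ^ n" for n
  proof -
    have "norm x ^ ((Suc n)\<^sup>2) \<le> norm x ^ Suc n" using x by (intro power_decreasing) (auto simp: power2_eq_square)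
    thus ?thesis by (simp add: norm_power)
  qed
  have "norm (thetaplus x) \<le> (\<Sum>n. norm x * norm x ^ n)"
    unfolding thetaplus_def by (rule norm_suminf_le[OF le]) (use g in \<open>simp add: sums_iff\<close>)
  also have "\<dots> = norm x * (1 / (1 - norm x))" using g by (simp add: sums_iff)
  finally show ?thesis by simp
qed

text \<open>Comparison with a geometric series loses a power of 1/y only, which the polynomial
  factor in the error term absorbs.\<close>

lemma norm_theta3_le:
  assumes x: "norm x < 1"
  shows "norm (theta3 x) \<le> 2 / (1 - norm x)"
proof -
  have "norm (theta3 x) \<le> 1 + 2 * norm (thetaplus x)"
    unfolding theta3_def using norm_triangle_ineq[of 1 "2 * thetaplus x"] by (simp add: norm_mult)
  also have "\<dots> \<le> 1 + 2 * (norm x / (1 - norm x))" using norm_thetaplus_le[OF x] by simp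
  also have "\<dots> = (1 + norm x) / (1 - norm x)" using x by (simp add: field_simps)
  also have "\<dots> \<le> 2 / (1 - norm x)" using x by (intro divide_right_mono) auto
  finally show ?thesis .
qed

lemma exp_neg_le_quadratic:
  fixes a :: real
  assumes "0 \<le> a"
  shows "exp (- a) \<le> 1 - a + a\<^sup>2 / 2"
proof -
  have "1 + a + a\<^sup>2 / 2 \<le> exp a" using exp_lower_Taylor_quadratic[OF assms] .
  moreover have p: "0 < 1 + a + a\<^sup>2 / 2" using assms by (simp add: add_pos_nonneg)
  ultimately have "exp (- a) \<le> 1 / (1 + a + a\<^sup>2 / 2)"
    by (simp add: exp_minus inverse_eq_divide frac_le)
  also have "\<dots> \<le> 1 - a + a\<^sup>2 / 2"
  proof -
    have "(1 + a + a\<^sup>2 / 2) * (1 - a + a\<^sup>2 / 2) = 1 + (a\<^sup>2 / 2)\<^sup>2" by (simp add: power2_eq_square algebra_simps)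
    hence "1 \<le> (1 - a + a\<^sup>2 / 2) * (1 + a + a\<^sup>2 / 2)" by (simp add: mult.commute)
    thus ?thesis using p by (subst pos_divide_le_eq) auto
  qed
  finally show ?thesis .
qed

lemma exp_minus_exp_ge:
  fixes a :: real
  assumes "0 \<le> a"
  shows "2 * a \<le> exp a - exp (- a)"
  using exp_neg_le_quadratic[OF assms] exp_lower_Taylor_quadratic[OF assms] by simp

lemma one_minus_exp_ge:
  fixes y :: real
  assumes "0 \<le> y" "y \<le> 1"
  shows "y / 2 \<le> 1 - exp (- y)"
proof -
  have "y\<^sup>2 \<le> y" using assms by (simp add: power2_eq_square mult_left_le)
  thus ?thesis using exp_neg_le_quadratic[OF assms(1)] by simp
qed

lemma theta_weber_far:
  fixes y t :: real
  assumes y: "0 < y" "y \<le> 0.44" and t: "6 * y \<le> \<bar>t\<bar>" "\<bar>t\<bar> \<le> pi"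
  shows "norm (theta_weber (exp (- Complex y t))) \<le> 4 / y * exp (pi\<^sup>2 / (54 * y))"
proof -
  define x where "x = exp (- Complex y t)"
  have nx: "norm x = exp (- y)" by (simp add: x_def)
  have x: "norm x < 1" using y by (simp add: nx)
  have n2: "(norm x)\<^sup>2 / (1 - (norm x) ^ 4) \<le> 1 / (4 * y)"
  proof -
    have "(norm x)\<^sup>2 = exp (- (2 * y))" "(norm x) ^ 4 = exp (- (4 * y))" by (simp_all add: nx flip: exp_of_nat_mult)
    hence "(norm x)\<^sup>2 / (1 - (norm x) ^ 4) = exp (- (2 * y)) / (exp (- (2 * y)) * (exp (2 * y) - exp (- (2 * y))))"
      by (simp add: right_diff_distrib flip: exp_add)
    also have "\<dots> = 1 / (exp (2 * y) - exp (- (2 * y)))" by simp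
    also have "\<dots> \<le> 1 / (4 * y)"
      using exp_minus_exp_ge[of "2 * y"] y by (intro divide_left_mono mult_pos_pos) auto
    finally show ?thesis .
  qed
  have re: "Re (x / (1 - x\<^sup>2)) \<le> 0.043 / y"
  proof -
    define W where "W = exp (Complex y t) - exp (- Complex y t)"
    have "x \<noteq> 0" by (simp add: x_def)
    have "1 - x\<^sup>2 = x * W"
      by (simp add: x_def W_def right_diff_distrib power2_eq_square flip: exp_add)
    hence "x / (1 - x\<^sup>2) = 1 / W" using \<open>x \<noteq> 0\<close> by simp
    hence e: "Re (x / (1 - x\<^sup>2)) = Re W / (norm W)\<^sup>2" by (simp add: Re_divide cmod_power2)
    have ReW: "Re W = (exp y - exp (- y)) * cos t" by (simp add: W_def Re_exp algebra_simps)
    have ImW: "Im W = (exp y + exp (- y)) * sin t" by (simp add: W_def Im_exp algebra_simps)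
    have d: "0 \<le> exp y - exp (- y)" using y by simp
    show ?thesis
    \<comment> \<open>The first-order term has the sign of cos t, so only angles up to pi/2 need an
      estimate.\<close>
    proof (cases "cos t \<le> 0")
      case True
      have "Re W \<le> 0" unfolding ReW using d True by (rule mult_nonneg_nonpos)
      hence "Re W / (norm W)\<^sup>2 \<le> 0" by (simp add: divide_nonpos_nonneg)
      moreover have "0 \<le> 0.043 / y" using y by simp
      ultimately show ?thesis using e by linarith
    next
      case False
      have tp: "\<bar>t\<bar> \<le> pi / 2"
      proof (rule ccontr)
        assume "\<not> \<bar>t\<bar> \<le> pi / 2"
        hence "cos \<bar>t\<bar> \<le> 0" using t cos_monotone_0_pi_le[of "pi / 2" "\<bar>t\<bar>"] by simp
        thus False using False by simp
      qed
      have "2 * (6 * y) / pi \<le> 2 * \<bar>t\<bar> / pi" using t by (simp add: divide_right_mono)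
      also have "\<dots> \<le> sin \<bar>t\<bar>" by (rule jordan_sine) (use tp in auto)
      finally have s: "12 * y / pi \<le> sin \<bar>t\<bar>" by simp
      have "(12 * y / pi)\<^sup>2 \<le> (sin \<bar>t\<bar>)\<^sup>2" using y by (intro power_mono s) auto
      also have "(sin \<bar>t\<bar>)\<^sup>2 = (sin t)\<^sup>2" by (simp add: abs_if)
      finally have s2: "144 * y\<^sup>2 / pi\<^sup>2 \<le> (sin t)\<^sup>2" by (simp add: power_divide power_mult_distrib)
      have "2 \<le> exp y + exp (- y)"
        using exp_ge_add_one_self[of y] exp_ge_add_one_self[of "-y"] by linarith
      hence "2\<^sup>2 \<le> (exp y + exp (- y))\<^sup>2" by (intro power_mono) auto
      hence "4 * (sin t)\<^sup>2 \<le> (exp y + exp (- y))\<^sup>2 * (sin t)\<^sup>2" by (intro mult_right_mono) auto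
      also have "\<dots> \<le> (norm W)\<^sup>2" unfolding cmod_power2 ImW by (simp add: power_mult_distrib)
      finally have W4: "4 * (144 * y\<^sup>2 / pi\<^sup>2) \<le> (norm W)\<^sup>2" using s2 by linarith
      have "exp y \<le> 1 + y + y\<^sup>2" using y by (intro exp_bound) auto
      moreover have "1 - y \<le> exp (- y)" using exp_ge_add_one_self[of "-y"] by simp
      moreover have "y\<^sup>2 \<le> 0.44 * y" using y by (simp add: power2_eq_square)
      ultimately have "exp y - exp (- y) \<le> 2.44 * y" by simp
      moreover have "(exp y - exp (- y)) * cos t \<le> (exp y - exp (- y)) * 1" using d by (intro mult_left_mono) auto
      ultimately have "Re W \<le> 2.44 * y" unfolding ReW by simp
      hence "Re W / (norm W)\<^sup>2 \<le> (2.44 * y) / (norm W)\<^sup>2" by (intro divide_right_mono) auto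
      also have "\<dots> \<le> (2.44 * y) / (4 * (144 * y\<^sup>2 / pi\<^sup>2))"
      proof (rule divide_left_mono[OF W4])
        have "0 < 4 * (144 * y\<^sup>2 / pi\<^sup>2)" using y by simp
        thus "0 < (norm W)\<^sup>2 * (4 * (144 * y\<^sup>2 / pi\<^sup>2))" using W4 by (intro mult_pos_pos) linarith+
      qed (use y in auto)
      also have "\<dots> = (2.44 * pi\<^sup>2 / 576) / y" using y by (simp add: power2_eq_square)
      also have "\<dots> \<le> 0.043 / y" using y pi_sq_bounds(2) by (intro divide_right_mono) auto
      finally show ?thesis using e by simp
    qed
  qed
  have "norm (theta_weber x) = norm (theta3 x) * norm (qprod x (x\<^sup>2))"
    by (simp add: theta_weber_def theta3_def norm_mult)
  also have "\<dots> \<le> 2 / (1 - norm x) * exp (Re (x / (1 - x\<^sup>2)) + (norm x)\<^sup>2 / (1 - (norm x) ^ 4) / 2)"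
    by (intro mult_mono norm_theta3_le norm_weber_le x) (use x in auto)
  also have "\<dots> \<le> 4 / y * exp (pi\<^sup>2 / (54 * y))"
  proof (intro mult_mono)
    show "2 / (1 - norm x) \<le> 4 / y"
      using one_minus_exp_ge[of y] y unfolding nx by (simp add: field_simps)
    \<comment> \<open>First- and second-order parts add up to 0.168 = 0.043 + 1/8, to be compared
      with pi^2/54 > 0.1827.\<close>
    have "0.043 / y + 1 / (4 * y) / 2 = 0.168 / y" by (simp add: field_simps)
    also have "\<dots> \<le> pi\<^sup>2 / 54 / y" using pi_sq_bounds(1) y by (intro divide_right_mono) auto
    finally have "0.043 / y + 1 / (4 * y) / 2 \<le> pi\<^sup>2 / (54 * y)" by simp
    moreover have "Re (x / (1 - x\<^sup>2)) + (norm x)\<^sup>2 / (1 - (norm x) ^ 4) / 2 \<le> 0.043 / y + 1 / (4 * y) / 2"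
      by (intro add_mono divide_right_mono n2 re) simp
    ultimately show "exp (Re (x / (1 - x\<^sup>2)) + (norm x)\<^sup>2 / (1 - (norm x) ^ 4) / 2) \<le> exp (pi\<^sup>2 / (54 * y))"
      unfolding exp_le_cancel_iff by (rule order_trans[rotated])
  qed (use y in auto)
  finally show ?thesis unfolding x_def .
qed

subsection \<open>The Weber product near the positive real axis\<close>

text \<open>For |x| <= 3/5 the product is at most 3, as its exponent is at most 15/16, and the theta
  sum is at most (5/2) |x|. The constant 20 rounds up 2 * (5/2) * 3 + 3 * 25/16. Linearity in |x| is
  essential for the cancellation in \<open>theta_weber_near\<close>.\<close>

lemma norm_theta_weber_minus_1:
  assumes x: "norm x \<le> 3 / 5"
  shows "norm (theta_weber x - 1) \<le> 20 * norm x"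
proof -
  have x1: "norm x < 1" using x by simp
  have X: "norm (x\<^sup>2) < 1" using norm_square_less_1[OF x1] .
  have x2: "(norm x)\<^sup>2 \<le> (3 / 5)\<^sup>2" using x by (intro power_mono) auto
  have s: "norm x / (1 - norm (x\<^sup>2)) \<le> 25 / 16 * norm x"
  proof -
    have "norm x / (1 - norm (x\<^sup>2)) \<le> norm x / (16 / 25)"
      using x2 by (intro divide_left_mono) (auto simp: norm_power power_divide)
    thus ?thesis by simp
  qed
  define e where "e = exp (norm x / (1 - norm (x\<^sup>2)))"
  have e3: "e \<le> 3"
  proof -
    have "norm x / (1 - norm (x\<^sup>2)) \<le> 1" using s x by linarith
    hence "e \<le> exp 1" unfolding e_def by simp
    thus ?thesis using exp_le by simp
  qed
  have P: "norm (qprod x (x\<^sup>2)) \<le> 3" using norm_qprod_le[OF X, of x] e3 unfolding e_def by simp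
  have P1: "norm (qprod x (x\<^sup>2) - 1) \<le> 3 * (25 / 16 * norm x)"
  proof -
    have "norm (qpoch x (x\<^sup>2) n - 1) \<le> e - 1" for n
    proof -
      have "norm (qpoch x (x\<^sup>2) n - 1) \<le> (\<Prod>k<n. 1 + norm (x * (x\<^sup>2) ^ k)) - 1"
        unfolding qpoch_def by (rule norm_prod_minus1_le_prod_minus1)
      also have "(\<Prod>k<n. 1 + norm (x * (x\<^sup>2) ^ k)) \<le> exp (\<Sum>k<n. norm (x * (x\<^sup>2) ^ k))"
        by (intro prod_le_exp_sum) auto
      also have "(\<Sum>k<n. norm (x * (x\<^sup>2) ^ k)) \<le> (\<Sum>k. norm x * norm (x\<^sup>2) ^ k)"
        unfolding norm_mult norm_power[of "x\<^sup>2"]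
        using X by (intro sum_le_suminf summable_mult summable_geometric) auto
      also have "\<dots> = norm x / (1 - norm (x\<^sup>2))"
        using X by (simp add: suminf_mult suminf_geometric summable_geometric)
      finally show ?thesis unfolding e_def by simp
    qed
    moreover have "(\<lambda>n. norm (qpoch x (x\<^sup>2) n - 1)) \<longlonglongrightarrow> norm (qprod x (x\<^sup>2) - 1)"
      by (intro tendsto_intros qpoch_tendsto X)
    ultimately have "norm (qprod x (x\<^sup>2) - 1) \<le> e - 1" by (intro LIMSEQ_le_const2) auto
    also have "e - 1 \<le> e * (norm x / (1 - norm (x\<^sup>2)))"
    proof -
      define v where "v = norm x / (1 - norm (x\<^sup>2))"
      have "e * (1 - v) \<le> e * exp (- v)" unfolding e_def
        using exp_ge_add_one_self[of "- v"] by (intro mult_left_mono) auto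
      also have "e * exp (- v) = 1" by (simp add: e_def v_def flip: exp_add)
      finally show ?thesis unfolding v_def by (simp add: algebra_simps)
    qed
    also have "\<dots> \<le> 3 * (25 / 16 * norm x)" by (intro mult_mono e3 s) (use X in auto)
    finally show ?thesis .
  qed
  have T: "norm (thetaplus x) \<le> 5 / 2 * norm x"
  proof -
    have "norm (thetaplus x) \<le> norm x / (1 - norm x)" by (rule norm_thetaplus_le[OF x1])
    also have "\<dots> \<le> norm x / (2 / 5)" using x by (intro divide_left_mono) auto
    finally show ?thesis by simp
  qed
  have "theta_weber x - 1 = 2 * thetaplus x * qprod x (x\<^sup>2) + (qprod x (x\<^sup>2) - 1)"
    by (simp add: theta_weber_def algebra_simps)
  hence "norm (theta_weber x - 1) \<le> norm (2 * thetaplus x * qprod x (x\<^sup>2)) + norm (qprod x (x\<^sup>2) - 1)"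
    by (simp only: norm_triangle_ineq)
  also have "\<dots> \<le> 2 * (5 / 2 * norm x) * 3 + 3 * (25 / 16 * norm x)"
    unfolding norm_mult by (intro add_mono mult_mono P P1 T) auto
  also have "\<dots> \<le> 20 * norm x" by simp
  finally show ?thesis .
qed

text \<open>The multiplier in \<open>theta_weber_inversion\<close>. Near the real axis the inverted
  variable is close to 0, where \<open>theta_weber\<close> equals 1, so the multiplier is the whole
  main term.\<close>

definition main_arc :: "complex \<Rightarrow> complex" where
  "main_arc z = exp (- z / 24) * (of_real (sqrt pi) / csqrt z) * exp (of_real (pi\<^sup>2) / (24 * z))"

text \<open>The multiplier grows like exp(pi^2 \<rho> / 24), but its error factor is of order exp(-
  pi^2 \<rho>). Their product is bounded, so the error on this arc carries no exponential at
  all.\<close>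

lemma theta_weber_near:
  fixes y t :: real
  assumes y: "0 < y" "y \<le> 0.44" and t: "\<bar>t\<bar> \<le> 6 * y"
  shows "norm (theta_weber (exp (- Complex y t)) - main_arc (Complex y t)) \<le> 20 * sqrt (pi / y)"
proof -
  define z where "z = Complex y t"
  have z0: "z \<noteq> 0" using y by (auto simp: z_def complex_eq_iff)
  define \<rho> where "\<rho> = Re (1 / z)"
  have \<rho>: "\<rho> = y / (y\<^sup>2 + t\<^sup>2)" by (simp add: \<rho>_def z_def Re_divide)
  have t2: "t\<^sup>2 \<le> 36 * y\<^sup>2" using power_mono[OF t, of 2] by (simp add: power_mult_distrib)
  have \<rho>ge: "1 / (37 * y) \<le> \<rho>"
  proof -
    have "y / (37 * y\<^sup>2) \<le> y / (y\<^sup>2 + t\<^sup>2)" using y t2 by (intro divide_left_mono mult_pos_pos add_pos_nonneg) auto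
    thus ?thesis using y by (simp add: \<rho> power2_eq_square)
  qed
  have "0 < 1 / (37 * y)" using y by simp
  hence \<rho>pos: "\<rho> > 0" using \<rho>ge by linarith
  define x' where "x' = exp (- (of_real (pi\<^sup>2) / z))"
  have Re_c: "Re (of_real c / z) = c * \<rho>" for c by (simp add: \<rho>_def Re_divide)
  have nx': "norm x' = exp (- (pi\<^sup>2 * \<rho>))" using Re_c[of "pi\<^sup>2"] by (simp add: x'_def)
  have "norm x' \<le> 3 / 5"
  proof -
    \<comment> \<open>Here 37 = 1 + 6^2 comes from |t| <= 6 y. The bound 0.44 on y is just
      sufficient, since 9.8 / (37 * 0.44) is about 0.602.\<close>
    have "0.6 \<le> 9.8 / (37 * y)" using y by (simp add: field_simps)
    also have "\<dots> = 9.8 * (1 / (37 * y))" by simp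
    also have "\<dots> \<le> pi\<^sup>2 * \<rho>" using \<rho>ge pi_sq_bounds y by (intro mult_mono) auto
    finally have "exp (- (pi\<^sup>2 * \<rho>)) \<le> exp (- 0.6 :: real)" by simp
    also have "\<dots> \<le> 1 - 0.6 + 0.6\<^sup>2 / 2" using exp_neg_le_quadratic[of "0.6"] by simp
    also have "\<dots> \<le> 3 / 5" by (simp add: power2_eq_square)
    finally show ?thesis by (simp add: nx')
  qed
  note B1 = norm_theta_weber_minus_1[OF this]
  have "Re z > 0" using y by (simp add: z_def)
  hence "theta_weber (exp (- z)) = main_arc z * theta_weber x'"
    using theta_weber_inversion[of z] unfolding main_arc_def x'_def by simp
  hence "norm (theta_weber (exp (- z)) - main_arc z) = norm (main_arc z) * norm (theta_weber x' - 1)"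
    by (simp add: norm_mult[symmetric] algebra_simps)
  also have "\<dots> \<le> (sqrt (pi / y) * exp (pi\<^sup>2 / 24 * \<rho>)) * (20 * exp (- (pi\<^sup>2 * \<rho>)))"
  proof (rule mult_mono)
    show "norm (main_arc z) \<le> sqrt (pi / y) * exp (pi\<^sup>2 / 24 * \<rho>)"
  proof -
    have "norm (csqrt z) = sqrt (norm z)" by (metis norm_power power2_csqrt real_sqrt_abs abs_norm_cancel)
    have "norm (exp (- z / 24)) \<le> 1" using y by (simp add: z_def)
    moreover have "norm (exp (of_real (pi\<^sup>2) / (24 * z))) = exp (pi\<^sup>2 / 24 * \<rho>)"
      using Re_c[of "pi\<^sup>2 / 24"] by simp
    moreover have "norm (of_real (sqrt pi) / csqrt z) \<le> sqrt (pi / y)"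
    proof -
      have "y \<le> norm z" using complex_Re_le_cmod[of z] by (simp add: z_def)
      hence "sqrt y \<le> sqrt (norm z)" by simp
      hence "sqrt pi / sqrt (norm z) \<le> sqrt pi / sqrt y" using y z0 by (intro divide_left_mono) auto
      thus ?thesis using \<open>norm (csqrt z) = _\<close> by (simp add: norm_divide real_sqrt_divide)
    qed
    ultimately have "norm (main_arc z) \<le> 1 * sqrt (pi / y) * exp (pi\<^sup>2 / 24 * \<rho>)"
      unfolding main_arc_def norm_mult using y by (intro mult_mono) auto
    thus ?thesis by simp
    qed
    show "norm (theta_weber x' - 1) \<le> 20 * exp (- (pi\<^sup>2 * \<rho>))" using B1 by (simp add: nx')
  qed (use y in auto)
  also have "sqrt (pi / y) * exp (pi\<^sup>2 / 24 * \<rho>) * (20 * exp (- (pi\<^sup>2 * \<rho>))) = 20 * sqrt (pi / y) * exp (pi\<^sup>2 / 24 * \<rho> - pi\<^sup>2 * \<rho>)"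
    by (simp only: diff_conv_add_uminus exp_add mult_ac)
  also have "\<dots> \<le> 20 * sqrt (pi / y) * 1"
    using \<rho>pos y by (intro mult_left_mono) auto
  finally show ?thesis unfolding z_def by simp
qed

subsection \<open>The function \<open>\<phi>\<close>\<close>

text \<open>A finite form of Euler's identity. Going up by one factor alternates between multiplying
  1 + X^j with its odd partner 1 - X^j and with the first factor of the right-hand product; in both
  cases 1 - X^(2j) results.\<close>

lemma qpoch_odd_product:
  "qpoch X X (2 * k) * (\<Prod>i<k. 1 - X ^ (2 * i + 1)) = (\<Prod>i<k. 1 - X ^ (2 * (k + i + 1)))"
  "qpoch X X (2 * k + 1) * (\<Prod>i<Suc k. 1 - X ^ (2 * i + 1)) = (\<Prod>i<Suc k. 1 - X ^ (2 * (k + i + 1)))"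
proof -
  have odd: "qpoch X X (2 * k + 1) * (\<Prod>i<Suc k. 1 - X ^ (2 * i + 1)) = (\<Prod>i<Suc k. 1 - X ^ (2 * (k + i + 1)))"
    if even: "qpoch X X (2 * k) * (\<Prod>i<k. 1 - X ^ (2 * i + 1)) = (\<Prod>i<k. 1 - X ^ (2 * (k + i + 1)))" for k
  proof -
    have "qpoch X X (2 * k + 1) * (\<Prod>i<Suc k. 1 - X ^ (2 * i + 1)) =
       (qpoch X X (2 * k) * (\<Prod>i<k. 1 - X ^ (2 * i + 1))) * ((1 + X ^ (2 * k + 1)) * (1 - X ^ (2 * k + 1)))"
      by (simp add: qpoch_Suc)
    also have "(1 + X ^ (2 * k + 1)) * (1 - X ^ (2 * k + 1)) = 1 - X ^ (2 * (k + k + 1))"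
    proof -
      have "2 * (k + k + 1) = (2 * k + 1) + (2 * k + 1)" by simp
      hence "X ^ (2 * (k + k + 1)) = X ^ (2 * k + 1) * X ^ (2 * k + 1)" by (simp only: power_add)
      thus ?thesis by (simp only:) (simp add: algebra_simps)
    qed
    finally show ?thesis unfolding even by simp
  qed
  have "qpoch X X (2 * k) * (\<Prod>i<k. 1 - X ^ (2 * i + 1)) = (\<Prod>i<k. 1 - X ^ (2 * (k + i + 1)))" for k
  proof (induction k)
    case (Suc k)
    define R where "R = (\<Prod>i<k. 1 - X ^ (2 * (Suc k + i + 1)))"
    have T: "(\<Prod>i<Suc k. 1 - X ^ (2 * (k + i + 1))) = (1 - X ^ (2 * k + 2)) * R"
      unfolding R_def by (subst prod.lessThan_Suc_shift) simp
    have "qpoch X X (2 * Suc k) * (\<Prod>i<Suc k. 1 - X ^ (2 * i + 1)) =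
       (qpoch X X (2 * k + 1) * (\<Prod>i<Suc k. 1 - X ^ (2 * i + 1))) * (1 + X ^ (2 * k + 2))"
      by (simp add: qpoch_Suc del: prod.lessThan_Suc)
    also have "\<dots> = R * ((1 + X ^ (2 * k + 2)) * (1 - X ^ (2 * k + 2)))"
      unfolding odd[OF Suc] T by (simp only: mult_ac)
    also have "(1 + X ^ (2 * k + 2)) * (1 - X ^ (2 * k + 2)) = 1 - X ^ (2 * (Suc k + k + 1))"
    proof -
      have "2 * (Suc k + k + 1) = (2 * k + 2) + (2 * k + 2)" by simp
      hence "X ^ (2 * (Suc k + k + 1)) = X ^ (2 * k + 2) * X ^ (2 * k + 2)" by (simp only: power_add)
      thus ?thesis by (simp only:) (simp add: algebra_simps)
    qed
    finally show ?case unfolding R_def by simp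
  qed simp
  thus "qpoch X X (2 * k) * (\<Prod>i<k. 1 - X ^ (2 * i + 1)) = (\<Prod>i<k. 1 - X ^ (2 * (k + i + 1)))"
    "qpoch X X (2 * k + 1) * (\<Prod>i<Suc k. 1 - X ^ (2 * i + 1)) = (\<Prod>i<Suc k. 1 - X ^ (2 * (k + i + 1)))"
    using odd by blast+
qed

text \<open>The cancellation between consecutive factors of \<open>(-X;X)\<^sub>m\<close> makes only the odd
  ones matter; bounding every factor separately would lose too much.\<close>
lemma norm_qpoch_ge_odd_product:
  assumes X: "norm X < 1" and m: "m = 2 * k \<and> c = k \<or> m = 2 * k + 1 \<and> c = Suc k"
  shows "(\<Prod>i<c. 1 - norm X ^ (2 * i + 1)) \<le> norm (qpoch X X m)"
proof -
  define r where "r = norm X"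
  have r: "0 \<le> r" "r < 1" using X by (auto simp: r_def)
  have id: "qpoch X X m * (\<Prod>i<c. 1 - X ^ (2 * i + 1)) = (\<Prod>i<c. 1 - X ^ (2 * (k + i + 1)))"
    using m qpoch_odd_product[of X k] by auto
  have pos: "1 - r ^ Suc i > 0" for i using r by (simp add: power_less_one_iff del: power_Suc)
  have nz: "norm (1 - X ^ (2 * i + 1)) > 0" for i
  proof -
    have "norm (X ^ (2 * i + 1)) < 1" using pos[of "2 * i"] by (simp add: norm_power norm_mult r_def)
    thus ?thesis by auto
  qed
  have "(\<Prod>i<c. (1 - r ^ (2 * i + 1)) * norm (1 - X ^ (2 * i + 1))) \<le> (\<Prod>i<c. norm (1 - X ^ (2 * (k + i + 1))))"
  proof (rule prod_mono, safe)
    fix i assume i: "i < c"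
    show "0 \<le> (1 - r ^ (2 * i + 1)) * norm (1 - X ^ (2 * i + 1))"
      using pos[of "2 * i"] by (intro mult_nonneg_nonneg) auto
    have "(1 - r ^ (2 * i + 1)) * norm (1 - X ^ (2 * i + 1)) \<le> (1 - r ^ (2 * i + 1)) * (1 + r ^ (2 * i + 1))"
    proof (rule mult_left_mono)
      show "norm (1 - X ^ (2 * i + 1)) \<le> 1 + r ^ (2 * i + 1)"
        using norm_triangle_ineq4[of 1 "X ^ (2 * i + 1)"] by (simp add: norm_power norm_mult r_def)
    qed (use pos[of "2 * i"] in auto)
    also have "\<dots> = 1 - r ^ (2 * (2 * i + 1))"
    proof -
      have "r ^ (2 * (2 * i + 1)) = r ^ (2 * i + 1) * r ^ (2 * i + 1)" by (simp only: mult_2 power_add)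
      thus ?thesis by (simp only:) (simp add: algebra_simps)
    qed
    \<comment> \<open>From \<open>i < c\<close> follows i <= k, hence 2 i + 1 <= k + i + 1. Each
      factor of the odd product is thus dominated by the factor with the same index on the right of
      the identity.\<close>
    also have "\<dots> \<le> 1 - r ^ (2 * (k + i + 1))"
      using r i m by (intro diff_left_mono power_decreasing) auto
    also have "\<dots> \<le> norm (1 - X ^ (2 * (k + i + 1)))"
      using norm_triangle_ineq2[of 1 "X ^ (2 * (k + i + 1))"] by (simp only: norm_one norm_power r_def)
    finally show "(1 - r ^ (2 * i + 1)) * norm (1 - X ^ (2 * i + 1)) \<le> norm (1 - X ^ (2 * (k + i + 1)))" .
  qed
  also have "\<dots> = norm (qpoch X X m) * (\<Prod>i<c. norm (1 - X ^ (2 * i + 1)))"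
    unfolding prod_norm norm_mult[symmetric] id ..
  finally have "(\<Prod>i<c. 1 - r ^ (2 * i + 1)) * (\<Prod>i<c. norm (1 - X ^ (2 * i + 1))) \<le> norm (qpoch X X m) * (\<Prod>i<c. norm (1 - X ^ (2 * i + 1)))"
    by (simp add: prod.distrib)
  moreover have "0 < (\<Prod>i<c. norm (1 - X ^ (2 * i + 1)))" by (intro prod_pos) (use nz in auto)
  ultimately show ?thesis unfolding r_def by (rule mult_right_le_imp_le)
qed

text \<open>The quadratic bound applied at 0.57 itself would only give 0.593; applying it at a third
  of the argument and cubing is sharp enough.\<close>

lemma exp_neg_057: "exp (- 0.57 :: real) \<le> 0.568"
proof -
  have "exp (- 0.57 :: real) = exp (- 0.19) ^ 3" by (simp flip: exp_of_nat_mult)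
  also have "\<dots> \<le> (1 - 0.19 + 0.19\<^sup>2 / 2) ^ 3"
    by (intro power_mono exp_neg_le_quadratic[of "0.19"]) auto
  also have "\<dots> \<le> 0.568" by (simp add: power2_eq_square power3_eq_cube)
  finally show ?thesis .
qed

text \<open>Completing the square at \<open>k = 0.57 / (4 y)\<close>, close to the true saddle point, turns the
  Rogers--Ramanujan type sum into one of Euler's.\<close>
lemma rogers_ramanujan_sum_le:
  assumes y: "0 < y"
  defines "p \<equiv> exp (- (4 * y))"
  shows "(\<Sum>k<K. p ^ (k\<^sup>2 + k) / (\<Prod>i<k. 1 - p ^ Suc i)) \<le> exp (pi\<^sup>2 / (54 * y))"
proof -
  have p: "0 < p" "p < 1" using y by (auto simp: p_def)
  define P where "P = (\<lambda>k. \<Prod>i<k. 1 - p ^ Suc i)"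
  have P: "P k > 0" for k unfolding P_def using p by (intro prod_pos) (auto simp: power_less_one_iff simp del: power_Suc)
  have qP: "qpoch (- of_real p) (of_real p) k = of_real (P k)" for k
    by (simp add: qpoch_def P_def)
  \<comment> \<open>With a general c in place of 0.57 the final exponent is (c^2/8 + e^(-c)/4) / y.
    It is least where c = e^(-c), that is for c about 0.567.\<close>
  define a where "a = exp (- 0.57) * p"
  have a: "0 < a" using p by (simp add: a_def)
  define C where "C = exp (0.57\<^sup>2 / (8 * y))"
  define T where "T = (\<lambda>k. p ^ (k choose 2) / P k * a ^ k)"
  have T0: "T k \<ge> 0" for k unfolding T_def using p P[of k] a by (intro mult_nonneg_nonneg divide_nonneg_pos) auto
  have pc: "norm (complex_of_real p) < 1" using p by simp
  have "(\<lambda>k. complex_of_real (T k)) sums qprod (of_real a) (of_real p)"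
    using euler_sum1[OF pc, of "of_real a"] unfolding qP by (simp add: T_def)
  hence S: "T sums Re (qprod (of_real a) (of_real p))" using sums_Re by fastforce
  have term_le: "p ^ (k\<^sup>2 + k) / P k \<le> C * T k" for k
  proof -
    have "p ^ (k\<^sup>2 + k) \<le> C * (p ^ (k choose 2) * a ^ k)"
    proof -
      have c2: "real (k choose 2) = real k * (real k - 1) / 2"
        by (induction k) (auto simp: choose_two_Suc field_simps)
      have "p ^ (k\<^sup>2 + k) = exp (- (4 * y) * ((real k)\<^sup>2 + real k))"
        by (simp add: p_def mult.commute flip: exp_of_nat_mult)
      also have "\<dots> \<le> exp (0.57\<^sup>2 / (8 * y) + (- (4 * y) * real (k choose 2) + (- 0.57 - 4 * y) * real k))"
      proof -
        have "0 \<le> 2 * y * (real k - 0.57 / (4 * y))\<^sup>2 + 2 * y * real k" using y by simp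
        also have "2 * y * (real k - 0.57 / (4 * y))\<^sup>2 = 2 * y * (real k)\<^sup>2 - 0.57 * real k + 0.57\<^sup>2 / (8 * y)"
          using y by (simp add: power2_eq_square field_simps)
        finally have "0 \<le> 2 * y * (real k)\<^sup>2 - 0.57 * real k + 0.57\<^sup>2 / (8 * y) + 2 * y * real k" .
        moreover have "- (4 * y) * real (k choose 2) = - (2 * y * (real k)\<^sup>2) + 2 * y * real k"
        proof -
          have "2 * real (k choose 2) = real k * (real k - 1)" unfolding c2 by simp
          hence "- (2 * y) * (2 * real (k choose 2)) = - (2 * y) * (real k * (real k - 1))" by (simp only:)
          thus ?thesis by (simp add: power2_eq_square algebra_simps)
        qed
        ultimately show ?thesis unfolding exp_le_cancel_iff by (simp add: algebra_simps)
      qed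
      also have "\<dots> = C * (p ^ (k choose 2) * a ^ k)"
      proof -
        have "p ^ (k choose 2) = exp (- (4 * y) * real (k choose 2))" unfolding p_def exp_of_nat_mult[symmetric] by (simp only: mult.commute)
        moreover have "a = exp (- 0.57 - 4 * y)" unfolding a_def p_def by (simp only: exp_add[symmetric] diff_conv_add_uminus)
        hence "a ^ k = exp ((- 0.57 - 4 * y) * real k)" by (simp only: exp_of_nat_mult[symmetric] mult.commute)
        ultimately show ?thesis unfolding C_def by (simp only: exp_add)
      qed
      finally show ?thesis .
    qed
    hence "p ^ (k\<^sup>2 + k) / P k \<le> C * (p ^ (k choose 2) * a ^ k) / P k" using P[of k] by (intro divide_right_mono) auto
    thus ?thesis by (simp add: T_def)
  qed
  have "(\<Sum>k<K. p ^ (k\<^sup>2 + k) / P k) \<le> C * (\<Sum>k<K. T k)"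
    unfolding sum_distrib_left by (intro sum_mono term_le)
  also have "(\<Sum>k<K. T k) \<le> (\<Sum>k. T k)" using S T0 by (intro sum_le_suminf) (auto simp: sums_iff)
  also have "(\<Sum>k. T k) = Re (qprod (of_real a) (of_real p))" using S by (simp add: sums_iff)
  also have "\<dots> \<le> norm (qprod (of_real a) (of_real p))" by (rule complex_Re_le_cmod)
  also have "\<dots> \<le> exp (a / (1 - p))" using norm_qprod_le[OF pc, of "of_real a"] a p by simp
  also have "\<dots> \<le> exp (0.568 / (4 * y))"
  proof -
    have "p / (1 - p) \<le> 1 / (4 * y)"
    proof -
      have "4 * y * p \<le> 1 - p"
      proof -
        have "(1 + 4 * y) * p \<le> exp (4 * y) * p" using p exp_ge_add_one_self[of "4 * y"] by (intro mult_right_mono) auto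
        also have "exp (4 * y) * p = 1" by (simp add: p_def flip: exp_add)
        finally show ?thesis by (simp add: algebra_simps)
      qed
      thus ?thesis using y p by (simp add: field_simps)
    qed
    hence "exp (- 0.57) * (p / (1 - p)) \<le> 0.568 * (1 / (4 * y))"
      using exp_neg_057 p by (intro mult_mono) auto
    thus ?thesis by (simp add: a_def)
  qed
  finally have "(\<Sum>k<K. p ^ (k\<^sup>2 + k) / P k) \<le> C * exp (0.568 / (4 * y))" by (simp add: C_def)
  also have "\<dots> = exp ((0.57\<^sup>2 / 8 + 0.568 / 4) / y)"
    by (simp add: C_def add_divide_distrib flip: exp_add)
  also have "\<dots> \<le> exp (pi\<^sup>2 / 54 / y)"
  proof -
    \<comment> \<open>The left side is 0.18261... and the right side exceeds 0.18275: this is the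
      tightest comparison with pi^2/54.\<close>
    have "0.57\<^sup>2 / 8 + 0.568 / 4 \<le> pi\<^sup>2 / 54" using pi_sq_bounds(1) by (simp add: power2_eq_square)
    hence "(0.57\<^sup>2 / 8 + 0.568 / 4) / y \<le> pi\<^sup>2 / 54 / y" using y by (intro divide_right_mono) auto
    thus ?thesis by (simp only: exp_le_cancel_iff)
  qed
  finally show ?thesis by (simp add: P_def)
qed

text \<open>After the term m = 0, the terms m = 2 k + 1 and m = 2 k + 2 share a bound. Their
  denominators contain k + 1 odd factors each, and m^2 >= 4 (k^2 + k), so the series is at most 1
  plus twice a Rogers-Ramanujan sum in p = e^(-4y), divided by 1 - R.\<close>

lemma norm_phi3_le:
  assumes y: "0 < y" "y \<le> 0.44" and nx: "norm x = exp (- y)"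
  shows "norm (phi3 x) \<le> 3 / y * exp (pi\<^sup>2 / (54 * y))"
proof -
  define r R p where "r = exp (- y)" and "R = exp (- (2 * y))" and "p = exp (- (4 * y))"
  have x: "norm x < 1" using y by (simp add: nx)
  have X: "norm (x\<^sup>2) < 1" using norm_square_less_1[OF x] .
  have r: "0 < r" "r < 1" and R: "0 < R" "R < 1" and p: "0 < p" "p < 1" using y by (auto simp: r_def R_def p_def)
  have rel: "r ^ 2 = R" "R ^ 2 = p" "r ^ 4 = p" by (simp_all add: r_def R_def p_def flip: exp_of_nat_mult)
  have nX: "norm (x\<^sup>2) = R" using rel by (simp add: norm_power nx r_def)
  define u where "u = (\<lambda>m. x ^ (m\<^sup>2) / qpoch (x\<^sup>2) (x\<^sup>2) m)"
  define P where "P = (\<lambda>k. \<Prod>i<k. 1 - p ^ Suc i)"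
  have P: "P k > 0" for k unfolding P_def using p by (intro prod_pos) (auto simp: power_less_one_iff simp del: power_Suc)
  define b where "b = (\<lambda>k. p ^ (k\<^sup>2 + k) / P k / (1 - R))"
  \<comment> \<open>The factor with index 0 is kept as 1 - R; in the others the exponent 2 i + 3 is
    lowered to 2 i + 2, which turns powers of R into powers of p = R^2.\<close>
  have oP: "(1 - R) * P k \<le> (\<Prod>i<Suc k. 1 - R ^ (2 * i + 1))" for k
  proof -
    have "P k \<le> (\<Prod>i<k. 1 - R ^ (2 * Suc i + 1))" unfolding P_def
    proof (rule prod_mono, safe)
      fix i
      have "R ^ (2 * Suc i + 1) \<le> R ^ (2 * Suc i)" using R by (intro power_decreasing) auto
      also have "\<dots> = p ^ Suc i" by (simp only: power_mult rel)
      finally show "1 - p ^ Suc i \<le> 1 - R ^ (2 * Suc i + 1)" by simp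
      show "0 \<le> 1 - p ^ Suc i" using p by (simp add: power_le_one del: power_Suc)
    qed
    thus ?thesis using R by (subst prod.lessThan_Suc_shift) (simp add: mult_left_mono)
  qed
  have u_le: "norm (u m) \<le> b k" if "m = 2 * k + 1 \<or> m = 2 * k + 2" for m k
  proof -
    have "(\<Prod>i<Suc k. 1 - norm (x\<^sup>2) ^ (2 * i + 1)) \<le> norm (qpoch (x\<^sup>2) (x\<^sup>2) m)"
      using that norm_qpoch_ge_odd_product[OF X, of m k "Suc k"] norm_qpoch_ge_odd_product[OF X, of m "Suc k" "Suc k"] by auto
    hence q: "(1 - R) * P k \<le> norm (qpoch (x\<^sup>2) (x\<^sup>2) m)" using oP[of k] unfolding nX by linarith
    have "norm (x ^ (m\<^sup>2)) = r ^ (m\<^sup>2)" by (simp add: norm_power nx r_def)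
    also have "\<dots> \<le> r ^ (4 * (k\<^sup>2 + k))"
      using that r by (intro power_decreasing) (auto simp: power2_eq_square algebra_simps)
    also have "\<dots> = p ^ (k\<^sup>2 + k)" by (simp only: power_mult rel)
    finally have "norm (u m) \<le> p ^ (k\<^sup>2 + k) / ((1 - R) * P k)"
      unfolding u_def norm_divide using q R P[of k] p by (intro frac_le) (auto intro!: mult_pos_pos)
    thus ?thesis by (simp add: b_def mult.commute)
  qed
  define E where "E = exp (pi\<^sup>2 / (54 * y))"
  have bsum: "(\<Sum>k<K. b k) \<le> E / (1 - R)" for K
  proof -
    have "(\<Sum>k<K. b k) = (\<Sum>k<K. p ^ (k\<^sup>2 + k) / P k) / (1 - R)" by (simp add: b_def sum_divide_distrib)
    also have "\<dots> \<le> E / (1 - R)"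
      using rogers_ramanujan_sum_le[OF y(1), of K] R unfolding P_def p_def E_def by (intro divide_right_mono) auto
    finally show ?thesis .
  qed
  have partial: "norm (\<Sum>m<Suc (2 * K). u m) \<le> 1 + 2 * (\<Sum>k<K. b k)" for K
  proof (induction K)
    case (Suc K)
    have "(\<Sum>m<Suc (2 * Suc K). u m) = (\<Sum>m<Suc (2 * K). u m) + (u (2 * K + 1) + u (2 * K + 2))" by simp
    also have "norm \<dots> \<le> norm (\<Sum>m<Suc (2 * K). u m) + (norm (u (2 * K + 1)) + norm (u (2 * K + 2)))"
      by (intro order_trans[OF norm_triangle_ineq] add_left_mono norm_triangle_ineq)
    also have "\<dots> \<le> (1 + 2 * (\<Sum>k<K. b k)) + (b K + b K)"
      by (intro add_mono Suc u_le) auto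
    finally show ?case by simp
  qed (simp add: u_def)
  have "norm (phi3 x) \<le> 1 + 2 * (E / (1 - R))"
  proof (rule LIMSEQ_le_const2)
    have "strict_mono (\<lambda>K::nat. Suc (2 * K))" by (auto simp: strict_mono_def)
    from LIMSEQ_subseq_LIMSEQ[OF phi3_sums(1)[OF x, unfolded sums_def] this]
    show "(\<lambda>K. norm (\<Sum>m<Suc (2 * K). u m)) \<longlonglongrightarrow> norm (phi3 x)"
      by (intro tendsto_norm) (simp add: o_def u_def)
    have "norm (\<Sum>m<Suc (2 * K). u m) \<le> 1 + 2 * (E / (1 - R))" for K
      using partial[of K] bsum[of K] by linarith
    thus "\<exists>N. \<forall>K\<ge>N. norm (\<Sum>m<Suc (2 * K). u m) \<le> 1 + 2 * (E / (1 - R))" by blast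
  qed
  also have "\<dots> \<le> E / y + 2 * (E / y)"
  proof (intro add_mono mult_left_mono)
    have "1 \<le> E" using y by (simp add: E_def)
    moreover have "y \<le> 1" using y by simp
    ultimately have "y \<le> E" by linarith
    thus "1 \<le> E / y" using y by simp
    have "y \<le> 1 - R" using one_minus_exp_ge[of "2 * y"] y by (simp add: R_def)
    thus "E / (1 - R) \<le> E / y" using y by (intro divide_left_mono mult_pos_pos) (auto simp: E_def R)
  qed auto
  also have "\<dots> = 3 / y * E" by simp
  finally show ?thesis unfolding E_def .
qed

subsection \<open>The integral over the main arc\<close>

text \<open>Along the imaginary axis the primitive of e^(z^2) is i times the integral of e^(-s^2),
  so its limit at infinity there is i sqrt(pi) / 2. This is the constant from which the main term
  arises.\<close>

lemma gaussian_half_integral: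
  fixes F :: "complex \<Rightarrow> complex"
  assumes F: "\<And>z. (F has_field_derivative exp (z\<^sup>2)) (at z)" and F0: "F 0 = 0"
    and G: "G = (\<lambda>s::real. Im (F (\<i> * of_real s)))"
  shows "\<And>s. (G has_real_derivative exp (- s\<^sup>2)) (at s)"
    and "\<And>s. F (\<i> * of_real s) = \<i> * of_real (G s)"
    and "(G \<longlongrightarrow> sqrt pi / 2) at_top"
    and "\<And>a b. 0 \<le> a \<Longrightarrow> a \<le> b \<Longrightarrow> G a \<le> G b"
    and "\<And>s. 0 \<le> s \<Longrightarrow> G s \<le> sqrt pi / 2"
    and "G 0 = 0"
proof -
  have D: "((\<lambda>s. F (\<i> * of_real s)) has_vector_derivative (\<i> * exp (- of_real (s\<^sup>2)))) (at s)" for s :: real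
  proof -
    have "((\<lambda>s. \<i> * of_real s) has_vector_derivative \<i>) (at s)"
      by (auto intro!: derivative_eq_intros has_vector_derivative_of_real)
    from field_vector_diff_chain_at[OF this F] show ?thesis
      by (simp add: o_def power_mult_distrib)
  qed
  show G': "(G has_real_derivative exp (- s\<^sup>2)) (at s)" for s
  proof -
    have "((\<lambda>s. Im (F (\<i> * of_real s))) has_vector_derivative Im (\<i> * exp (- of_real (s\<^sup>2)))) (at s)"
      by (rule bounded_linear.has_vector_derivative[OF bounded_linear_Im D])
    moreover have "Im (\<i> * exp (- complex_of_real (s\<^sup>2))) = exp (- s\<^sup>2)"
      by (simp add: Re_exp)
    ultimately show ?thesis unfolding G by (simp add: has_real_derivative_iff_has_vector_derivative)
  qed
  have Re0: "Re (F (\<i> * of_real s)) = 0" for s :: real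
  proof -
    have R: "((\<lambda>s. Re (F (\<i> * of_real s))) has_real_derivative 0) (at s)" for s :: real
    proof -
      have "((\<lambda>s. Re (F (\<i> * of_real s))) has_vector_derivative Re (\<i> * exp (- of_real (s\<^sup>2)))) (at s)"
        by (rule bounded_linear.has_vector_derivative[OF bounded_linear_Re D])
      moreover have "Re (\<i> * exp (- complex_of_real (s\<^sup>2))) = 0"
        by (simp add: Im_exp)
      ultimately show ?thesis by (simp add: has_real_derivative_iff_has_vector_derivative)
    qed
    have "(\<lambda>s. Re (F (\<i> * of_real s))) s = (\<lambda>s. Re (F (\<i> * of_real s))) 0"
      by (rule DERIV_isconst_all) (use R in blast)
    thus ?thesis by (simp add: F0)
  qed
  show "F (\<i> * of_real s) = \<i> * of_real (G s)" for s
    by (simp add: complex_eq_iff Re0 G)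
  show G0: "G 0 = 0" by (simp add: G F0)
  show mono: "G a \<le> G b" if "0 \<le> a" "a \<le> b" for a b
    by (rule DERIV_nonneg_imp_nondecreasing[OF that(2)], rule exI, rule conjI, rule G') simp
  show lim: "(G \<longlongrightarrow> sqrt pi / 2) at_top"
  proof -
    define f where "f = (\<lambda>x::real. indicator {0..} x *\<^sub>R exp (- x\<^sup>2))"
    have f: "has_bochner_integral lborel f (sqrt pi / 2)" unfolding f_def by (rule gaussian_moment_0)
    hence "((\<lambda>y. \<integral>x. indicator {..y} x *\<^sub>R f x \<partial>lborel) \<longlongrightarrow> (\<integral>x. f x \<partial>lborel)) at_top"
      by (intro tendsto_integral_at_top) (auto simp: has_bochner_integral_iff)
    moreover have "(\<integral>x. f x \<partial>lborel) = sqrt pi / 2" using f by (simp add: has_bochner_integral_iff)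
    moreover have "\<forall>\<^sub>F y in at_top. (\<integral>x. indicator {..y} x *\<^sub>R f x \<partial>lborel) = G y"
      using eventually_ge_at_top[of 0]
    proof eventually_elim
      case (elim y)
      have "(\<integral>x. indicator {..y} x *\<^sub>R f x \<partial>lborel) = (\<integral>x. exp (- x\<^sup>2) * indicator {0..y} x \<partial>lborel)"
        by (rule Bochner_Integration.integral_cong) (auto simp: f_def indicator_def)
      also have "\<dots> = G y - G 0"
        by (rule integral_FTC_Icc_real[OF elim]) (use G' in \<open>auto intro!: continuous_intros\<close>)
      finally show ?case by (simp add: G0)
    qed
    ultimately have "((\<lambda>y. \<integral>x. indicator {..y} x *\<^sub>R f x \<partial>lborel) \<longlongrightarrow> sqrt pi / 2) at_top"
      "\<forall>\<^sub>F y in at_top. (\<integral>x. indicator {..y} x *\<^sub>R f x \<partial>lborel) = G y" by simp_all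
    thus ?thesis by (rule Lim_transform_eventually)
  qed
  show "G s \<le> sqrt pi / 2" if "0 \<le> s" for s
  proof (rule tendsto_lowerbound[OF lim])
    show "\<forall>\<^sub>F b in at_top. G s \<le> G b" using eventually_ge_at_top[of s] by eventually_elim (use mono that in auto)
  qed auto
qed

text \<open>Move vertically from \<open>u\<close> to infinity. On this ray the integrand has norm
  exp(Re u^2 - 2 X Im u - X^2), and Im u >= 0 leaves a Gaussian in X with factor exp(Re
  u^2).\<close>

lemma erfi_tail:
  fixes F :: "complex \<Rightarrow> complex"
  assumes F: "\<And>z. (F has_field_derivative exp (z\<^sup>2)) (at z)" and F0: "F 0 = 0" and u: "Im u \<ge> 0"
  shows "norm (F u - \<i> * of_real (sqrt pi / 2)) \<le> sqrt pi / 2 * exp (Re (u\<^sup>2))"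
proof -
  define G where "G = (\<lambda>s::real. Im (F (\<i> * of_real s)))"
  note G = gaussian_half_integral[OF F F0 G_def]
  define h where "h = (\<lambda>X::real. F (u + \<i> * of_real X))"
  have h': "(h has_vector_derivative (\<i> * exp ((u + \<i> * of_real X)\<^sup>2))) (at X)" for X
  proof -
    have "((\<lambda>s. u + \<i> * of_real s) has_vector_derivative \<i>) (at X)"
      by (auto intro!: derivative_eq_intros has_vector_derivative_of_real)
    from field_vector_diff_chain_at[OF this F] show ?thesis by (simp add: o_def h_def)
  qed
  have hX: "norm (h X - h 0) \<le> exp (Re (u\<^sup>2)) * G X" if X: "X > 0" for X
  proof -
    have "norm (h X - h 0) \<le> exp (Re (u\<^sup>2)) * G X - exp (Re (u\<^sup>2)) * G 0"
    proof (rule differentiable_bound_general[OF X])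
      show "continuous_on {0..X} h"
        by (intro continuous_at_imp_continuous_on ballI) (rule has_vector_derivative_continuous[OF h'])
      show "continuous_on {0..X} (\<lambda>s. exp (Re (u\<^sup>2)) * G s)"
        by (intro continuous_on_mult continuous_on_const continuous_at_imp_continuous_on ballI) (rule DERIV_isCont[OF G(1)])
      show "(h has_vector_derivative (\<i> * exp ((u + \<i> * of_real s)\<^sup>2))) (at s)" for s by (rule h')
      show "((\<lambda>s. exp (Re (u\<^sup>2)) * G s) has_vector_derivative (exp (Re (u\<^sup>2)) * exp (- s\<^sup>2))) (at s)" for s
        using DERIV_cmult[OF G(1), of "exp (Re (u\<^sup>2))" s] by (simp add: has_real_derivative_iff_has_vector_derivative)
      fix s :: real assume s: "0 < s"
      have "Re ((u + \<i> * of_real s)\<^sup>2) = Re (u\<^sup>2) - 2 * s * Im u - s\<^sup>2"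
        by (simp add: power2_eq_square algebra_simps)
      also have "\<dots> \<le> Re (u\<^sup>2) - s\<^sup>2" using s u by simp
      finally show "norm (\<i> * exp ((u + \<i> * of_real s)\<^sup>2)) \<le> exp (Re (u\<^sup>2)) * exp (- s\<^sup>2)"
        by (simp add: norm_mult flip: exp_add)
    qed
    thus ?thesis by (simp add: G(6))
  qed
  have lim: "(h \<longlongrightarrow> \<i> * of_real (sqrt pi / 2)) at_top"
  proof -
    define a b where "a = Re u" and "b = Im u"
    have inf: "filterlim (\<lambda>X. b + X) at_top at_top"
      by (rule filterlim_tendsto_add_at_top[OF tendsto_const filterlim_ident])
    have "((\<lambda>X. \<i> * complex_of_real (G (b + X))) \<longlongrightarrow> \<i> * of_real (sqrt pi / 2)) at_top"
      by (intro tendsto_intros filterlim_compose[OF G(3) inf])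
    \<comment> \<open>The ray through \<open>u\<close> is compared with the imaginary axis along a
      horizontal segment of length |a|, on which the integrand is at most exp(a^2 - (b +
      X)^2).\<close>
    moreover have "((\<lambda>X. h X - \<i> * complex_of_real (G (b + X))) \<longlongrightarrow> 0) at_top"
    proof (rule Lim_null_comparison)
      show "\<forall>\<^sub>F X in at_top. norm (h X - \<i> * complex_of_real (G (b + X))) \<le> exp (a\<^sup>2 - (b + X)\<^sup>2) * \<bar>a\<bar>"
      proof (intro always_eventually allI)
        fix X
        define c where "c = \<i> * complex_of_real (b + X)"
        define S where "S = closed_segment c (of_real a + c)"
        have "norm (F (of_real a + c) - F c) \<le> exp (a\<^sup>2 - (b + X)\<^sup>2) * norm (of_real a + c - c)"
        proof (rule field_differentiable_bound[of S])
          fix z assume "z \<in> S"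
          show "(F has_field_derivative exp (z\<^sup>2)) (at z within S)" by (rule has_field_derivative_at_within[OF F])
          from \<open>z \<in> S\<close> obtain v where v: "0 \<le> v" "v \<le> 1" "z = c + of_real (v * a)"
            unfolding S_def by (auto simp: in_segment algebra_simps scaleR_conv_of_real)
          have "(v * a)\<^sup>2 \<le> a\<^sup>2" using v by (simp add: power_mult_distrib power_le_one mult_left_le_one_le)
          hence "Re (z\<^sup>2) \<le> a\<^sup>2 - (b + X)\<^sup>2" by (simp add: v(3) c_def power2_eq_square)
          thus "norm (exp (z\<^sup>2)) \<le> exp (a\<^sup>2 - (b + X)\<^sup>2)" by simp
        qed (auto simp: S_def)
        moreover have "norm (of_real a + c - c) = \<bar>a\<bar>" by simp
        moreover have "of_real a + c = u + \<i> * of_real X" by (simp add: complex_eq_iff c_def a_def b_def)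
        moreover have "F c = \<i> * complex_of_real (G (b + X))" unfolding c_def by (rule G(2))
        ultimately show "norm (h X - \<i> * complex_of_real (G (b + X))) \<le> exp (a\<^sup>2 - (b + X)\<^sup>2) * \<bar>a\<bar>"
          by (simp only: h_def)
      qed
      show "((\<lambda>X. exp (a\<^sup>2 - (b + X)\<^sup>2) * \<bar>a\<bar>) \<longlongrightarrow> 0) at_top" by real_asymp
    qed
    ultimately have "((\<lambda>X. (h X - \<i> * complex_of_real (G (b + X))) + \<i> * complex_of_real (G (b + X))) \<longlongrightarrow> 0 + \<i> * of_real (sqrt pi / 2)) at_top"
      by (intro tendsto_add)
    thus ?thesis by simp
  qed
  have "norm (\<i> * of_real (sqrt pi / 2) - h 0) \<le> sqrt pi / 2 * exp (Re (u\<^sup>2))"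
  proof (rule tendsto_upperbound)
    show "((\<lambda>X. norm (h X - h 0)) \<longlongrightarrow> norm (\<i> * of_real (sqrt pi / 2) - h 0)) at_top"
      by (intro tendsto_intros lim)
    show "\<forall>\<^sub>F X in at_top. norm (h X - h 0) \<le> sqrt pi / 2 * exp (Re (u\<^sup>2))"
      using eventually_gt_at_top[of 0]
    proof eventually_elim
      case (elim X)
      have "exp (Re (u\<^sup>2)) * G X \<le> exp (Re (u\<^sup>2)) * (sqrt pi / 2)" using elim by (intro mult_left_mono G(5)) auto
      with hX[OF elim] have "norm (h X - h 0) \<le> exp (Re (u\<^sup>2)) * (sqrt pi / 2)" by (rule order_trans)
      thus ?case by (simp only: mult.commute)
    qed
  qed auto
  moreover have "h 0 = F u" by (simp add: h_def)
  ultimately show ?thesis by (simp only: norm_minus_commute)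
qed

text \<open>Oddness transfers \<open>erfi_tail\<close> to the lower half-plane, where the lower end
  of the arc lies.\<close>

lemma erfi_exists:
  obtains F :: "complex \<Rightarrow> complex" where "\<And>z. (F has_field_derivative exp (z\<^sup>2)) (at z)" "F 0 = 0" "\<And>z. F (- z) = - F z"
proof -
  have hol: "(\<lambda>z::complex. exp (z\<^sup>2)) holomorphic_on UNIV" by (intro holomorphic_intros)
  show thesis
  proof (rule holomorphic_convex_primitive'[OF convex_UNIV open_UNIV hol])
  fix g :: "complex \<Rightarrow> complex"
  assume "\<And>z. z \<in> UNIV \<Longrightarrow> (g has_field_derivative exp (z\<^sup>2)) (at z within UNIV)"
  hence g: "(g has_field_derivative exp (z\<^sup>2)) (at z)" for z by simp
  define F where "F = (\<lambda>z. g z - g 0)"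
  have F: "(F has_field_derivative exp (z\<^sup>2)) (at z)" for z
    unfolding F_def using g[of z] by (auto intro!: derivative_eq_intros)
  have "((\<lambda>z. F (- z)) has_field_derivative - exp (z\<^sup>2)) (at z)" for z
  proof -
    have "((\<lambda>z. F (- z)) has_field_derivative exp ((- z)\<^sup>2) * (- 1)) (at z)"
      by (rule DERIV_chain2[where g = uminus, OF F]) (auto intro!: derivative_eq_intros)
    thus ?thesis by simp
  qed
  hence "((\<lambda>z. F z + F (- z)) has_field_derivative 0) (at z)" for z
    using DERIV_add[OF F[of z], of "\<lambda>z. F (- z)" "- exp (z\<^sup>2)"] by simp
  hence "\<exists>c. \<forall>z\<in>UNIV. F z + F (- z) = c"
    by (intro has_field_derivative_zero_constant) auto
  then obtain c where "\<forall>z\<in>UNIV. F z + F (- z) = c" ..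
  hence c: "F z + F (- z) = c" for z by simp
  have F0: "F 0 = 0" by (simp add: F_def)
  have "c = 0" using c[of 0] F0 by simp
  hence "F (- z) = - F z" for z using c[of z] by (simp add: eq_neg_iff_add_eq_0 add.commute)
  from that[OF F F0 this] show thesis .
  qed
qed

text \<open>Weight 1/2 leads to a Bessel function of half-integral order, which is elementary. With
  w = csqrt z the exponent N w^2 + c / w^2 is (n w - e/w)^2 + K as well as (n w + e/w)^2 - K, where
  n^2 = N, e^2 = c and K = 2 n e. The derivatives of the two inner functions add up to 2 n, so a
  combination of error functions is an exact primitive.\<close>

theorem half_bessel_integral:
  fixes N c y T :: real
  assumes pos: "N > 0" "c > 0" "y > 0" "T > 0" and T: "c / N \<le> y\<^sup>2 + T\<^sup>2"
  shows "\<exists>I. ((\<lambda>t. exp (of_real N * Complex y t + of_real c / Complex y t) / csqrt (Complex y t)) has_integral I) {-T..T} \<and>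
    norm (I - of_real (2 * sqrt pi / sqrt N * cosh (2 * sqrt (N * c)))) \<le> 2 * sqrt pi / sqrt N * exp (N * y + c * y / (y\<^sup>2 + T\<^sup>2))"
proof -
  obtain F :: "complex \<Rightarrow> complex" where F: "\<And>z. (F has_field_derivative exp (z\<^sup>2)) (at z)" "F 0 = 0" and odd: "\<And>z. F (- z) = - F z"
    using erfi_exists by blast
  define n e where "n = complex_of_real (sqrt N)" and "e = complex_of_real (sqrt c)"
  define K where "K = 2 * sqrt (N * c)"
  have ne: "n \<noteq> 0" "e \<noteq> 0" "n\<^sup>2 = of_real N" "e\<^sup>2 = of_real c" "2 * (n * e) = of_real K"
    using pos by (simp_all add: n_def e_def K_def real_sqrt_mult flip: of_real_power)
  define U V where "U = (\<lambda>w. n * w - e / w)" and "V = (\<lambda>w. n * w + e / w)"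
  define \<Omega> where "\<Omega> = (\<lambda>z. (exp (of_real K) * F (U (csqrt z)) + exp (- of_real K) * F (V (csqrt z))) / n)"
  have U2: "(U w)\<^sup>2 = of_real N * w\<^sup>2 + of_real c / w\<^sup>2 - of_real K" and V2: "(V w)\<^sup>2 = of_real N * w\<^sup>2 + of_real c / w\<^sup>2 + of_real K"
    if "w \<noteq> 0" for w
    using that unfolding U_def V_def ne(3-5)[symmetric] by (simp_all add: power2_eq_square field_simps)
  have \<Omega>': "(\<Omega> has_field_derivative exp (of_real N * z + of_real c / z) / csqrt z) (at z)" if z: "Re z > 0" for z
  proof -
    define w where "w = csqrt z"
    have z0: "z \<noteq> 0" "z \<notin> \<real>\<^sub>\<le>\<^sub>0" using z by (auto simp: complex_nonpos_Reals_iff)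
    hence w0: "w \<noteq> 0" by (simp add: w_def)
    have w2: "w\<^sup>2 = z" by (simp add: w_def)
    have dF: "((\<lambda>z. F (g z)) has_field_derivative exp ((g z)\<^sup>2) * g') (at z)" if "(g has_field_derivative g') (at z)" for g g'
      using DERIV_chain2[OF F(1) that] .
    have dU: "((\<lambda>z. U (csqrt z)) has_field_derivative (n + e / w\<^sup>2) / (2 * w)) (at z)"
      unfolding U_def using z0 w0 by (auto intro!: derivative_eq_intros simp: w_def[symmetric] field_simps power2_eq_square)
    have dV: "((\<lambda>z. V (csqrt z)) has_field_derivative (n - e / w\<^sup>2) / (2 * w)) (at z)"
      unfolding V_def using z0 w0 by (auto intro!: derivative_eq_intros simp: w_def[symmetric] field_simps power2_eq_square)
    define Q where "Q = exp (of_real N * z + of_real c / z)"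
    have eU: "exp (of_real K) * exp ((U w)\<^sup>2) = Q" and eV: "exp (- of_real K) * exp ((V w)\<^sup>2) = Q"
      using U2[OF w0] V2[OF w0] unfolding w2 Q_def by (simp_all flip: exp_add)
    have "(\<Omega> has_field_derivative (exp (of_real K) * (exp ((U w)\<^sup>2) * ((n + e / w\<^sup>2) / (2 * w))) +
        exp (- of_real K) * (exp ((V w)\<^sup>2) * ((n - e / w\<^sup>2) / (2 * w)))) / n) (at z)"
      unfolding \<Omega>_def using dF[OF dU] dF[OF dV] unfolding w_def[symmetric]
      by (intro DERIV_cdivide DERIV_add DERIV_cmult)
    also have "(exp (of_real K) * (exp ((U w)\<^sup>2) * ((n + e / w\<^sup>2) / (2 * w))) +
        exp (- of_real K) * (exp ((V w)\<^sup>2) * ((n - e / w\<^sup>2) / (2 * w)))) / n =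
        Q * ((n + e / w\<^sup>2) / (2 * w) + (n - e / w\<^sup>2) / (2 * w)) / n"
      unfolding mult.assoc[symmetric] eU eV by (simp add: algebra_simps)
    also have "(n + e / w\<^sup>2) / (2 * w) + (n - e / w\<^sup>2) / (2 * w) = n / w" using w0 by (simp add: field_simps)
    also have "Q * (n / w) / n = Q / w" using ne by simp
    finally show ?thesis by (simp add: Q_def w_def)
  qed
  \<comment> \<open>Division by \<open>\<i>\<close> accounts for dz = i dt on the vertical
    segment.\<close>
  define I where "I = \<Omega> (Complex y T) / \<i> - \<Omega> (Complex y (- T)) / \<i>"
  have int: "((\<lambda>t. exp (of_real N * Complex y t + of_real c / Complex y t) / csqrt (Complex y t)) has_integral I) {-T..T}"
    unfolding I_def
  proof (rule fundamental_theorem_of_calculus[where f = "\<lambda>t. \<Omega> (Complex y t) / \<i>"])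
    show "- T \<le> T" using pos by simp
    fix t :: real
    have "(\<lambda>t. Complex y t) = (\<lambda>t. of_real y + \<i> * of_real t)" by (rule ext) (simp add: complex_eq_iff)
    moreover have "((\<lambda>t. of_real y + \<i> * of_real t) has_vector_derivative \<i>) (at t within {-T..T})"
      by (auto intro!: derivative_eq_intros has_vector_derivative_of_real)
    ultimately have "((\<lambda>t. Complex y t) has_vector_derivative \<i>) (at t within {-T..T})" by simp
    from field_vector_diff_chain_within[OF this has_field_derivative_at_within[OF \<Omega>']]
    have "((\<lambda>t. \<Omega> (Complex y t)) has_vector_derivative \<i> * (exp (of_real N * Complex y t + of_real c / Complex y t) / csqrt (Complex y t))) (at t within {-T..T})"
      using pos by (simp add: o_def)
    from has_vector_derivative_mult_left[OF this, of "1 / \<i>"]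
    show "((\<lambda>t. \<Omega> (Complex y t) / \<i>) has_vector_derivative (exp (of_real N * Complex y t + of_real c / Complex y t) / csqrt (Complex y t))) (at t within {-T..T})"
      by (simp add: field_simps)
  qed
  define Z where "Z = Complex y T"
  define w where "w = csqrt Z"
  have Z: "Re Z > 0" "Im Z > 0" using pos by (auto simp: Z_def)
  hence Z0: "Z \<noteq> 0" "Z \<notin> \<real>\<^sub>\<le>\<^sub>0" by (auto simp: complex_nonpos_Reals_iff)
  have w2: "w\<^sup>2 = Z" by (simp add: w_def)
  have w0: "w \<noteq> 0" using Z0 by (simp add: w_def)
  have cw: "csqrt (Complex y (- T)) = cnj w"
  proof -
    have "Complex y (- T) = cnj Z" by (simp add: Z_def complex_eq_iff)
    thus ?thesis using Z0 by (simp add: w_def cnj_csqrt)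
  qed
  have Imw: "Im w > 0"
  proof -
    have "2 * Re w * Im w = Im Z" unfolding w2[symmetric] by (simp add: power2_eq_square)
    moreover have "Re w \<ge> 0" unfolding w_def using Re_csqrt by simp
    moreover have "2 * Re w * Im w \<le> 0" if "Im w \<le> 0" using that \<open>Re w \<ge> 0\<close> by (intro mult_nonneg_nonpos) auto
    ultimately show ?thesis using Z by linarith
  qed
  have nw: "(norm w)\<^sup>2 = norm Z" by (simp add: w2 flip: norm_power)
  have nZ: "(norm Z)\<^sup>2 = y\<^sup>2 + T\<^sup>2" unfolding cmod_power2 by (simp add: Z_def)
  have ImU: "Im (U w) = Im w * (sqrt N + sqrt c / norm Z)" and ImV: "Im (V w) = Im w * (sqrt N - sqrt c / norm Z)"
  proof -
    have "Im (e / w) = - (sqrt c * Im w / (norm w)\<^sup>2)" by (simp add: e_def Im_divide cmod_power2)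
    thus "Im (U w) = Im w * (sqrt N + sqrt c / norm Z)" "Im (V w) = Im w * (sqrt N - sqrt c / norm Z)"
      by (simp_all add: U_def V_def n_def nw algebra_simps)
  qed
  have U0: "Im (U w) \<ge> 0" unfolding ImU using Imw pos by (intro mult_nonneg_nonneg add_nonneg_nonneg) auto
  \<comment> \<open>The hypothesis \<open>c / N \<le> y\<^sup>2 + T\<^sup>2\<close> says that |Z| is
    at least sqrt(c/N). It places V(w) in the closed upper half-plane, as required by
    \<open>erfi_tail\<close>; for U(w) this is automatic.\<close>
  have V0: "Im (V w) \<ge> 0"
  proof -
    have "sqrt (c / N) \<le> sqrt ((norm Z)\<^sup>2)" using T unfolding nZ by simp
    hence "sqrt c / sqrt N \<le> norm Z" by (simp add: real_sqrt_divide)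
    hence "sqrt c / norm Z \<le> sqrt N" using pos Z0 by (simp add: field_simps)
    thus ?thesis unfolding ImV using Imw by simp
  qed
  have UVc: "U (cnj w) = cnj (U w)" "V (cnj w) = cnj (V w)" by (simp_all add: U_def V_def n_def e_def)
  define H where "H = N * y + c * y / (y\<^sup>2 + T\<^sup>2)"
  have ReH: "Re (of_real N * Z + of_real c / Z) = H"
    unfolding H_def nZ[symmetric] by (simp add: Re_divide Z_def cmod_power2)
  have ReU: "Re ((U w)\<^sup>2) = H - K" and ReV: "Re ((V w)\<^sup>2) = H + K"
    using U2[OF w0] V2[OF w0] ReH unfolding w2 by simp_all
  define g where "g = \<i> * complex_of_real (sqrt pi / 2)"
  have b1: "norm (F (U w) - g) \<le> sqrt pi / 2 * exp (H - K)" "norm (F (V w) - g) \<le> sqrt pi / 2 * exp (H + K)"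
    using erfi_tail[OF F U0] erfi_tail[OF F V0] unfolding g_def ReU ReV by blast+
  have tail2: "norm (F (cnj v) + g) \<le> sqrt pi / 2 * exp (Re (v\<^sup>2))" if "Im v \<ge> 0" for v
  proof -
    have "norm (F (- cnj v) - g) \<le> sqrt pi / 2 * exp (Re ((- cnj v)\<^sup>2))"
      unfolding g_def by (rule erfi_tail[OF F]) (use that in simp)
    moreover have "Re ((- cnj v)\<^sup>2) = Re (v\<^sup>2)" by (simp add: power2_eq_square)
    moreover have "norm (F (- cnj v) - g) = norm (F (cnj v) + g)"
    proof -
      have "F (- cnj v) - g = - (F (cnj v) + g)" unfolding odd by simp
      thus ?thesis by (simp only: norm_minus_cancel)
    qed
    ultimately show ?thesis by simp
  qed
  have b2: "norm (F (cnj (U w)) + g) \<le> sqrt pi / 2 * exp (H - K)" "norm (F (cnj (V w)) + g) \<le> sqrt pi / 2 * exp (H + K)"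
    using tail2[OF U0] tail2[OF V0] unfolding ReU ReV by blast+
  define A B where "A = complex_of_real (exp K)" and "B = complex_of_real (exp (- K))"
  have I_eq: "I = (A * (F (U w) - F (cnj (U w))) + B * (F (V w) - F (cnj (V w)))) / (n * \<i>)"
  proof -
    have "I = ((A * F (U w) + B * F (V w)) - (A * F (cnj (U w)) + B * F (cnj (V w)))) / (n * \<i>)"
      unfolding I_def \<Omega>_def cw Z_def[symmetric] w_def[symmetric] UVc
      by (simp only: A_def B_def exp_of_real[symmetric] of_real_minus diff_divide_distrib divide_divide_eq_left)
    thus ?thesis by (simp add: algebra_simps)
  qed
  have main: "of_real (2 * sqrt pi / sqrt N * cosh K) = (A * (2 * g) + B * (2 * g)) / (n * \<i>)"
  proof -
    have AB: "A + B = of_real (2 * cosh K)" by (simp add: A_def B_def cosh_field_def)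
    have "A * (2 * g) + B * (2 * g) = ((A + B) * of_real (sqrt pi)) * \<i>" by (simp add: g_def algebra_simps)
    hence "(A * (2 * g) + B * (2 * g)) / (n * \<i>) = ((A + B) * of_real (sqrt pi)) / n" by simp
    also have "\<dots> = of_real (2 * sqrt pi / sqrt N * cosh K)" unfolding AB by (simp add: n_def)
    finally show ?thesis ..
  qed
  have "I - of_real (2 * sqrt pi / sqrt N * cosh K) =
     (A * (F (U w) - g) - A * (F (cnj (U w)) + g) + (B * (F (V w) - g) - B * (F (cnj (V w)) + g))) / (n * \<i>)"
    unfolding I_eq main diff_divide_distrib[symmetric] by (simp add: algebra_simps)
  also have "norm \<dots> = norm (A * (F (U w) - g) - A * (F (cnj (U w)) + g) + (B * (F (V w) - g) - B * (F (cnj (V w)) + g))) / sqrt N"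
    using pos by (simp add: norm_divide norm_mult n_def)
  also have "\<dots> \<le> (4 * (sqrt pi / 2 * exp H)) / sqrt N"
  proof (intro divide_right_mono)
    \<comment> \<open>The weights e^K and e^(-K) exactly compensate the exponents H - K and H + K,
      so all four tails have the same size.\<close>
    have k: "exp K * (sqrt pi / 2 * exp (H - K)) = sqrt pi / 2 * exp H" "exp (- K) * (sqrt pi / 2 * exp (H + K)) = sqrt pi / 2 * exp H"
      by (simp_all add: exp_diff exp_add exp_minus)
    have m: "norm (A * a) \<le> sqrt pi / 2 * exp H" if "norm a \<le> sqrt pi / 2 * exp (H - K)" for a
      unfolding k(1)[symmetric] norm_mult using that by (intro mult_mono) (auto simp: A_def)
    have m': "norm (B * a) \<le> sqrt pi / 2 * exp H" if "norm a \<le> sqrt pi / 2 * exp (H + K)" for a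
      unfolding k(2)[symmetric] norm_mult using that by (intro mult_mono) (auto simp: B_def)
    have "norm (A * (F (U w) - g) - A * (F (cnj (U w)) + g) + (B * (F (V w) - g) - B * (F (cnj (V w)) + g))) \<le>
       (norm (A * (F (U w) - g)) + norm (A * (F (cnj (U w)) + g))) + (norm (B * (F (V w) - g)) + norm (B * (F (cnj (V w)) + g)))"
      by (intro order_trans[OF norm_triangle_ineq] add_mono norm_triangle_ineq4)
    also have "\<dots> \<le> (sqrt pi / 2 * exp H + sqrt pi / 2 * exp H) + (sqrt pi / 2 * exp H + sqrt pi / 2 * exp H)"
      by (intro add_mono m m' b1 b2)
    finally show "norm (A * (F (U w) - g) - A * (F (cnj (U w)) + g) + (B * (F (V w) - g) - B * (F (cnj (V w)) + g))) \<le> 4 * (sqrt pi / 2 * exp H)"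
      by simp
  qed (use pos in auto)
  finally have "norm (I - of_real (2 * sqrt pi / sqrt N * cosh K)) \<le> 2 * sqrt pi / sqrt N * exp H" by simp
  thus ?thesis using int unfolding K_def H_def by blast
qed

subsection \<open>Coefficient estimates\<close>

lemma has_integral_exp_int:
  fixes m :: int
  shows "((\<lambda>t. exp (of_int m * Complex y t)) has_integral (if m = 0 then of_real (2 * pi) else 0)) {-pi..pi}"
proof (cases "m = 0")
  case True
  have "((\<lambda>t::real. 1::complex) has_integral of_real (pi - - pi) * 1) {-pi..pi}"
    using has_integral_const_real[of "1::complex" "-pi" pi] by (simp add: scaleR_conv_of_real)
  thus ?thesis using True by simp
next
  case False
  define G where "G = (\<lambda>t. exp (of_int m * Complex y t) / (\<i> * of_int m))"
  have "((\<lambda>t. exp (of_int m * Complex y t)) has_integral (G pi - G (- pi))) {-pi..pi}"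
  proof (rule fundamental_theorem_of_calculus)
    fix t :: real
    have C: "(\<lambda>t. Complex y t) = (\<lambda>t. of_real y + \<i> * of_real t)" by (rule ext) (simp add: complex_eq_iff)
    have "((\<lambda>t. Complex y t) has_vector_derivative \<i>) (at t within {-pi..pi})"
      unfolding C by (auto intro!: derivative_eq_intros has_vector_derivative_of_real)
    moreover have "((\<lambda>z. exp (of_int m * z) / (\<i> * of_int m)) has_field_derivative (exp (of_int m * Complex y t) / \<i>))
        (at (Complex y t) within (\<lambda>t. Complex y t) ` {-pi..pi})"
      using False by (auto intro!: derivative_eq_intros)
    ultimately have "(((\<lambda>z. exp (of_int m * z) / (\<i> * of_int m)) \<circ> (\<lambda>t. Complex y t)) has_vector_derivative \<i> * (exp (of_int m * Complex y t) / \<i>)) (at t within {-pi..pi})"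
      by (rule field_vector_diff_chain_within)
    thus "(G has_vector_derivative exp (of_int m * Complex y t)) (at t within {-pi..pi})"
      by (simp add: G_def o_def)
  qed auto
  moreover have "G pi = G (- pi)"
  proof -
    have "of_int m * Complex y pi = of_int m * Complex y (- pi) + of_int (2 * m) * (of_real pi * \<i>)"
      by (simp add: complex_eq_iff)
    moreover have "exp (of_int (2 * m) * (of_real pi * \<i>)) = 1"
      by (simp add: exp_eq_1 mult_ac)
    ultimately show ?thesis unfolding G_def by (simp only: exp_add mult_1_right)
  qed
  ultimately show ?thesis using False by simp
qed

text \<open>Cauchy's coefficient formula on the circle of radius e^(-y), written in the angle: the
  powers are orthogonal and the series converges uniformly on the circle.\<close>

lemma coefficient_has_integral:
  fixes c :: "nat \<Rightarrow> complex"
  assumes h: "\<And>x. norm x < 1 \<Longrightarrow> (\<lambda>k. c k * x ^ k) sums h x" and y: "y > 0"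
  shows "((\<lambda>t. h (exp (- Complex y t)) * exp (of_nat n * Complex y t)) has_integral (of_real (2 * pi) * c n)) {-pi..pi}"
proof -
  define r where "r = exp (- y)"
  have r: "0 < r" "r < 1" using y by (auto simp: r_def)
  define f where "f = (\<lambda>k t. c k * exp (of_int (int n - int k) * Complex y t))"
  have f_eq: "f k t = c k * exp (- Complex y t) ^ k * exp (of_nat n * Complex y t)" for k t
    unfolding f_def exp_of_nat_mult[symmetric] mult.assoc exp_add[symmetric] by (simp add: algebra_simps)
  have "summable (\<lambda>k. norm (c k * of_real r ^ k))"
  proof (rule powser_insidea)
    \<comment> \<open>Convergence at a radius strictly between r and 1 gives absolute convergence at
      r.\<close>
    define r' where "r' = (1 + r) / 2"
    have r': "0 < r'" "r' < 1" "r < r'" using r by (simp_all add: r'_def)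
    hence "norm (complex_of_real r') < 1" by simp
    from sums_summable[OF h[OF this]] show "summable (\<lambda>k. c k * of_real r' ^ k)" .
    show "norm (complex_of_real r) < norm (complex_of_real r')" using r r' by simp
  qed
  hence summ: "summable (\<lambda>k. norm (c k) * r ^ k * exp (real n * y))"
    using r by (intro summable_mult2) (simp add: norm_mult norm_power)
  have "uniform_limit (cbox (-pi) pi) (\<lambda>K t. \<Sum>k<K. f k t) (\<lambda>t. \<Sum>k. f k t) sequentially"
  proof (rule Weierstrass_m_test[OF _ summ])
    fix k t
    have "norm (exp (- Complex y t)) = r" by (simp add: r_def)
    thus "norm (f k t) \<le> norm (c k) * r ^ k * exp (real n * y)"
      unfolding f_eq norm_mult norm_power by simp
  qed
  then obtain I J where IJ: "\<And>K. ((\<lambda>t. \<Sum>k<K. f k t) has_integral I K) (cbox (-pi) pi)"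
     "((\<lambda>t. \<Sum>k. f k t) has_integral J) (cbox (-pi) pi)" "I \<longlonglongrightarrow> J"
  proof (rule uniform_limit_integral_cbox)
    have C: "(\<lambda>t. Complex y t) = (\<lambda>t. of_real y + \<i> * of_real t)" by (rule ext) (simp add: complex_eq_iff)
    show "continuous_on (cbox (-pi) pi) (\<lambda>t. \<Sum>k<K. f k t)" for K
      unfolding f_def C by (intro continuous_intros)
  qed auto
  have "I K = of_real (2 * pi) * c n" if "K > n" for K
  proof -
    have "((\<lambda>t. \<Sum>k<K. f k t) has_integral (\<Sum>k<K. c k * (if int n - int k = 0 then of_real (2 * pi) else 0))) {-pi..pi}"
      unfolding f_def by (intro has_integral_sum has_integral_mult_right has_integral_exp_int) auto
    moreover have c: "(\<Sum>k<K. c k * (if int n - int k = 0 then of_real (2 * pi) else 0)) = of_real (2 * pi) * c n"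
    proof -
      have "(\<Sum>k<K. c k * (if int n - int k = 0 then of_real (2 * pi) else 0)) = (\<Sum>k<K. if k = n then c n * of_real (2 * pi) else 0)"
        by (rule sum.cong) auto
      also have "\<dots> = of_real (2 * pi) * c n" using that by simp
      finally show ?thesis .
    qed
    ultimately show ?thesis using has_integral_unique[OF IJ(1)[of K]] unfolding cbox_interval c by blast
  qed
  hence "\<forall>\<^sub>F K in sequentially. I K = of_real (2 * pi) * c n"
    using eventually_gt_at_top[of n] by (rule eventually_mono[rotated])
  hence "I \<longlonglongrightarrow> of_real (2 * pi) * c n" by (rule tendsto_eventually)
  hence "J = of_real (2 * pi) * c n" using IJ(3) LIMSEQ_unique by blast
  moreover have "(\<Sum>k. f k t) = h (exp (- Complex y t)) * exp (of_nat n * Complex y t)" for t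
  proof -
    have "norm (exp (- Complex y t)) < 1" using y by simp
    from sums_mult2[OF h[OF this], of "exp (of_nat n * Complex y t)"] show ?thesis
      unfolding f_eq[symmetric] by (simp add: sums_iff)
  qed
  ultimately show ?thesis using IJ(2) by simp
qed

section \<open>Assembly of the asymptotic formula\<close>

theorem alpha_asymptotic:
  fixes n :: nat
  assumes n: "n \<ge> 1"
  defines "d \<equiv> 24 * real n - 1"
  shows "\<bar>(-1) ^ n * real_of_int (\<alpha> n) + sqrt 6 / sqrt d * exp (pi * sqrt d / 12)\<bar> \<le> 100 * d\<^sup>2 * exp (pi * sqrt d / 18)"
proof -
  have d: "d \<ge> 23" using n by (simp add: d_def)
  define s where "s = sqrt d"
  have s2: "s * s = d" using d by (simp add: s_def)
  \<comment> \<open>A decimal lower bound for sqrt 23, the value at n = 1; it is large enough to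
    force y <= 0.44 for all n.\<close>
  have s: "s \<ge> 4.795"
  proof -
    have "4.795\<^sup>2 \<le> d" using d by (simp add: power2_eq_square)
    thus ?thesis unfolding s_def by (rule real_le_rsqrt)
  qed
  \<comment> \<open>This choice makes d y / 24 and pi^2 / (54 y) both equal to
    \<open>\<Lambda>\<close>, and 2 \<Lambda> = pi s / 18 is the exponent l(n)/3.\<close>
  define y where "y = 2 * pi / (3 * s)"
  define T where "T = 6 * y"
  define \<Lambda> where "\<Lambda> = pi * s / 36"
  have y: "0 < y" using s by (simp add: y_def)
  have y44: "y \<le> 0.44"
  proof -
    have "pi \<le> 3.1416" using pi_approx by simp
    hence "2 * pi \<le> 0.44 * (3 * s)" using s by simp
    thus ?thesis using s by (simp add: y_def pos_divide_le_eq)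
  qed
  have Tpi: "T < pi" using y44 pi_gt3 by (simp add: T_def)
  have T0: "T > 0" using y by (simp add: T_def)
  have \<Lambda>1: "pi\<^sup>2 / (54 * y) = \<Lambda>" using s by (simp add: y_def \<Lambda>_def power2_eq_square field_simps)
  have \<Lambda>2: "d / 24 * y = \<Lambda>" using s by (simp add: y_def \<Lambda>_def s2[symmetric] field_simps)
  \<comment> \<open>As n = d/24 + 1/24, replacing n by d/24 costs only the factor exp(y/24).\<close>
  have ny: "exp (real n * y) \<le> 2 * exp \<Lambda>"
  proof -
    have "real n * y = \<Lambda> + y / 24" unfolding \<Lambda>2[symmetric] by (simp add: d_def field_simps)
    moreover have "exp (y / 24) \<le> 2"
    proof -
      have "exp (y / 24) \<le> 1 + y / 24 + (y / 24)\<^sup>2" using y y44 by (intro exp_bound) auto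
      also have "(y / 24)\<^sup>2 \<le> y / 24" using y y44 by (simp add: power2_eq_square mult_left_le)
      finally show ?thesis using y44 by simp
    qed
    ultimately show ?thesis by (simp add: exp_add mult.commute)
  qed
  define e where "e = exp \<Lambda>"
  have e1: "e \<ge> 1" using s by (simp add: e_def \<Lambda>_def)
  define h where "h = (\<lambda>x. 2 * phi3 x - theta_weber x)"
  define c where "c = (\<lambda>k. of_int (\<alpha> k) * (-1) ^ k :: complex)"
  have hsums: "(\<lambda>k. c k * x ^ k) sums h x" if "norm x < 1" for x
    using alpha_generating_function[OF that] unfolding c_def h_def
    by (simp add: power_minus[of x] mult.assoc)
  define z where "z = (\<lambda>t. Complex y t)"
  define ex where "ex = (\<lambda>t. exp (of_nat n * z t))"
  define f where "f = (\<lambda>t. h (exp (- z t)) * ex t)"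
  have f: "(f has_integral (of_real (2 * pi) * c n)) {-pi..pi}"
    unfolding f_def ex_def z_def by (rule coefficient_has_integral[OF hsums y])
  have nex: "norm (ex t) \<le> 2 * e" for t using ny by (simp add: ex_def z_def e_def)
  have phi: "norm (phi3 (exp (- z t))) \<le> 3 / y * e" for t
    using norm_phi3_le[OF y y44, of "exp (- z t)"] by (simp add: z_def \<Lambda>1 e_def)
  \<comment> \<open>The constant is 172 = 2 * (6 + 80): 6 from twice the bound for phi, 80 from the
    error of the inversion near the real axis, and the factor 2 from \<open>ny\<close>. The far arc
    would need only 20.\<close>
  define B where "B = 172 / y * e\<^sup>2"
  have B0: "B \<ge> 0" using y by (simp add: B_def)
  have far: "norm (f t) \<le> B" if "T \<le> \<bar>t\<bar>" "\<bar>t\<bar> \<le> pi" for t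
  proof -
    have "norm (theta_weber (exp (- z t))) \<le> 4 / y * e"
      using theta_weber_far[OF y y44, of t] that unfolding z_def T_def \<Lambda>1 e_def by simp
    hence "norm (h (exp (- z t))) \<le> 2 * (3 / y * e) + 4 / y * e"
      unfolding h_def using phi[of t] norm_triangle_ineq4[of "2 * phi3 (exp (- z t))" "theta_weber (exp (- z t))"]
      by (simp add: norm_mult)
    hence "norm (f t) \<le> (2 * (3 / y * e) + 4 / y * e) * (2 * e)"
      unfolding f_def norm_mult using nex[of t] y e1 by (intro mult_mono) auto
    also have "\<dots> = 20 / y * e\<^sup>2" by (simp add: power2_eq_square field_simps)
    also have "\<dots> \<le> B" unfolding B_def using y by (intro mult_right_mono divide_right_mono) auto
    finally show ?thesis .
  qed
  \<comment> \<open>The Weber part enters \<open>h\<close> with a minus sign, so the main term is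
    removed by adding \<open>g\<close>.\<close>
  define g where "g = (\<lambda>t. main_arc (z t) * ex t)"
  have near: "norm (f t + g t) \<le> B" if "\<bar>t\<bar> \<le> T" for t
  proof -
    have "norm (theta_weber (exp (- z t)) - main_arc (z t)) \<le> 20 * sqrt (pi / y)"
      using theta_weber_near[OF y y44, of t] that unfolding z_def T_def by simp
    also have "sqrt (pi / y) \<le> 4 / y"
    proof -
      have "1 \<le> pi / y" using y y44 pi_gt3 by simp
      hence "sqrt (pi / y) * 1 \<le> sqrt (pi / y) * sqrt (pi / y)" by (intro mult_left_mono) auto
      also have "\<dots> = pi / y" using y by simp
      also have "\<dots> \<le> 4 / y" using pi_less_4 y by (intro divide_right_mono) auto
      finally show ?thesis by simp
    qed
    finally have w: "norm (theta_weber (exp (- z t)) - main_arc (z t)) \<le> 80 / y" by simp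
    have "f t + g t = (2 * phi3 (exp (- z t)) - (theta_weber (exp (- z t)) - main_arc (z t))) * ex t"
      by (simp add: f_def g_def h_def algebra_simps)
    moreover have "norm (2 * phi3 (exp (- z t)) - (theta_weber (exp (- z t)) - main_arc (z t))) \<le> 2 * (3 / y * e) + 80 / y"
      using phi[of t] w norm_triangle_ineq4[of "2 * phi3 (exp (- z t))" "theta_weber (exp (- z t)) - main_arc (z t)"]
      by (simp add: norm_mult)
    ultimately have "norm (f t + g t) \<le> (2 * (3 / y * e) + 80 / y) * (2 * e)"
      using nex[of t] y e1 by (simp only: norm_mult) (intro mult_mono, auto)
    also have "\<dots> \<le> (2 * (3 / y * e) + 80 / y * e) * (2 * e)"
    proof (intro mult_right_mono add_left_mono)
      have "80 / y * 1 \<le> 80 / y * e" using y e1 by (intro mult_left_mono) auto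
      thus "80 / y \<le> 80 / y * e" by simp
    qed (use e1 in auto)
    also have "\<dots> = B" by (simp add: B_def power2_eq_square field_simps)
    finally show ?thesis .
  qed
  \<comment> \<open>The factor exp(- z / 24) of the multiplier shifts n to n - 1/24 = d/24; this is
    how |D_n| enters in place of n.\<close>
  define N where "N = d / 24"
  have N: "N > 0" using d by (simp add: N_def)
  have TN: "pi\<^sup>2 / 24 / N \<le> y\<^sup>2 + T\<^sup>2"
  proof -
    have "y\<^sup>2 = 4 * pi\<^sup>2 / (9 * d)" by (simp add: y_def power_divide power_mult_distrib power2_eq_square s2[symmetric])
    moreover have "pi\<^sup>2 / 24 / N = pi\<^sup>2 / d" by (simp add: N_def)
    moreover have "pi\<^sup>2 / d \<le> 37 * (4 * pi\<^sup>2 / (9 * d))" using d by (simp add: field_simps)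
    moreover have "y\<^sup>2 + T\<^sup>2 = 37 * y\<^sup>2" by (simp add: T_def power_mult_distrib)
    ultimately show ?thesis by simp
  qed
  have "pi\<^sup>2 / 24 > 0" by simp
  from half_bessel_integral[OF N this y T0 TN] obtain I where
    I: "((\<lambda>t. exp (of_real N * Complex y t + of_real (pi\<^sup>2 / 24) / Complex y t) / csqrt (Complex y t)) has_integral I) {-T..T}"
    and I_le: "norm (I - of_real (2 * sqrt pi / sqrt N * cosh (2 * sqrt (N * (pi\<^sup>2 / 24))))) \<le> 2 * sqrt pi / sqrt N * exp (N * y + pi\<^sup>2 / 24 * y / (y\<^sup>2 + T\<^sup>2))"
    by blast
  have K: "2 * sqrt (N * (pi\<^sup>2 / 24)) = pi * s / 12"
  proof -
    have "N * (pi\<^sup>2 / 24) = (pi * s / 24)\<^sup>2" by (simp add: N_def power2_eq_square s2[symmetric])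
    hence "sqrt (N * (pi\<^sup>2 / 24)) = pi * s / 24" using s by (simp only: real_sqrt_abs) simp
    thus ?thesis by simp
  qed
  \<comment> \<open>At the ends of the arc the second exponent is only pi^2 / (888 y), where 888 =
    24 * 37.\<close>
  have expo: "N * y + pi\<^sup>2 / 24 * y / (y\<^sup>2 + T\<^sup>2) \<le> \<Lambda> + \<Lambda>"
  proof (intro add_mono)
    show "N * y \<le> \<Lambda>" using \<Lambda>2 by (simp add: N_def)
    have "y\<^sup>2 + T\<^sup>2 = 37 * y * y" by (simp add: T_def power_mult_distrib power2_eq_square)
    hence "pi\<^sup>2 / 24 * y / (y\<^sup>2 + T\<^sup>2) = pi\<^sup>2 / (888 * y)" using y by simp
    also have "\<dots> \<le> pi\<^sup>2 / (54 * y)" using y by (intro divide_left_mono) auto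
    finally show "pi\<^sup>2 / 24 * y / (y\<^sup>2 + T\<^sup>2) \<le> \<Lambda>" unfolding \<Lambda>1 .
  qed
  have g: "(g has_integral (of_real (sqrt pi) * I)) {-T..T}"
  proof -
    have "g = (\<lambda>t. of_real (sqrt pi) * (exp (of_real N * Complex y t + of_real (pi\<^sup>2 / 24) / Complex y t) / csqrt (Complex y t)))"
    proof
      fix t
      have "- z t / 24 + of_nat n * z t = of_real N * z t" by (simp add: N_def d_def field_simps)
      hence "exp (- z t / 24) * exp (of_nat n * z t) = exp (of_real N * z t)" by (simp only: exp_add[symmetric])
      moreover have "of_real (pi\<^sup>2) / (24 * z t) = of_real (pi\<^sup>2 / 24) / z t" by simp
      ultimately show "g t = of_real (sqrt pi) * (exp (of_real N * Complex y t + of_real (pi\<^sup>2 / 24) / Complex y t) / csqrt (Complex y t))"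
        unfolding g_def main_arc_def ex_def z_def[symmetric] exp_add by (simp add: mult_ac)
    qed
    thus ?thesis using has_integral_mult_right[OF I] by simp
  qed
  have f_int: "f integrable_on {a..b}" if "{a..b} \<subseteq> {-pi..pi}" for a b
    using integrable_on_subinterval[OF has_integral_integrable[OF f]] that by blast
  define I1 I2 I3 where "I1 = integral {-pi..-T} f" and "I2 = integral {-T..T} f" and "I3 = integral {T..pi} f"
  have h1: "(f has_integral I1) {-pi..-T}" and h2: "(f has_integral I2) {-T..T}" and h3: "(f has_integral I3) {T..pi}"
    unfolding I1_def I2_def I3_def using T0 Tpi by (auto intro!: integrable_integral f_int)
  have "(f has_integral (I1 + I2 + I3)) {-pi..pi}"
  proof (rule has_integral_combine[of "-pi" T])
    show "(f has_integral (I1 + I2)) {-pi..T}"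
      by (rule has_integral_combine[of "-pi" "-T"]) (use h1 h2 T0 Tpi in auto)
  qed (use h3 T0 Tpi in auto)
  hence tot: "of_real (2 * pi) * c n = I1 + I2 + I3" using f has_integral_unique by blast
  have b1: "norm I1 \<le> B * (pi - T)"
    using has_integral_bound_real[OF B0 _ h1, of "{}"] far T0 Tpi by (auto simp: abs_if)
  have b3: "norm I3 \<le> B * (pi - T)"
    using has_integral_bound_real[OF B0 _ h3, of "{}"] far T0 Tpi by (auto simp: abs_if)
  have b2: "norm (I2 + of_real (sqrt pi) * I) \<le> B * (2 * T)"
    using has_integral_bound_real[OF B0 _ has_integral_add[OF h2 g], of "{}"] near T0 Tpi by (auto simp: abs_if)
  have "norm (of_real (2 * pi) * c n + of_real (sqrt pi) * I) \<le> norm I1 + norm (I2 + of_real (sqrt pi) * I) + norm I3"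
  proof -
    have "of_real (2 * pi) * c n + of_real (sqrt pi) * I = (I1 + (I2 + of_real (sqrt pi) * I)) + I3"
      unfolding tot by simp
    thus ?thesis by (simp only:) (intro order_trans[OF norm_triangle_ineq] add_right_mono norm_triangle_ineq)
  qed
  \<comment> \<open>The two outer arcs and the inner arc have total length 2 pi, so \<open>T\<close>
    drops out.\<close>
  also have "\<dots> \<le> B * (2 * pi)" using b1 b2 b3 by (simp add: algebra_simps)
  finally have m1: "norm (of_real (2 * pi) * c n + of_real (sqrt pi) * I) \<le> B * (2 * pi)" .
  have e2: "exp (\<Lambda> + \<Lambda>) = e\<^sup>2" unfolding e_def exp_add power2_eq_square ..
  define M where "M = cosh (pi * s / 12) / sqrt N"
  have m2: "norm (of_real (sqrt pi) * I - of_real (2 * pi * M)) \<le> 2 * pi * (e\<^sup>2 / sqrt N)"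
  proof -
    have "2 * sqrt pi / sqrt N * exp (N * y + pi\<^sup>2 / 24 * y / (y\<^sup>2 + T\<^sup>2)) \<le> 2 * sqrt pi / sqrt N * e\<^sup>2"
      using expo N unfolding e2[symmetric] by (intro mult_left_mono) auto
    hence "norm (I - of_real (2 * sqrt pi * M)) \<le> 2 * sqrt pi / sqrt N * e\<^sup>2"
      using I_le unfolding K M_def by simp
    hence "sqrt pi * norm (I - of_real (2 * sqrt pi * M)) \<le> sqrt pi * (2 * sqrt pi / sqrt N * e\<^sup>2)"
      by (intro mult_left_mono) auto
    also have "\<dots> = 2 * (sqrt pi * sqrt pi) * (e\<^sup>2 / sqrt N)" by simp
    also have "sqrt pi * norm (I - of_real (2 * sqrt pi * M)) = norm (of_real (sqrt pi) * (I - of_real (2 * sqrt pi * M)))"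
      by (simp add: norm_mult)
    also have "of_real (sqrt pi) * (I - of_real (2 * sqrt pi * M)) = of_real (sqrt pi) * I - of_real (2 * (sqrt pi * sqrt pi) * M)"
      by (simp only: right_diff_distrib of_real_mult mult_ac)
    finally show ?thesis by simp
  qed
  have "norm (of_real (2 * pi) * c n + of_real (2 * pi * M)) \<le> B * (2 * pi) + 2 * pi * (e\<^sup>2 / sqrt N)"
  proof -
    have "of_real (2 * pi) * c n + of_real (2 * pi * M) =
       (of_real (2 * pi) * c n + of_real (sqrt pi) * I) - (of_real (sqrt pi) * I - of_real (2 * pi * M))" by simp
    thus ?thesis using m1 m2 norm_triangle_ineq4 by (smt (verit, best))
  qed
  moreover have "of_real (2 * pi) * c n + of_real (2 * pi * M) = of_real (2 * pi * ((-1) ^ n * real_of_int (\<alpha> n) + M))"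
    by (simp add: c_def algebra_simps)
  ultimately have "2 * pi * \<bar>(-1) ^ n * real_of_int (\<alpha> n) + M\<bar> \<le> 2 * pi * (B + e\<^sup>2 / sqrt N)"
    by (simp only: norm_of_real abs_mult) (simp add: algebra_simps)
  hence m3: "\<bar>(-1) ^ n * real_of_int (\<alpha> n) + M\<bar> \<le> B + e\<^sup>2 / sqrt N" by (simp add: mult_le_cancel_left_pos)
  have sN: "sqrt N = s / sqrt 24" by (simp add: N_def s_def real_sqrt_divide)
  \<comment> \<open>The hyperbolic cosine splits into the main exponential and a decaying one that
    joins the error.\<close>
  have M: "M = sqrt 6 / s * exp (pi * s / 12) + sqrt 6 / s * exp (- (pi * s / 12))"
  proof -
    have "sqrt 24 = 2 * sqrt 6" using real_sqrt_mult[of 4 6] by simp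
    thus ?thesis by (simp add: M_def sN cosh_field_def add_divide_distrib distrib_left distrib_right mult_ac)
  qed
  have s24: "sqrt 24 \<le> 5" by (rule real_le_lsqrt) auto
  have s6: "sqrt 6 \<le> 3" by (rule real_le_lsqrt) auto
  have ee: "1 \<le> e\<^sup>2" using e1 by (simp add: one_le_power)
  have "s \<le> d"
  proof -
    have "s * 1 \<le> s * s" using s by (intro mult_left_mono) auto
    thus ?thesis using s2 by simp
  qed
  have r1: "B \<le> 86 * d * e\<^sup>2"
  proof -
    have "172 / y = 86 * (3 * s / pi)" using s by (simp add: y_def field_simps)
    also have "3 * s / pi \<le> 3 * s / 3" using pi_gt3 s by (intro divide_left_mono) auto
    also have "\<dots> \<le> d" using \<open>s \<le> d\<close> by simp
    finally have "172 / y \<le> 86 * d" by simp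
    thus ?thesis unfolding B_def by (intro mult_right_mono) auto
  qed
  have r2: "e\<^sup>2 / sqrt N \<le> 5 * e\<^sup>2"
  proof -
    have "e\<^sup>2 / sqrt N = e\<^sup>2 * (sqrt 24 / s)" by (simp add: sN)
    also have "\<dots> \<le> e\<^sup>2 * (5 / 1)" using s24 s by (intro mult_left_mono frac_le) auto
    finally show ?thesis by simp
  qed
  have r3: "\<bar>sqrt 6 / s * exp (- (pi * s / 12))\<bar> \<le> 3 * e\<^sup>2"
  proof -
    have "\<bar>sqrt 6 / s * exp (- (pi * s / 12))\<bar> = sqrt 6 / s * exp (- (pi * s / 12))" using s by (simp add: abs_mult)
    also have "\<dots> \<le> 3 / 1 * 1" using s6 s by (intro mult_mono frac_le) auto
    also have "\<dots> \<le> 3 * e\<^sup>2" using ee by simp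
    finally show ?thesis .
  qed
  have "\<bar>(-1) ^ n * real_of_int (\<alpha> n) + sqrt 6 / s * exp (pi * s / 12)\<bar> \<le>
      \<bar>(-1) ^ n * real_of_int (\<alpha> n) + M\<bar> + \<bar>sqrt 6 / s * exp (- (pi * s / 12))\<bar>"
    unfolding M by linarith
  also have "\<dots> \<le> (86 * d * e\<^sup>2 + 5 * e\<^sup>2) + 3 * e\<^sup>2" using m3 r1 r2 r3 by linarith
  also have "\<dots> = (86 * d + 8) * e\<^sup>2" by (simp add: algebra_simps)
  also have "\<dots> \<le> (100 * d\<^sup>2) * e\<^sup>2"
  proof (intro mult_right_mono)
    \<comment> \<open>The accumulated factor 86 d + 8 is only linear in d; d >= 23 allows it to be
      replaced by 100 d^2.\<close>
    have "23 * d \<le> d * d" using d by (intro mult_right_mono) auto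
    thus "86 * d + 8 \<le> 100 * d\<^sup>2" unfolding power2_eq_square using d by linarith
  qed auto
  also have "e\<^sup>2 = exp (pi * s / 18)" unfolding e2[symmetric] by (simp add: \<Lambda>_def)
  finally show ?thesis unfolding s_def .
qed

theorem theorem1p1:
  "\<exists>E :: nat \<Rightarrow> real. \<forall>n\<ge>1.
     real_of_int (\<alpha> n) =
       (-1) ^ (n + 1) * (sqrt 6 / sqrt (24 * real n - 1)) * exp (l n / 2) + E n \<and>
     \<bar>E n\<bar> < (4.30 * 10 ^ 23) * 2 powr q n * (real_of_int \<bar>D n\<bar>)\<^sup>2 * exp (l n / 3)"
proof (intro exI allI impI conjI)
  define main where "main = (\<lambda>n. (-1) ^ (n + 1) * (sqrt 6 / sqrt (24 * real n - 1)) * exp (l n / 2))"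
  fix n :: nat assume n: "n \<ge> 1"
  show "real_of_int (\<alpha> n) = (-1) ^ (n + 1) * (sqrt 6 / sqrt (24 * real n - 1)) * exp (l n / 2) +
      (\<lambda>n. real_of_int (\<alpha> n) - (-1) ^ (n + 1) * (sqrt 6 / sqrt (24 * real n - 1)) * exp (l n / 2)) n"
    by simp
  define d where "d = 24 * real n - 1"
  have d: "d \<ge> 23" using n by (simp add: d_def)
  have "\<bar>D n\<bar> = 24 * int n - 1" using n unfolding Defs.D_def by linarith
  hence D: "real_of_int \<bar>D n\<bar> = d" by (simp only: d_def of_int_diff of_int_mult of_int_numeral of_int_of_nat_eq of_int_1)
  have l: "l n = pi * sqrt d / 6" unfolding Defs.l_def D ..
  hence l3: "l n / 3 = pi * sqrt d / 18" by simp
  \<comment> \<open>Here ln d is positive because d >= 23, and the denominator is an absolute value;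
    hence \<open>q n\<close> is nonnegative, and the estimate with constant 100 implies the stated
    one.\<close>
  have q: "1 \<le> 2 powr q n"
  proof -
    have "0 \<le> q n" unfolding Defs.q_def D using d by (intro divide_nonneg_nonneg) auto
    thus ?thesis by (rule ge_one_powr_ge_zero[rotated]) simp
  qed
  have "\<bar>real_of_int (\<alpha> n) - main n\<bar> = \<bar>(-1) ^ n * (real_of_int (\<alpha> n) - main n)\<bar>"
    by (simp add: abs_mult power_abs)
  also have "(-1) ^ n * (real_of_int (\<alpha> n) - main n) = (-1) ^ n * real_of_int (\<alpha> n) + sqrt 6 / sqrt d * exp (pi * sqrt d / 12)"
  proof -
    have main: "main n = - ((-1) ^ n * (sqrt 6 / sqrt d * exp (pi * sqrt d / 12)))"
      unfolding main_def l d_def by simp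
    have "s * (a - (- (s * x))) = s * a + x" if "s * s = 1" for s a x :: real
      using that by (simp add: distrib_left flip: mult.assoc)
    moreover have "(-1 :: real) ^ n * (-1) ^ n = 1" by (simp flip: power_mult_distrib)
    ultimately show ?thesis unfolding main by blast
  qed
  also have "\<bar>\<dots>\<bar> \<le> 100 * d\<^sup>2 * exp (pi * sqrt d / 18)"
    using alpha_asymptotic[OF n] unfolding d_def .
  also have "\<dots> < (4.30 * 10 ^ 23) * 1 * d\<^sup>2 * exp (pi * sqrt d / 18)" using d by simp
  also have "\<dots> \<le> (4.30 * 10 ^ 23) * 2 powr q n * d\<^sup>2 * exp (pi * sqrt d / 18)"
    using q by (intro mult_right_mono mult_left_mono) auto
  finally show "\<bar>(\<lambda>n. real_of_int (\<alpha> n) - (-1) ^ (n + 1) * (sqrt 6 / sqrt (24 * real n - 1)) * exp (l n / 2)) n\<bar> <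
      (4.30 * 10 ^ 23) * 2 powr q n * (real_of_int \<bar>D n\<bar>)\<^sup>2 * exp (l n / 3)"
    unfolding main_def D l3 .
qed

end
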